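(* Let $k\ge1$ be an integer and let $\Phi:\mathbb{N}\to[k,\infty)$ be a function. Let $$\mathcal F_k(\Phi)=\Big\{x\in I:\ \sum_{i=1}^k\deg A_{n+i}(x)\ge \Phi(n)\ \text{for infinitely many } n\in\mathbb{N}\Big\},$$ and let $B\in[0,\infty]$ and $b\in[1,\infty]$ be defined by $$B=\liminf_{n\to\infty}\frac{\Phi(n)}{n},\qquad \log b=\liminf_{n\to\infty}\frac{\log\Phi(n)}{n}.$$ Then $$\dim_{\mathcal H}\mathcal F_k(\Phi)=\begin{cases}1, & \text{if } B=0,\\ \frac1{1+b}, & \text{if } B=\infty,\\ s_k(B), & \text{if } 0<B<\infty,\end{cases}$$ where $\frac{1}{1+b}$ is read as $0$ when $b=\infty$, and where $s_k(B)$ is the unique solution $s$ of the equation $$\sum_{j=1}^\infty\frac{(q-1)q^j}{q^{2js+Bf_k(s)}}=1,$$ with $f_i(s)$ ($i\ge1$) given by the recursion $f_1(s)=s$, $f_{i+1}(s)=\dfrac{s f_i(s)}{1-s+f_i(s)}$ for $i\ge1$.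
   Context: $\mathbb{F}_q$ is a finite field with $q$ elements and $\mathbb{F}_q((z^{-1}))$ is the field of formal Laurent series $x=\sum_{n=v}^\infty c_nz^{-n}$ ($v\in\mathbb Z$, $c_n\in\mathbb{F}_q$), with the non-Archimedean absolute value $|0|_\infty=0$ and $|x|_\infty=q^{-v}$ if $c_v\neq0$ is the first non-zero coefficient. The integer part of $x$ is the polynomial $[x]=\sum_{n=v}^0c_nz^{-n}\in\mathbb{F}_q[z]$. $I=\{x:|x|_\infty<1\}$. The Gauss map $T:I\to I$ is $T(x)=\frac1x-[\frac1x]$ for $x\ne0$, $T(0)=0$. The partial quotients of $x\in I$ are $A_i(x)=[1/T^{i-1}(x)]$, $i\ge1$, defined as long as $T^{i-1}(x)\neq0$; they are polynomials in $\mathbb{F}_q[z]$ of strictly positive degree. An inequality involving $\deg A_{n+1}(x),\dots,\deg A_{n+k}(x)$ is understood to require that these partial quotients are defined. $\dim_{\mathcal H}$ is Hausdorff dimension with respect to the metric $\rho(x,y)=|x-y|_\infty$. The functions $f_i$ are considered for $s\in[0,1]$, and the solution $s_k(B)$ lies in $(1/2,1)$ (the series diverges for $s\le 1/2$). *)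

theory Defs
  imports "HOL-Analysis.Analysis" "HOL-Computational_Algebra.Computational_Algebra"
begin

unbundle fps_syntax

section \<open>Laurent series in the inverse of the variable\<close>

text \<open>
  An element of the field of Laurent series in \<open>z\<inverse>\<close> over \<open>F\<^sub>q\<close> is an element of
  \<open>'a fls\<close>, where \<open>'a\<close> is a finite field with \<open>q = CARD('a)\<close> elements: \<open>fls_X\<close> plays the
  role of \<open>z\<inverse>\<close>, \<open>fls_X_inv\<close> that of \<open>z\<close>, and \<open>x $$ n\<close> is the coefficient of \<open>z\<close> to the
  power \<open>- n\<close>.  The library's \<open>dist\<close> on \<open>fls\<close> uses base 2 instead of base \<open>q\<close>, which would
  change Hausdorff dimensions, so the absolute value and the metric are introduced here.
\<close>

definition fls_absv :: "'a::{field,finite} fls \<Rightarrow> real" where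
  "fls_absv x = (if x = 0 then 0 else real CARD('a) powi (- fls_subdegree x))"

definition fls_rho :: "'a::{field,finite} fls \<Rightarrow> 'a fls \<Rightarrow> real" where
  "fls_rho x y = fls_absv (x - y)"

text \<open>\<open>fls_prpart\<close> omits the constant coefficient, which belongs to the integer part.\<close>

definition int_part :: "'a::{field,finite} fls \<Rightarrow> 'a poly" where
  "int_part x = fls_prpart x + [:x $$ 0:]"

text \<open>The embedding of \<open>F\<^sub>q[z]\<close>: evaluate the polynomial at \<open>z\<close>.\<close>

definition fls_of_poly :: "'a::{field,finite} poly \<Rightarrow> 'a fls" where
  "fls_of_poly p = poly (map_poly fls_const p) fls_X_inv"

lemma coeff_int_part: "coeff (int_part x) n = x $$ (- int n)"
  by (auto simp: int_part_def coeff_pCons split: nat.splits)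

lemma fls_X_inv_times_nth: "(fls_X_inv * (f :: 'a::{field,finite} fls)) $$ n = f $$ (n + 1)"
  by (simp add: fls_X_inv_times_conv_shift)

lemma fls_of_poly_nth: "fls_of_poly p $$ n = (if n \<le> 0 then coeff p (nat (- n)) else 0)"
proof (induction p arbitrary: n)
  case 0
  show ?case by (simp add: fls_of_poly_def)
next
  case (pCons a p)
  have "fls_of_poly (pCons a p) = fls_const a + fls_X_inv * fls_of_poly p"
    using pCons.hyps by (simp add: fls_of_poly_def map_poly_pCons)
  then have "fls_of_poly (pCons a p) $$ n =
      (if n = 0 then a else 0) + (if n + 1 \<le> 0 then coeff p (nat (- (n + 1))) else 0)"
    by (simp add: fls_X_inv_times_nth pCons.IH)
  moreover have "nat (- n) = Suc (nat (- (n + 1)))" if "n + 1 \<le> 0"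
    using that by linarith
  ultimately show ?case by auto
qed

lemma fls_of_poly_int_part_nth:
  "fls_of_poly (int_part x) $$ n = (if n \<le> 0 then x $$ n else 0)"
  by (simp add: fls_of_poly_nth coeff_int_part)


section \<open>Continued fractions\<close>

definition unit_I :: "'a::{field,finite} fls set" where
  "unit_I = {x. fls_absv x < 1}"

definition gauss_map :: "'a::{field,finite} fls \<Rightarrow> 'a fls" where
  "gauss_map x = (if x = 0 then 0 else 1 / x - fls_of_poly (int_part (1 / x)))"

text \<open>Partial quotients are indexed from \<open>i = 1\<close>.\<close>

definition pq_defined :: "'a::{field,finite} fls \<Rightarrow> nat \<Rightarrow> bool" where
  "pq_defined x i \<longleftrightarrow> i \<ge> 1 \<and> (gauss_map ^^ (i - 1)) x \<noteq> 0"

text \<open>Meaningful only under \<open>pq_defined x i\<close>.\<close>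

definition partial_quotient :: "'a::{field,finite} fls \<Rightarrow> nat \<Rightarrow> 'a poly" where
  "partial_quotient x i = int_part (1 / (gauss_map ^^ (i - 1)) x)"

definition F_set :: "nat \<Rightarrow> (nat \<Rightarrow> real) \<Rightarrow> 'a::{field,finite} fls set" where
  "F_set k \<Phi> = {x \<in> unit_I. \<exists>\<^sub>\<infinity>n.
      (\<forall>i\<in>{1..k}. pq_defined x (n + i)) \<and>
      real (\<Sum>i=1..k. degree (partial_quotient x (n + i))) \<ge> \<Phi> n}"


section \<open>Hausdorff dimension with respect to a given metric\<close>

definition ediam :: "('b \<Rightarrow> 'b \<Rightarrow> real) \<Rightarrow> 'b set \<Rightarrow> ennreal" where
  "ediam d U = (SUP x\<in>U. SUP y\<in>U. ennreal (d x y))"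

text \<open>
  The \<open>s\<close>-th power of the diameter, for \<open>s \<ge> 0\<close> and sets of finite diameter, with the usual
  conventions that the empty set contributes 0 and that \<open>0\<^sup>0 = 1\<close> for nonempty sets
  (whereas \<open>0 powr 0 = 0\<close>).
\<close>

definition diam_pow :: "('b \<Rightarrow> 'b \<Rightarrow> real) \<Rightarrow> real \<Rightarrow> 'b set \<Rightarrow> ennreal" where
  "diam_pow d s U =
     (if U = {} then 0 else if s = 0 then 1 else ennreal (enn2real (ediam d U) powr s))"

definition hausdorff_premeasure ::
  "('b \<Rightarrow> 'b \<Rightarrow> real) \<Rightarrow> real \<Rightarrow> real \<Rightarrow> 'b set \<Rightarrow> ennreal" where
  "hausdorff_premeasure d s \<delta> E =
     Inf {(\<Sum>i. diam_pow d s (U i)) | U :: nat \<Rightarrow> 'b set.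
            E \<subseteq> (\<Union>i. U i) \<and> (\<forall>i. ediam d (U i) \<le> ennreal \<delta>)}"

definition hausdorff_measure ::
  "('b \<Rightarrow> 'b \<Rightarrow> real) \<Rightarrow> real \<Rightarrow> 'b set \<Rightarrow> ennreal" where
  "hausdorff_measure d s E = (SUP \<delta>\<in>{0<..}. hausdorff_premeasure d s \<delta> E)"

definition hausdorff_dim :: "('b \<Rightarrow> 'b \<Rightarrow> real) \<Rightarrow> 'b set \<Rightarrow> ereal" where
  "hausdorff_dim d E = Inf {ereal s | s. 0 \<le> s \<and> hausdorff_measure d s E = 0}"


section \<open>The dimensional numbers\<close>

text \<open>The functions \<open>f\<^sub>i\<close> are indexed from \<open>i = 1\<close>; there is no equation for \<open>i = 0\<close>.\<close>

fun f_rec :: "nat \<Rightarrow> real \<Rightarrow> real" where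
  "f_rec (Suc 0) s = s"
| "f_rec (Suc (Suc i)) s = s * f_rec (Suc i) s / (1 - s + f_rec (Suc i) s)"

text \<open>The series over \<open>j \<ge> 1\<close> is summed by shifting the index by one.\<close>

definition solves_eq :: "real \<Rightarrow> nat \<Rightarrow> real \<Rightarrow> real \<Rightarrow> bool" where
  "solves_eq q k B s \<longleftrightarrow> 0 \<le> s \<and> s \<le> 1 \<and>
     (\<lambda>j. let i = Suc j in
        (q - 1) * q ^ i / q powr (2 * real i * s + B * f_rec k s)) sums 1"

definition s_dim :: "real \<Rightarrow> nat \<Rightarrow> real \<Rightarrow> real" where
  "s_dim q k B = (THE s. solves_eq q k B s)"

text \<open>The extended natural logarithm on \<open>(0, \<infinity>]\<close>; here only used on \<open>[1, \<infinity>]\<close>.\<close>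

definition ext_ln :: "ereal \<Rightarrow> ereal" where
  "ext_ln b = (if b = \<infinity> then \<infinity> else ereal (ln (real_of_ereal b)))"

end

theory Submission
  imports Defs "HOL-Probability.Probability"
begin

text \<open>
A finite prefix of \<open>n\<close> partial quotients with sum of degrees \<open>D\<close> confines \<open>x\<close> to a ball on which
the \<open>n\<close>-th iterate of the Gauss map is a similarity of ratio \<open>q\<close> to the power \<open>2 D\<close>.  Hausdorff
contents can therefore be computed digit by digit: prescribing a first digit \<open>A\<close> multiplies the
content by \<open>q\<close> to the power \<open>-2 s deg A\<close>, and summing over all \<open>A\<close> gives the series of the dimension
equation.  Covering the event that \<open>k\<close> consecutive degrees sum up to \<open>L\<close> costs \<open>q\<close> to the power
\<open>-f\<^sub>k(s) L\<close> up to a polynomial factor in \<open>L\<close>.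

For the lower bounds, random digits are chosen independently, with weights proportional to
\<open>q\<close> to the power \<open>-2 s deg A\<close> except on sparse blocks of \<open>k\<close> digits with prescribed degrees, and
the mass distribution principle is applied to the law of the continued fraction.  When \<open>B\<close> is
infinite, only the growth rate \<open>b\<close> of the degrees matters.
\<close>

section \<open>Absolute value and integer part\<close>

text \<open>Origin of \<open>f_rec\<close>: covering all digits of degree at least d by one ball
  costs q^(-s d). Resolving the roughly q^d digits of degree d, each of which scales the rest by
  q^(-2 d), costs q^(-(2 s - 1) d) and leaves the following digits to be covered. A cover of a block
  resolves some digits and treats the next one by a single ball; the degrees that make all these
  options equally expensive lead to f_k(s). Balancing a block of target B n against n free digits,
  each contributing the factor \<open>digit_series q (2 * s)\<close>, yields the equation.

  For infinite B the exponent may be at most 1/2, where the series over free digits diverges. The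
  remedy is to use the size of the next digit: a degree of at least (c - 1) D after a prefix of
  depth D saves the factor q^(-s (c - 1) D). Distributed over the prefix, it replaces the exponent 2
  s of the series by s (1 + c). Convergence for s (1 + c) > 1 is the origin of 1 / (1 + b).\<close>

lemma card_field_ge_2: "2 \<le> CARD('a::{field,finite})"
proof -
  have "card {0, 1 :: 'a} \<le> CARD('a)"
    by (rule card_mono) auto
  then show ?thesis by simp
qed

lemma card_field_gt_1: "1 < real CARD('a::{field,finite})"
  using card_field_ge_2[where 'a='a] by simp

lemma fls_absv_0 [simp]: "fls_absv 0 = 0"
  by (simp add: fls_absv_def)

lemma fls_absv_powr:
  "x \<noteq> 0 \<Longrightarrow> fls_absv (x :: 'a::{field,finite} fls) = real CARD('a) powr (- real_of_int (fls_subdegree x))"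
  by (simp add: fls_absv_def powr_real_of_int' flip: of_int_minus)

lemma fls_absv_pos: "x \<noteq> 0 \<Longrightarrow> 0 < fls_absv (x :: 'a::{field,finite} fls)"
  by (simp add: fls_absv_powr)

lemma fls_absv_nonneg: "0 \<le> fls_absv x"
  by (cases "x = 0") (auto simp: fls_absv_pos less_imp_le)

lemma fls_absv_minus [simp]: "fls_absv (- x) = fls_absv x"
  by (simp add: fls_absv_def)

lemma fls_absv_mult: "fls_absv (x * y) = fls_absv x * fls_absv y"
  by (cases "x = 0 \<or> y = 0") (auto simp: fls_absv_powr powr_add[symmetric])

lemma fls_absv_inverse: "fls_absv (inverse x) = inverse (fls_absv x)"
  by (cases "x = 0") (auto simp: fls_absv_powr powr_minus)

lemma fls_absv_divide: "fls_absv (x / y) = fls_absv x / fls_absv y"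
  by (simp add: divide_inverse fls_absv_mult fls_absv_inverse)

lemma fls_absv_1 [simp]: "fls_absv 1 = 1"
  by (simp add: fls_absv_def)

text \<open>Balls whose radius is an integral power of q are conditions on coefficients; in this
  form ultrametric estimates become equalities of coefficients.\<close>

lemma fls_absv_le_iff:
  "fls_absv (x :: 'a::{field,finite} fls) \<le> real CARD('a) powr (- real_of_int m)
     \<longleftrightarrow> (\<forall>n<m. x $$ n = 0)"
proof (cases "x = 0")
  case False
  have "fls_absv x \<le> real CARD('a) powr (- real_of_int m) \<longleftrightarrow> m \<le> fls_subdegree x"
    using False card_field_gt_1[where 'a='a] by (simp add: fls_absv_powr)
  also have "\<dots> \<longleftrightarrow> (\<forall>n<m. x $$ n = 0)"
    using False fls_subdegree_geI[of x m] by auto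
  finally show ?thesis .
qed simp

lemma fls_absv_less_1_iff: "fls_absv (x :: 'a::{field,finite} fls) < 1 \<longleftrightarrow> (\<forall>n\<le>0. x $$ n = 0)"
proof (cases "x = 0")
  case False
  have "fls_absv x < 1 \<longleftrightarrow> 1 \<le> fls_subdegree x"
    using False card_field_gt_1[where 'a='a] powr_less_cancel_iff[of "real CARD('a)" "- real_of_int (fls_subdegree x)" 0]
    by (auto simp: fls_absv_powr)
  also have "\<dots> \<longleftrightarrow> (\<forall>n\<le>0. x $$ n = 0)"
    using False fls_subdegree_geI[of x 1] by auto
  finally show ?thesis .
qed simp

lemma fls_absv_diff_less_1: "fls_absv x < 1 \<Longrightarrow> fls_absv y < 1 \<Longrightarrow> fls_absv (x - y) < 1"
  by (simp add: fls_absv_less_1_iff)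

lemma fls_absv_add_eq:
  fixes x y :: "'a::{field,finite} fls"
  assumes "fls_absv y < fls_absv x"
  shows "fls_absv (x + y) = fls_absv x"
proof (cases "y = 0")
  case False
  with assms have x: "x \<noteq> 0" by (auto simp: fls_absv_nonneg leD)
  then have "fls_subdegree x < fls_subdegree y"
    using assms False card_field_gt_1[where 'a='a] by (simp add: fls_absv_powr)
  then have "fls_subdegree (x + y) = fls_subdegree x" and "x + y \<noteq> 0"
    using x by (auto intro!: fls_subdegree_eqI fls_nonzeroI[of _ "fls_subdegree x"])
  then show ?thesis using x by (simp add: fls_absv_powr)
qed simp

lemma fls_of_poly_eq_0_iff [simp]: "fls_of_poly p = 0 \<longleftrightarrow> p = 0"
proof
  assume "fls_of_poly p = 0"
  then have "fls_of_poly p $$ (- int n) = 0" for n by simp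
  then show "p = 0" by (auto simp: fls_of_poly_nth poly_eq_iff)
qed (simp add: fls_of_poly_def)

lemma fls_of_poly_diff: "fls_of_poly (p - r) = fls_of_poly p - fls_of_poly r"
  by (rule fls_eqI) (simp add: fls_of_poly_nth)

lemma fls_absv_of_poly:
  assumes "p \<noteq> 0"
  shows "fls_absv (fls_of_poly (p :: 'a::{field,finite} poly)) = real CARD('a) powr real (degree p)"
proof -
  have "fls_subdegree (fls_of_poly p) = - int (degree p)"
    using assms by (intro fls_subdegree_eqI) (auto simp: fls_of_poly_nth intro!: coeff_eq_0)
  then show ?thesis using assms by (simp add: fls_absv_powr)
qed

lemma fls_absv_of_poly_ge_1:
  assumes "p \<noteq> 0"
  shows "1 \<le> fls_absv (fls_of_poly (p :: 'a::{field,finite} poly))"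
  using card_field_gt_1[where 'a='a] by (simp add: fls_absv_of_poly[OF assms] ge_one_powr_ge_zero)

lemma int_part_of_poly_add:
  assumes "fls_absv y < 1"
  shows "int_part (fls_of_poly p + y) = p"
  using assms by (intro poly_eqI) (auto simp: coeff_int_part fls_of_poly_nth fls_absv_less_1_iff)

lemma fls_absv_frac_part: "fls_absv (x - fls_of_poly (int_part x)) < 1"
  by (simp add: fls_absv_less_1_iff fls_of_poly_int_part_nth)

lemma fls_rho_nonneg: "0 \<le> fls_rho x y"
  by (simp add: fls_rho_def fls_absv_nonneg)

section \<open>Digits of continued fractions\<close>

text \<open>Index 0 is the first partial quotient: an index counts the applications of the Gauss
  map, one less than in \<open>partial_quotient\<close>.\<close>

definition digit :: "'a::{field,finite} fls \<Rightarrow> nat \<Rightarrow> 'a poly" where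
  "digit x n = int_part (1 / (gauss_map ^^ n) x)"

definition infinite_expansion :: "'a::{field,finite} fls set" where
  "infinite_expansion = {x \<in> unit_I. \<forall>n. (gauss_map ^^ n) x \<noteq> 0}"

lemma digit_Suc: "digit x (Suc n) = digit (gauss_map x) n"
  by (simp add: digit_def funpow_swap1)

lemma digit_add: "digit ((gauss_map ^^ m) x) n = digit x (n + m)"
  by (simp add: digit_def funpow_add)

lemma gauss_map_in_unit_I: "gauss_map x \<in> unit_I"
  by (simp add: gauss_map_def unit_I_def fls_absv_frac_part)

lemma gauss_map_infinite_expansion:
  assumes "x \<in> infinite_expansion"
  shows "gauss_map x \<in> infinite_expansion"
proof -
  have "(gauss_map ^^ n) (gauss_map x) \<noteq> 0" for n
    using assms unfolding infinite_expansion_def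
    by (metis (mono_tags, lifting) funpow_swap1 funpow.simps(2) o_apply mem_Collect_eq)
  then show ?thesis by (simp add: infinite_expansion_def gauss_map_in_unit_I)
qed

lemma funpow_gauss_map_infinite_expansion:
  "x \<in> infinite_expansion \<Longrightarrow> (gauss_map ^^ n) x \<in> infinite_expansion"
  by (induction n) (auto simp: gauss_map_infinite_expansion)

lemma infinite_expansion_nonzero: "x \<in> infinite_expansion \<Longrightarrow> x \<noteq> 0"
  unfolding infinite_expansion_def by (metis (mono_tags, lifting) funpow_0 mem_Collect_eq)

lemma infinite_expansion_absv: "x \<in> infinite_expansion \<Longrightarrow> fls_absv x < 1"
  by (simp add: infinite_expansion_def unit_I_def)

lemma inverse_eq_digit_add:
  "x \<in> infinite_expansion \<Longrightarrow> 1 / x = fls_of_poly (digit x 0) + gauss_map x"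
  by (simp add: digit_def gauss_map_def infinite_expansion_nonzero)

text \<open>In 1 / x = A + T x the tail has absolute value below 1, so A carries the absolute value
  of 1 / x. The latter exceeds 1, which excludes a constant A.\<close>

lemma absv_digit_0:
  fixes x :: "'a::{field,finite} fls"
  assumes x: "x \<in> infinite_expansion"
  shows "fls_absv x = real CARD('a) powr (- real (degree (digit x 0)))"
    and "1 \<le> degree (digit x 0)"
proof -
  have x0: "x \<noteq> 0" using x by (rule infinite_expansion_nonzero)
  have T: "fls_absv (gauss_map x) < 1"
    using x by (intro infinite_expansion_absv gauss_map_infinite_expansion)
  have gt: "1 < fls_absv (1 / x)"
    using infinite_expansion_absv[OF x] fls_absv_pos[OF x0] by (simp add: fls_absv_divide)
  have nz: "digit x 0 \<noteq> 0"
  proof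
    assume "digit x 0 = 0"
    then have "1 / x = gauss_map x" using inverse_eq_digit_add[OF x] by simp
    with T gt show False by simp
  qed
  have eq: "fls_absv (1 / x) = fls_absv (fls_of_poly (digit x 0))"
    unfolding inverse_eq_digit_add[OF x]
    using T fls_absv_of_poly_ge_1[OF nz] by (intro fls_absv_add_eq) auto
  then have e: "1 / fls_absv x = real CARD('a) powr real (degree (digit x 0))"
    using nz by (simp add: fls_absv_divide fls_absv_of_poly)
  then show "fls_absv x = real CARD('a) powr (- real (degree (digit x 0)))"
    by (metis inverse_eq_divide inverse_inverse_eq powr_minus)
  show "1 \<le> degree (digit x 0)"
  proof (rule ccontr)
    assume "\<not> 1 \<le> degree (digit x 0)"
    then have "degree (digit x 0) = 0" by simp
    with e have "1 / fls_absv x = 1" by simp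
    with gt show False by (simp add: fls_absv_divide)
  qed
qed

lemma degree_digit_ge_1:
  assumes "x \<in> infinite_expansion"
  shows "1 \<le> degree (digit x n)"
  using absv_digit_0(2)[OF funpow_gauss_map_infinite_expansion[OF assms, of n]] digit_add[of n x 0] by simp

lemma rho_eq_rho_inverse:
  assumes "x \<noteq> 0" "y \<noteq> 0"
  shows "fls_rho x y = fls_absv x * fls_absv y * fls_rho (1 / x) (1 / y)"
proof -
  have "x - y = - (x * y * (1 / x - 1 / y))"
    using assms by (simp add: field_simps)
  then show ?thesis
    by (simp only: fls_rho_def fls_absv_minus fls_absv_mult)
qed

text \<open>A common first digit cancels in 1 / x - 1 / y and leaves the difference of the tails;
  the factor is |x| |y|. Equality holds, so the inverse branches of the Gauss map are exact
  similarities.\<close>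

lemma rho_same_digit:
  fixes x y :: "'a::{field,finite} fls"
  assumes x: "x \<in> infinite_expansion" and y: "y \<in> infinite_expansion" and eq: "digit x 0 = digit y 0"
  shows "fls_rho x y = real CARD('a) powr (- 2 * real (degree (digit x 0))) * fls_rho (gauss_map x) (gauss_map y)"
proof -
  have "fls_rho (1 / x) (1 / y) = fls_rho (gauss_map x) (gauss_map y)"
    by (simp add: inverse_eq_digit_add[OF x] inverse_eq_digit_add[OF y] eq fls_rho_def)
  then show ?thesis
    using x y by (simp add: rho_eq_rho_inverse[of x y] infinite_expansion_nonzero absv_digit_0 eq flip: powr_add)
qed

text \<open>Distinct digits differ by a nonzero polynomial, which dominates the difference of the
  tails. The degree of that polynomial matters, because digits with common leading coefficients give
  closer points.\<close>

lemma rho_different_digit: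
  fixes x y :: "'a::{field,finite} fls"
  assumes x: "x \<in> infinite_expansion" and y: "y \<in> infinite_expansion" and ne: "digit x 0 \<noteq> digit y 0"
  shows "fls_rho x y = real CARD('a) powr
    (real (degree (digit x 0 - digit y 0)) - real (degree (digit x 0)) - real (degree (digit y 0)))"
proof -
  let ?d = "digit x 0 - digit y 0"
  have less: "fls_absv (gauss_map x - gauss_map y) < 1"
    using x y by (intro fls_absv_diff_less_1 infinite_expansion_absv gauss_map_infinite_expansion)
  have "fls_rho (1 / x) (1 / y) = fls_absv (fls_of_poly ?d + (gauss_map x - gauss_map y))"
    by (simp add: inverse_eq_digit_add[OF x] inverse_eq_digit_add[OF y] fls_rho_def fls_of_poly_diff algebra_simps)
  also have "\<dots> = fls_absv (fls_of_poly ?d)"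
    using less fls_absv_of_poly_ge_1[of ?d] ne by (intro fls_absv_add_eq) auto
  also have "\<dots> = real CARD('a) powr real (degree ?d)"
    using ne by (simp add: fls_absv_of_poly)
  finally show ?thesis
    using x y
    by (simp add: rho_eq_rho_inverse[of x y] infinite_expansion_nonzero absv_digit_0 powr_add[symmetric])
       (simp add: algebra_simps)
qed

text \<open>For digits of positive degree, this is the degree of the denominator of the
  \<open>n\<close>-th convergent.\<close>

definition depth :: "(nat \<Rightarrow> 'a::{field,finite} poly) \<Rightarrow> nat \<Rightarrow> real" where
  "depth \<omega> n = (\<Sum>i<n. real (degree (\<omega> i)))"

lemma rho_same_prefix:
  fixes x y :: "'a::{field,finite} fls"
  assumes "x \<in> infinite_expansion" "y \<in> infinite_expansion" "\<And>i. i < n \<Longrightarrow> digit x i = digit y i"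
  shows "fls_rho x y =
    real CARD('a) powr (- 2 * depth (digit x) n) * fls_rho ((gauss_map ^^ n) x) ((gauss_map ^^ n) y)"
  using assms
proof (induction n arbitrary: x y)
  case 0
  then show ?case by (simp add: depth_def)
next
  case (Suc n)
  have "fls_rho x y = real CARD('a) powr (- 2 * real (degree (digit x 0))) * fls_rho (gauss_map x) (gauss_map y)"
    using Suc.prems by (intro rho_same_digit) auto
  also have "fls_rho (gauss_map x) (gauss_map y) =
     real CARD('a) powr (- 2 * depth (digit (gauss_map x)) n) *
       fls_rho ((gauss_map ^^ n) (gauss_map x)) ((gauss_map ^^ n) (gauss_map y))"
    using Suc.prems by (intro Suc.IH) (auto simp: gauss_map_infinite_expansion simp flip: digit_Suc)
  also have "depth (digit x) (Suc n) = real (degree (digit x 0)) + depth (digit (gauss_map x)) n"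
    unfolding depth_def sum.lessThan_Suc_shift by (simp add: digit_Suc)
  ultimately show ?case
    by (simp add: funpow_swap1 powr_add[symmetric] algebra_simps)
qed

lemma rho_different_at:
  fixes x y :: "'a::{field,finite} fls"
  assumes "x \<in> infinite_expansion" "y \<in> infinite_expansion" "\<And>i. i < n \<Longrightarrow> digit x i = digit y i"
    and "digit x n \<noteq> digit y n"
  shows "fls_rho x y = real CARD('a) powr (- 2 * depth (digit x) n +
    real (degree (digit x n - digit y n)) - real (degree (digit x n)) - real (degree (digit y n)))"
proof -
  have d: "digit ((gauss_map ^^ n) z) 0 = digit z n" for z :: "'a fls"
    by (simp add: digit_add)
  show ?thesis
    using rho_same_prefix[OF assms(1,2,3)] rho_different_digit[of "(gauss_map ^^ n) x" "(gauss_map ^^ n) y"] assms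
    by (simp add: d funpow_gauss_map_infinite_expansion algebra_simps flip: powr_add)
qed

section \<open>Continued fractions with prescribed digits\<close>

text \<open>Unfolded from the front, so that an induction shifts \<open>\<omega>\<close> and meets
  one inverse branch at a time.\<close>

primrec convergent :: "nat \<Rightarrow> (nat \<Rightarrow> 'a::{field,finite} poly) \<Rightarrow> 'a fls" where
  "convergent 0 \<omega> = 0"
| "convergent (Suc n) \<omega> = 1 / (fls_of_poly (\<omega> 0) + convergent n (\<lambda>i. \<omega> (Suc i)))"

lemma absv_cf_step:
  fixes y :: "'a::{field,finite} fls"
  assumes "1 \<le> degree p" "fls_absv y < 1"
  shows "fls_of_poly p + y \<noteq> 0"
    and "fls_absv (1 / (fls_of_poly p + y)) = real CARD('a) powr (- real (degree p))"
    and "fls_absv (1 / (fls_of_poly p + y)) \<le> real CARD('a) powr (- 1)"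
    and "fls_absv (1 / (fls_of_poly p + y)) < 1"
proof -
  have p: "p \<noteq> 0" using assms(1) by auto
  have q: "1 < real CARD('a)" by (rule card_field_gt_1)
  have *: "fls_absv (fls_of_poly p + y) = fls_absv (fls_of_poly p)"
    using assms(2) fls_absv_of_poly_ge_1[OF p] by (intro fls_absv_add_eq) auto
  then show "fls_of_poly p + y \<noteq> 0"
    using fls_absv_of_poly_ge_1[OF p] by (metis fls_absv_0 not_one_le_zero)
  show e: "fls_absv (1 / (fls_of_poly p + y)) = real CARD('a) powr (- real (degree p))"
    unfolding fls_absv_divide * fls_absv_of_poly[OF p] by (simp add: powr_minus field_simps)
  show l: "fls_absv (1 / (fls_of_poly p + y)) \<le> real CARD('a) powr (- 1)"
    unfolding e using assms(1) q by (intro powr_mono) auto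
  also have "\<dots> < 1"
    using q by (simp add: powr_minus field_simps)
  finally show "fls_absv (1 / (fls_of_poly p + y)) < 1" .
qed

lemma rho_cf_step:
  fixes y z :: "'a::{field,finite} fls"
  assumes "1 \<le> degree p" "fls_absv y < 1" "fls_absv z < 1"
  shows "fls_rho (1 / (fls_of_poly p + y)) (1 / (fls_of_poly p + z)) \<le> real CARD('a) powr (- 2) * fls_rho y z"
proof -
  note sy = absv_cf_step[OF assms(1,2)] and sz = absv_cf_step[OF assms(1,3)]
  have "fls_rho (1 / (fls_of_poly p + y)) (1 / (fls_of_poly p + z)) =
     fls_absv (1 / (fls_of_poly p + y)) * fls_absv (1 / (fls_of_poly p + z)) * fls_rho y z"
    by (subst rho_eq_rho_inverse) (use sy(1) sz(1) in \<open>auto simp: fls_rho_def\<close>)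
  also have "\<dots> \<le> (real CARD('a) powr (- 1) * real CARD('a) powr (- 1)) * fls_rho y z"
    by (intro mult_right_mono mult_mono sy(3) sz(3) fls_absv_nonneg fls_rho_nonneg) simp
  finally show ?thesis by (simp only: powr_add[symmetric]) simp
qed

lemma absv_convergent:
  assumes "\<And>i. 1 \<le> degree (\<omega> i)"
  shows "fls_absv (convergent n \<omega>) < 1"
  using assms by (induction n arbitrary: \<omega>) (auto intro: absv_cf_step(4))

text \<open>Each common digit contracts by q^(-2) or more; the weaker rate q^(-n) starts trivially
  at 1 and suffices for convergence.\<close>

lemma rho_convergent:
  fixes \<omega> :: "nat \<Rightarrow> 'a::{field,finite} poly"
  assumes "\<And>i. 1 \<le> degree (\<omega> i)"
  shows "fls_rho (convergent (n + m) \<omega>) (convergent n \<omega>) \<le> real CARD('a) powr (- real n)"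
  using assms
proof (induction n arbitrary: \<omega>)
  case 0
  then show ?case using absv_convergent[of \<omega> m] card_field_gt_1[where 'a='a] by (simp add: fls_rho_def)
next
  case (Suc n)
  let ?\<omega> = "\<lambda>i. \<omega> (Suc i)"
  have "fls_rho (convergent (Suc n + m) \<omega>) (convergent (Suc n) \<omega>) \<le>
      real CARD('a) powr (- 2) * fls_rho (convergent (n + m) ?\<omega>) (convergent n ?\<omega>)"
    using Suc.prems by (simp, intro rho_cf_step absv_convergent) auto
  also have "\<dots> \<le> real CARD('a) powr (- 2) * real CARD('a) powr (- real n)"
    using Suc.prems by (intro mult_left_mono Suc.IH) auto
  also have "\<dots> \<le> real CARD('a) powr (- real (Suc n))"
    using card_field_gt_1[where 'a='a] by (simp flip: powr_add)
  finally show ?case .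
qed

text \<open>The coefficient of index \<open>m\<close> does not change after the convergent of index \<open>m + 1\<close>.\<close>

definition cf :: "(nat \<Rightarrow> 'a::{field,finite} poly) \<Rightarrow> 'a fls" where
  "cf \<omega> = Abs_fls (\<lambda>m. if m \<le> 0 then 0 else convergent (Suc (nat m)) \<omega> $$ m)"

lemma cf_nth: "cf \<omega> $$ m = (if m \<le> 0 then 0 else convergent (Suc (nat m)) \<omega> $$ m)"
  unfolding cf_def by (rule nth_Abs_fls_lower_bound[of 0]) auto

lemma rho_cf_convergent:
  fixes \<omega> :: "nat \<Rightarrow> 'a::{field,finite} poly"
  assumes \<omega>: "\<And>i. 1 \<le> degree (\<omega> i)"
  shows "fls_rho (cf \<omega>) (convergent n \<omega>) \<le> real CARD('a) powr (- real n)"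
proof -
  have "cf \<omega> $$ m = convergent n \<omega> $$ m" if "m < int n" for m
  proof (cases "m \<le> 0")
    case True
    then show ?thesis
      using absv_convergent[of \<omega> n, OF \<omega>] by (simp add: cf_nth fls_absv_less_1_iff)
  next
    case False
    define j where "j = Suc (nat m)"
    have "fls_rho (convergent (j + (n - j)) \<omega>) (convergent j \<omega>) \<le> real CARD('a) powr (- real_of_int (int j))"
      using rho_convergent[of \<omega> j "n - j", OF \<omega>] by simp
    then have "\<forall>i<int j. convergent (j + (n - j)) \<omega> $$ i = convergent j \<omega> $$ i"
      unfolding fls_rho_def fls_absv_le_iff by simp
    moreover have "j + (n - j) = n" "m < int j"
      using that False by (auto simp: j_def)
    ultimately show ?thesis
      using False by (simp add: cf_nth j_def)
  qed
  then have "fls_rho (cf \<omega>) (convergent n \<omega>) \<le> real CARD('a) powr (- real_of_int (int n))"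
    unfolding fls_rho_def fls_absv_le_iff by simp
  then show ?thesis by simp
qed

lemma absv_cf: "fls_absv (cf \<omega>) < 1"
  by (simp add: fls_absv_less_1_iff cf_nth)

lemma fls_eqI_convergent:
  fixes x y :: "'a::{field,finite} fls"
  assumes "\<And>n. fls_rho x (c n) \<le> real CARD('a) powr (- real n)"
    and "\<And>n. fls_rho y (c n) \<le> real CARD('a) powr (- real n)"
  shows "x = y"
proof (rule fls_eqI)
  fix m
  define n where "n = nat (m + 1)"
  have "\<forall>i<int n. x $$ i = c n $$ i" "\<forall>i<int n. y $$ i = c n $$ i"
    using assms(1,2)[of n] fls_absv_le_iff[of "x - c n" "int n"] fls_absv_le_iff[of "y - c n" "int n"]
    by (simp_all add: fls_rho_def)
  moreover have "m < int n" by (simp add: n_def)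
  ultimately show "x $$ m = y $$ m" by simp
qed

text \<open>The recursion of the convergents passes to the limit because the inverse branches
  contract: both sides are within q^(-n) of the convergent of index \<open>Suc n\<close>.\<close>

lemma cf_unfold:
  fixes \<omega> :: "nat \<Rightarrow> 'a::{field,finite} poly"
  assumes \<omega>: "\<And>i. 1 \<le> degree (\<omega> i)"
  shows "cf \<omega> = 1 / (fls_of_poly (\<omega> 0) + cf (\<lambda>i. \<omega> (Suc i)))"
proof (rule fls_eqI_convergent[where c = "\<lambda>n. convergent (Suc n) \<omega>"])
  fix n
  have q: "1 < real CARD('a)" by (rule card_field_gt_1)
  have "fls_rho (cf \<omega>) (convergent (Suc n) \<omega>) \<le> real CARD('a) powr (- real (Suc n))"
    using \<omega> by (rule rho_cf_convergent)
  also have "\<dots> \<le> real CARD('a) powr (- real n)" using q by simp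
  finally show "fls_rho (cf \<omega>) (convergent (Suc n) \<omega>) \<le> real CARD('a) powr (- real n)" .
  have "fls_rho (1 / (fls_of_poly (\<omega> 0) + cf (\<lambda>i. \<omega> (Suc i)))) (convergent (Suc n) \<omega>)
     \<le> real CARD('a) powr (- 2) * fls_rho (cf (\<lambda>i. \<omega> (Suc i))) (convergent n (\<lambda>i. \<omega> (Suc i)))"
    using \<omega> by (simp, intro rho_cf_step absv_convergent absv_cf) auto
  also have "\<dots> \<le> real CARD('a) powr (- 2) * real CARD('a) powr (- real n)"
    using \<omega> by (intro mult_left_mono rho_cf_convergent) auto
  also have "\<dots> \<le> real CARD('a) powr (- real n)"
    using q by (simp flip: powr_add)
  finally show "fls_rho (1 / (fls_of_poly (\<omega> 0) + cf (\<lambda>i. \<omega> (Suc i)))) (convergent (Suc n) \<omega>)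
     \<le> real CARD('a) powr (- real n)" .
qed

lemma
  fixes \<omega> :: "nat \<Rightarrow> 'a::{field,finite} poly"
  assumes \<omega>: "\<And>i. 1 \<le> degree (\<omega> i)"
  shows gauss_map_cf: "gauss_map (cf \<omega>) = cf (\<lambda>i. \<omega> (Suc i))"
    and digit_0_cf: "digit (cf \<omega>) 0 = \<omega> 0"
    and cf_nonzero: "cf \<omega> \<noteq> 0"
proof -
  show nz: "cf \<omega> \<noteq> 0"
    using absv_cf_step(1)[OF \<omega> absv_cf] by (subst cf_unfold[OF \<omega>]) auto
  have *: "1 / cf \<omega> = fls_of_poly (\<omega> 0) + cf (\<lambda>i. \<omega> (Suc i))"
    by (subst cf_unfold[OF \<omega>]) simp
  show "digit (cf \<omega>) 0 = \<omega> 0"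
    by (simp add: digit_def * int_part_of_poly_add absv_cf)
  show "gauss_map (cf \<omega>) = cf (\<lambda>i. \<omega> (Suc i))"
    using nz by (simp add: gauss_map_def * int_part_of_poly_add absv_cf)
qed

lemma funpow_gauss_map_cf:
  "(\<And>i. 1 \<le> degree (\<omega> i)) \<Longrightarrow> (gauss_map ^^ n) (cf \<omega>) = cf (\<lambda>i. \<omega> (i + n))"
  by (induction n) (auto simp: gauss_map_cf)

lemma digit_cf:
  assumes "\<And>i. 1 \<le> degree (\<omega> i)"
  shows "digit (cf \<omega>) n = \<omega> n"
  using digit_0_cf[of "\<lambda>i. \<omega> (i + n)"] assms digit_add[of n "cf \<omega>" 0] by (simp add: funpow_gauss_map_cf)

lemma cf_in_infinite_expansion:
  "(\<And>i. 1 \<le> degree (\<omega> i)) \<Longrightarrow> cf \<omega> \<in> infinite_expansion"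
  by (simp add: infinite_expansion_def funpow_gauss_map_cf cf_nonzero unit_I_def absv_cf)

section \<open>Counting polynomials\<close>

lemma finite_degree_le: "finite {p :: 'a::{field,finite} poly. degree p \<le> n}"
  and card_degree_le: "card {p :: 'a::{field,finite} poly. degree p \<le> n} = CARD('a) ^ Suc n"
proof (induction n)
  case 0
  have *: "{p :: 'a poly. degree p \<le> 0} = range (\<lambda>a. [:a:])"
    by (auto elim: degree_eq_zeroE)
  show "finite {p :: 'a poly. degree p \<le> 0}" unfolding * by simp
  show "card {p :: 'a poly. degree p \<le> 0} = CARD('a) ^ Suc 0"
    unfolding * by (subst card_image) (auto simp: inj_on_def)
next
  case (Suc n)
  have *: "{p :: 'a poly. degree p \<le> Suc n} = (\<lambda>(a, p). pCons a p) ` (UNIV \<times> {p. degree p \<le> n})"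
  proof (rule set_eqI, rule iffI)
    fix p :: "'a poly" assume "p \<in> {p. degree p \<le> Suc n}"
    then show "p \<in> (\<lambda>(a, p). pCons a p) ` (UNIV \<times> {p. degree p \<le> n})"
      by (cases p) (force simp: degree_pCons_eq_if split: if_splits)
  qed (auto simp: degree_pCons_eq_if)
  show "finite {p :: 'a poly. degree p \<le> Suc n}" unfolding * using Suc by simp
  have "inj_on (\<lambda>(a, p :: 'a poly). pCons a p) (UNIV \<times> {p. degree p \<le> n})"
    by (auto simp: inj_on_def)
  then show "card {p :: 'a poly. degree p \<le> Suc n} = CARD('a) ^ Suc (Suc n)"
    unfolding * by (subst card_image) (auto simp: card_cartesian_product Suc)
qed

lemma finite_degree_eq: "finite {p :: 'a::{field,finite} poly. degree p = n}"
  by (rule finite_subset[OF _ finite_degree_le[of n]]) auto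

lemma card_degree_eq:
  assumes "1 \<le> n"
  shows "real (card {p :: 'a::{field,finite} poly. degree p = n}) = (real CARD('a) - 1) * real CARD('a) ^ n"
proof -
  obtain m where m: "n = Suc m" using assms by (cases n) auto
  have *: "{p :: 'a poly. degree p = n} = {p. degree p \<le> Suc m} - {p. degree p \<le> m}"
    using m by auto
  have "card {p :: 'a poly. degree p = n} = CARD('a) ^ Suc n - CARD('a) ^ n"
    unfolding * by (subst card_Diff_subset) (auto simp: finite_degree_le card_degree_le m)
  moreover have "CARD('a) ^ n \<le> CARD('a) ^ Suc n"
    by (rule power_increasing) auto
  ultimately show ?thesis by (simp add: of_nat_diff algebra_simps)
qed

section \<open>Hausdorff content\<close>

text \<open>The radii are carried along explicitly, so that a cover can be rescaled without computing
  diameters.\<close>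

definition covers :: "(nat \<Rightarrow> 'a::{field,finite} fls set) \<Rightarrow> (nat \<Rightarrow> real) \<Rightarrow> 'a fls set \<Rightarrow> bool" where
  "covers U r E \<longleftrightarrow> E \<subseteq> (\<Union>i. U i) \<and> (\<forall>i. 0 \<le> r i \<and> (\<forall>x\<in>U i. \<forall>y\<in>U i. fls_rho x y \<le> r i))"

text \<open>The radii are not bounded, unlike in the premeasure. Without a scale, similarities act
  on the content in a simple way, and for s > 0 its vanishing still implies that of the Hausdorff
  measure.\<close>

definition hcontent :: "real \<Rightarrow> 'a::{field,finite} fls set \<Rightarrow> ennreal" where
  "hcontent s E = Inf {(\<Sum>i. ennreal (r i powr s)) | U r. covers U r E}"

lemma hcontent_le_suminf: "covers U r E \<Longrightarrow> hcontent s E \<le> (\<Sum>i. ennreal (r i powr s))"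
  unfolding hcontent_def by (intro Inf_lower) blast

lemma hcontent_less_imp:
  assumes "hcontent s E < c"
  obtains U r where "covers U r E" "(\<Sum>i. ennreal (r i powr s)) < c"
  using assms unfolding hcontent_def by (auto simp: Inf_less_iff)

lemma hcontent_mono: "E \<subseteq> F \<Longrightarrow> hcontent s E \<le> hcontent s F"
proof -
  assume "E \<subseteq> F"
  then have "covers U r F \<Longrightarrow> covers U r E" for U r by (auto simp: covers_def)
  then show ?thesis unfolding hcontent_def by (intro Inf_superset_mono) blast
qed

lemma hcontent_le_powr:
  assumes "0 \<le> c" "\<And>x y. x \<in> E \<Longrightarrow> y \<in> E \<Longrightarrow> fls_rho x y \<le> c"
  shows "hcontent s E \<le> ennreal (c powr s)"
proof -
  \<comment> \<open>Padding with empty sets of radius 0 is free, since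
    \<open>0 powr s = 0\<close>.\<close>
  have "covers (\<lambda>i. if i = 0 then E else {}) (\<lambda>i. if i = 0 then c else 0) E"
    using assms by (auto simp: covers_def)
  from hcontent_le_suminf[OF this, of s]
  have "hcontent s E \<le> (\<Sum>i. ennreal ((if i = 0 then c else 0) powr s))" .
  also have "\<dots> = (\<Sum>i\<in>{0::nat}. ennreal ((if i = 0 then c else 0) powr s))"
    by (rule suminf_finite) auto
  finally show ?thesis by simp
qed

lemma hcontent_empty [simp]: "hcontent s {} = 0"
  using hcontent_le_powr[of 0 "{}" s] by simp

lemma ennreal_half_power_sums: "(\<Sum>i. ennreal (e * (1/2) ^ Suc i)) = ennreal e" if "0 \<le> e"
proof (rule suminf_ennreal_eq)
  show "(\<lambda>i. e * (1 / 2) ^ Suc i) sums e"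
    using sums_mult[OF power_half_series, of e] by simp
qed (use that in auto)

lemma hcontent_UN_le: "hcontent s (\<Union>n. E n) \<le> (\<Sum>n. hcontent s (E (n::nat)))"
proof (rule ennreal_le_epsilon)
  fix e :: real assume e: "0 < e" and fin: "(\<Sum>n. hcontent s (E n)) < top"
  have "\<exists>U r. covers U r (E n) \<and> (\<Sum>i. ennreal (r i powr s)) < hcontent s (E n) + ennreal (e * (1/2) ^ Suc n)" for n
  proof -
    have "hcontent s (E n) \<noteq> top"
      using fin ennreal_suminf_lessD[of "\<lambda>n. hcontent s (E n)" top n] by auto
    then have "hcontent s (E n) < hcontent s (E n) + ennreal (e * (1/2) ^ Suc n)"
      using e ennreal_add_left_cancel_less[of "hcontent s (E n)" 0 "ennreal (e * (1/2) ^ Suc n)"]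
      by (simp add: ennreal_less_zero_iff)
    then show ?thesis by (elim hcontent_less_imp) blast
  qed
  then obtain U r where cov: "\<And>n. covers (U n) (r n) (E n)"
    and less: "\<And>n. (\<Sum>i. ennreal (r n i powr s)) < hcontent s (E n) + ennreal (e * (1/2) ^ Suc n)"
    by metis
  have "covers (\<lambda>i. case prod_decode i of (n, j) \<Rightarrow> U n j) (\<lambda>i. case prod_decode i of (n, j) \<Rightarrow> r n j) (\<Union>n. E n)"
    unfolding covers_def
  proof (intro conjI allI subsetI)
    fix x assume "x \<in> (\<Union>n. E n)"
    then obtain n where "x \<in> E n" by blast
    then obtain j where "x \<in> U n j" using cov by (fastforce simp: covers_def)
    then show "x \<in> (\<Union>i. case prod_decode i of (n, j) \<Rightarrow> U n j)"
      by (intro UN_I[of "prod_encode (n, j)"]) auto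
  qed (use cov in \<open>auto simp: covers_def split: prod.split\<close>)
  then have "hcontent s (\<Union>n. E n) \<le> (\<Sum>i. ennreal ((case prod_decode i of (n, j) \<Rightarrow> r n j) powr s))"
    by (rule hcontent_le_suminf)
  also have "\<dots> = (\<Sum>i. (\<lambda>(n, j). ennreal (r n j powr s)) (prod_decode i))"
    by (intro suminf_cong) (auto split: prod.split)
  also have "\<dots> = (\<Sum>n. \<Sum>j. ennreal (r n j powr s))"
    by (rule suminf_ennreal_2dimen) simp
  also have "\<dots> \<le> (\<Sum>n. hcontent s (E n) + ennreal (e * (1/2) ^ Suc n))"
    using less by (intro suminf_le) (auto intro: less_imp_le)
  also have "\<dots> = (\<Sum>n. hcontent s (E n)) + (\<Sum>n. ennreal (e * (1/2) ^ Suc n))"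
    by (rule suminf_add[symmetric]) auto
  also have "\<dots> = (\<Sum>n. hcontent s (E n)) + ennreal e"
    using e by (subst ennreal_half_power_sums) auto
  finally show "hcontent s (\<Union>n. E n) \<le> (\<Sum>n. hcontent s (E n)) + ennreal e" .
qed

lemma hcontent_Un_le: "hcontent s (E \<union> F) \<le> hcontent s E + hcontent s F"
proof -
  let ?G = "\<lambda>n::nat. if n = 0 then E else if n = 1 then F else {}"
  have "E \<union> F \<subseteq> (\<Union>n. ?G n)"
    using UN_upper[of "0::nat" UNIV ?G] UN_upper[of "1::nat" UNIV ?G] by simp
  then have "hcontent s (E \<union> F) \<le> hcontent s (\<Union>n. ?G n)" by (rule hcontent_mono)
  also have "\<dots> \<le> (\<Sum>n. hcontent s (?G n))" by (rule hcontent_UN_le)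
  also have "\<dots> = (\<Sum>n\<in>{0::nat,1}. hcontent s (?G n))" by (rule suminf_finite) auto
  finally show ?thesis by simp
qed

lemma hcontent_finite_UN_le: "finite I \<Longrightarrow> hcontent s (\<Union>i\<in>I. E i) \<le> (\<Sum>i\<in>I. hcontent s (E i))"
proof (induction rule: finite_induct)
  case (insert i I)
  have "hcontent s (\<Union>i\<in>insert i I. E i) \<le> hcontent s (E i) + hcontent s (\<Union>i\<in>I. E i)"
    using hcontent_Un_le[of s "E i" "\<Union>i\<in>I. E i"] by simp
  also have "\<dots> \<le> hcontent s (E i) + (\<Sum>i\<in>I. hcontent s (E i))"
    by (intro add_left_mono insert.IH)
  finally show ?case using insert.hyps by simp
qed simp

section \<open>From contents to Hausdorff measure and dimension\<close>

lemma ediam_le: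
  assumes "0 \<le> c" "\<And>x y. x \<in> U \<Longrightarrow> y \<in> U \<Longrightarrow> d x y \<le> c"
  shows "ediam d U \<le> ennreal c"
  unfolding ediam_def using assms by (intro SUP_least ennreal_leI) auto

lemma diam_pow_le:
  assumes "0 < s" "0 \<le> c" "\<And>x y. x \<in> U \<Longrightarrow> y \<in> U \<Longrightarrow> d x y \<le> c"
  shows "diam_pow d s U \<le> ennreal (c powr s)"
proof -
  have "enn2real (ediam d U) \<le> c"
    using ediam_le[of c U d] assms(2,3) by (intro enn2real_leI) auto
  then show ?thesis using assms(1) by (auto simp: diam_pow_def intro!: ennreal_leI powr_mono2)
qed

text \<open>A cover of total cost below \<open>\<delta> powr s\<close> has no radius above \<delta>,
  so it is automatically admissible at scale \<delta>.\<close>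

lemma hausdorff_measure_eq_0:
  assumes s: "0 < s" and E: "hcontent s E = 0"
  shows "hausdorff_measure fls_rho s E = 0"
proof -
  have "hausdorff_premeasure fls_rho s \<delta> E \<le> 0 + ennreal e" if "0 < \<delta>" "0 < e" for \<delta> e
  proof -
    define e' where "e' = min e (\<delta> powr s)"
    have "0 < e'" using that by (simp add: e'_def)
    then have "hcontent s E < ennreal e'" by (simp add: E)
    then obtain U r where cov: "covers U r E" and less: "(\<Sum>i. ennreal (r i powr s)) < ennreal e'"
      by (rule hcontent_less_imp)
    have r: "0 \<le> r i" and U: "\<And>x y. x \<in> U i \<Longrightarrow> y \<in> U i \<Longrightarrow> fls_rho x y \<le> r i" for i
      using cov by (auto simp: covers_def)
    have r_le: "r i \<le> \<delta>" for i
    proof -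
      have "ennreal (r i powr s) < ennreal e'" using less by (rule ennreal_suminf_lessD)
      then have "r i powr s < \<delta> powr s"
        by (simp add: e'_def ennreal_less_iff)
      then show ?thesis
        using s \<open>0 < \<delta>\<close> powr_mono2[of s \<delta> "r i"] by force
    qed
    have "ediam fls_rho (U i) \<le> ennreal \<delta>" for i
      using \<open>0 < \<delta>\<close> order.trans[OF U r_le] by (intro ediam_le) auto
    then have "hausdorff_premeasure fls_rho s \<delta> E \<le> (\<Sum>i. diam_pow fls_rho s (U i))"
      using cov unfolding hausdorff_premeasure_def by (intro Inf_lower) (auto simp: covers_def)
    also have "\<dots> \<le> (\<Sum>i. ennreal (r i powr s))"
      using r U s by (intro suminf_le diam_pow_le) auto
    also have "\<dots> \<le> ennreal e'" using less by simp
    also have "\<dots> \<le> ennreal e" by (intro ennreal_leI) (simp add: e'_def)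
    finally show ?thesis by simp
  qed
  then have le: "hausdorff_premeasure fls_rho s \<delta> E \<le> 0" if "0 < \<delta>" for \<delta>
    by (rule ennreal_le_epsilon) (use that in auto)
  have "hausdorff_measure fls_rho s E \<le> 0"
    unfolding hausdorff_measure_def using le by (intro SUP_least) simp
  then show ?thesis by simp
qed

lemma hausdorff_dim_le:
  assumes "0 < s" "hcontent s E = 0"
  shows "hausdorff_dim fls_rho E \<le> ereal s"
  unfolding hausdorff_dim_def
  using assms hausdorff_measure_eq_0[of s E] by (intro Inf_lower) (auto intro: less_imp_le)

text \<open>The convergence half of the Borel-Cantelli lemma for contents: the limsup set lies in
  every tail union, and the tails of a convergent series tend to 0.\<close>

lemma hcontent_eq_0_limsup:
  assumes sum: "summable c" and c0: "\<And>n. 0 \<le> c n"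
    and le: "\<And>n. N0 \<le> n \<Longrightarrow> hcontent s (E n) \<le> ennreal (c n)"
    and sub: "F \<subseteq> {x. \<exists>\<^sub>\<infinity>n. x \<in> E n}"
  shows "hcontent s F = 0"
proof -
  have "hcontent s F \<le> 0 + ennreal e" if e: "0 < e" for e
  proof -
    obtain N where N: "\<And>n. N \<le> n \<Longrightarrow> norm (\<Sum>i. c (i + n)) < e"
      using suminf_exist_split[OF e sum] by blast
    define m where "m = max N N0"
    have "F \<subseteq> (\<Union>n. E (n + m))"
    proof
      fix x assume "x \<in> F"
      then have "\<exists>\<^sub>\<infinity>n. x \<in> E n" using sub by blast
      then obtain n where "m \<le> n" "x \<in> E n" unfolding INFM_nat_le by blast
      then show "x \<in> (\<Union>n. E (n + m))" by (intro UN_I[of "n - m"]) auto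
    qed
    then have "hcontent s F \<le> hcontent s (\<Union>n. E (n + m))" by (rule hcontent_mono)
    also have "\<dots> \<le> (\<Sum>n. hcontent s (E (n + m)))" by (rule hcontent_UN_le)
    also have "\<dots> \<le> (\<Sum>n. ennreal (c (n + m)))"
      by (intro suminf_le le) (auto simp: m_def)
    also have "\<dots> = ennreal (\<Sum>n. c (n + m))"
      using sum c0 by (intro suminf_ennreal2 c0) (simp add: summable_iff_shift)
    also have "\<dots> \<le> ennreal e"
      using N[of m] by (intro ennreal_leI) (auto simp: m_def)
    finally show ?thesis by simp
  qed
  then have "hcontent s F \<le> 0" by (rule ennreal_le_epsilon)
  then show ?thesis by simp
qed

section \<open>Contents of sets described by digits\<close>

lemma hcontent_degree_ge:
  "hcontent s {x :: 'a::{field,finite} fls. x \<in> infinite_expansion \<and> L \<le> real (degree (digit x 0))}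
     \<le> ennreal (real CARD('a) powr (- L * s))" if "0 < s"
proof -
  let ?E = "{x :: 'a fls. x \<in> infinite_expansion \<and> L \<le> real (degree (digit x 0))}"
  have q: "1 < real CARD('a)" by (rule card_field_gt_1)
  have "fls_rho x y \<le> real CARD('a) powr (- L)" if x: "x \<in> ?E" and y: "y \<in> ?E" for x y
  proof (cases "x = y")
    case False

    \<comment> \<open>Rounding up excludes no integral degree and provides the integral exponent
      that the coefficientwise description of balls requires.\<close>
    define m where "m = \<lceil>L\<rceil>"
    have *: "fls_absv z \<le> real CARD('a) powr (- real_of_int m)" if "z \<in> ?E" for z
    proof -
      have "m \<le> int (degree (digit z 0))" using that by (simp add: m_def ceiling_le_iff)
      then have "real_of_int m \<le> real (degree (digit z 0))" by linarith
      then show ?thesis using that q absv_digit_0(1)[of z] by simp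
    qed
    have "fls_absv (x - y) \<le> real CARD('a) powr (- real_of_int m)"
      using *[OF x] *[OF y] unfolding fls_absv_le_iff by simp
    also have "\<dots> \<le> real CARD('a) powr (- L)" using q by (simp add: m_def)
    finally show ?thesis by (simp add: fls_rho_def)
  qed (simp add: fls_rho_def)
  then have "hcontent s ?E \<le> ennreal ((real CARD('a) powr (- L)) powr s)"
    by (intro hcontent_le_powr) auto
  then show ?thesis by (simp add: powr_powr)
qed

text \<open>Pulling a cover back along one inverse branch multiplies all radii by q^(-2 deg
  A).\<close>

lemma hcontent_first_digit:
  "hcontent s {x :: 'a::{field,finite} fls. x \<in> infinite_expansion \<and> digit x 0 = A \<and> gauss_map x \<in> E}
     \<le> ennreal (real CARD('a) powr (- 2 * real (degree A) * s)) * hcontent s E"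
proof -
  let ?c = "real CARD('a) powr (- 2 * real (degree A))"
  let ?E = "{x :: 'a fls. x \<in> infinite_expansion \<and> digit x 0 = A \<and> gauss_map x \<in> E}"
  have c: "0 < ?c" by simp
  have cs: "real CARD('a) powr (- 2 * real (degree A) * s) = ?c powr s" by (simp add: powr_powr)
  have "hcontent s ?E \<le> (\<Sum>i. ennreal (?c powr s) * ennreal (r i powr s))" if "covers U r E" for U r
  proof -
    have r: "0 \<le> r i" for i using that by (auto simp: covers_def)
    have "covers (\<lambda>i. {x \<in> infinite_expansion. digit x 0 = A \<and> gauss_map x \<in> U i}) (\<lambda>i. ?c * r i) ?E"
      unfolding covers_def
    proof (intro conjI allI ballI subsetI)
      fix x assume "x \<in> ?E"
      then show "x \<in> (\<Union>i. {x \<in> infinite_expansion. digit x 0 = A \<and> gauss_map x \<in> U i})"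
        using that by (auto simp: covers_def)
    next
      fix i x y
      assume x: "x \<in> {x \<in> infinite_expansion. digit x 0 = A \<and> gauss_map x \<in> U i}"
        and y: "y \<in> {x \<in> infinite_expansion. digit x 0 = A \<and> gauss_map x \<in> U i}"
      have "fls_rho x y = ?c * fls_rho (gauss_map x) (gauss_map y)"
        using x y rho_same_digit[of x y] by simp
      also have "\<dots> \<le> ?c * r i"
        using x y that by (intro mult_left_mono) (auto simp: covers_def)
      finally show "fls_rho x y \<le> ?c * r i" .
    qed (use r in auto)
    then have "hcontent s ?E \<le> (\<Sum>i. ennreal ((?c * r i) powr s))"
      by (rule hcontent_le_suminf)
    also have "\<dots> = (\<Sum>i. ennreal (?c powr s) * ennreal (r i powr s))"
      by (intro suminf_cong) (simp add: powr_mult r flip: ennreal_mult)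
    finally show ?thesis .
  qed
  \<comment> \<open>The factor is moved to the left before the infimum over covers of
    \<open>E\<close> is taken, and back afterwards; it is neither 0 nor infinite.\<close>
  then have "hcontent s ?E / ennreal (?c powr s) \<le> (\<Sum>i. ennreal (r i powr s))" if "covers U r E" for U r
    using that by (intro divide_le_posI_ennreal) (auto simp: mult.commute)
  then have "hcontent s ?E / ennreal (?c powr s) \<le> hcontent s E"
    unfolding hcontent_def[of s E] by (intro Inf_greatest) blast
  then have "ennreal (?c powr s) * (hcontent s ?E / ennreal (?c powr s)) \<le> ennreal (?c powr s) * hcontent s E"
    by (rule mult_left_mono) simp
  moreover have "ennreal (?c powr s) * (hcontent s ?E / ennreal (?c powr s)) = hcontent s ?E"
    using c mult_divide_eq_ennreal[of "ennreal (?c powr s)" "hcontent s ?E"]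
    by (simp only: ennreal_times_divide mult.commute[of "ennreal (?c powr s)"]) simp
  ultimately show ?thesis unfolding cs by simp
qed

section \<open>The series of the dimension equation\<close>

text \<open>For u > 1, the sum of q^(-u deg A) over all polynomials A of positive degree, of which
  (q - 1) q^j have degree j. The closed form makes the monotonicity in u visible.\<close>

definition digit_series :: "real \<Rightarrow> real \<Rightarrow> real" where
  "digit_series q u = (q - 1) / (q powr (u - 1) - 1)"

lemma digit_series_sums:
  assumes "1 < q" "1 < u"
  shows "(\<lambda>j. (q - 1) * q powr (real (Suc j) * (1 - u))) sums digit_series q u"
proof -
  define z where "z = q powr (1 - u)"
  have z: "0 < z" "z < 1" using assms by (auto simp: z_def powr_less_one)
  have "(\<lambda>j. (q - 1) * (z * z ^ j)) sums ((q - 1) * (z * (1 / (1 - z))))"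
    using z by (intro sums_mult geometric_sums) auto
  moreover have "q powr (real (Suc j) * (1 - u)) = z * z ^ j" for j
  proof -
    have "z * z ^ j = z powr real (Suc j)"
      using z by (simp only: powr_realpow power_Suc)
    then show ?thesis by (simp add: z_def powr_powr mult.commute)
  qed
  moreover have "(q - 1) * (z * (1 / (1 - z))) = digit_series q u"
  proof -
    have "q powr (u - 1) - 1 = (1 - z) / z"
      using z by (simp add: z_def powr_minus_divide[symmetric] diff_divide_distrib)
    then show ?thesis by (simp add: digit_series_def)
  qed
  ultimately show ?thesis by simp
qed

lemma digit_series_pos: "1 < q \<Longrightarrow> 1 < u \<Longrightarrow> 0 < digit_series q u"
  by (simp add: digit_series_def)

section \<open>Upper bounds for contents\<close>

text \<open>The common step of the recursions over digits: (q - 1) q^j first digits have degree j,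
  each with ratio q^(-2 j). The set of tails may depend on j, because the first digit may use up
  part of a target.\<close>

lemma hcontent_first_digit_le:
  fixes F :: "'a::{field,finite} fls set"
  assumes F: "F \<subseteq> infinite_expansion"
    and tail: "\<And>x. x \<in> F \<Longrightarrow> gauss_map x \<in> E (degree (digit x 0))"
    and c0: "\<And>j. 1 \<le> j \<Longrightarrow> 0 \<le> c j"
    and c: "\<And>j. 1 \<le> j \<Longrightarrow> hcontent s (E j) \<le> ennreal (c j)"
  shows "hcontent s F \<le>
    (\<Sum>j. ennreal ((real CARD('a) - 1) * real CARD('a) powr (real (Suc j) * (1 - 2 * s)) * c (Suc j)))"
proof -
  let ?q = "real CARD('a)"
  let ?D = "\<lambda>A. {x :: 'a fls. x \<in> infinite_expansion \<and> digit x 0 = A \<and> gauss_map x \<in> E (degree A)}"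
  let ?P = "\<lambda>j. {A :: 'a poly. degree A = Suc j}"
  have q: "1 < ?q" by (rule card_field_gt_1)
  have "F \<subseteq> (\<Union>j. \<Union>A\<in>?P j. ?D A)"
  proof
    fix x assume x: "x \<in> F"
    then have "1 \<le> degree (digit x 0)" using F degree_digit_ge_1[of x 0] by blast
    then have "digit x 0 \<in> ?P (degree (digit x 0) - 1)" by simp
    then show "x \<in> (\<Union>j. \<Union>A\<in>?P j. ?D A)" using x F tail by blast
  qed
  then have "hcontent s F \<le> hcontent s (\<Union>j. \<Union>A\<in>?P j. ?D A)" by (rule hcontent_mono)
  also have "\<dots> \<le> (\<Sum>j. hcontent s (\<Union>A\<in>?P j. ?D A))" by (rule hcontent_UN_le)
  also have "\<dots> \<le> (\<Sum>j. ennreal ((?q - 1) * ?q powr (real (Suc j) * (1 - 2 * s)) * c (Suc j)))"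
  proof (intro suminf_le allI)
    fix j
    have "hcontent s (\<Union>A\<in>?P j. ?D A) \<le> (\<Sum>A\<in>?P j. hcontent s (?D A))"
      by (intro hcontent_finite_UN_le finite_degree_eq)
    also have "\<dots> \<le> (\<Sum>A\<in>?P j. ennreal (?q powr (- 2 * real (Suc j) * s) * c (Suc j)))"
    proof (intro sum_mono)
      fix A assume A: "A \<in> ?P j"
      have "hcontent s (?D A) \<le> ennreal (?q powr (- 2 * real (degree A) * s)) * hcontent s (E (degree A))"
        by (rule hcontent_first_digit)
      also have "\<dots> \<le> ennreal (?q powr (- 2 * real (degree A) * s)) * ennreal (c (degree A))"
        using A by (intro mult_left_mono c) auto
      also have "\<dots> = ennreal (?q powr (- 2 * real (Suc j) * s) * c (Suc j))"
        using A c0 by (simp add: ennreal_mult)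
      finally show "hcontent s (?D A) \<le> ennreal (?q powr (- 2 * real (Suc j) * s) * c (Suc j))" .
    qed
    also have "\<dots> = ennreal (real (card (?P j)) * (?q powr (- 2 * real (Suc j) * s) * c (Suc j)))"
      using c0 by (simp add: ennreal_mult ennreal_of_nat_eq_real_of_nat)
    also have "real (card (?P j)) * (?q powr (- 2 * real (Suc j) * s) * c (Suc j))
      = (?q - 1) * (?q powr real (Suc j) * ?q powr (- 2 * real (Suc j) * s)) * c (Suc j)"
      using q card_degree_eq[of "Suc j", where 'a='a] by (simp only: powr_realpow)
    also have "?q powr real (Suc j) * ?q powr (- 2 * real (Suc j) * s) = ?q powr (real (Suc j) * (1 - 2 * s))"
      by (simp add: powr_add[symmetric] algebra_simps)
    finally show "hcontent s (\<Union>A\<in>?P j. ?D A) \<le> ennreal ((?q - 1) * ?q powr (real (Suc j) * (1 - 2 * s)) * c (Suc j))" .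
  qed auto
  finally show ?thesis .
qed

text \<open>A first digit of degree j raises the threshold \<open>\<kappa>\<close> of the tail by t
  j, and the resulting factor q^(-t j) shifts the exponent of the series from 2 s to 2 s + t. A
  large t thus gives convergence even for s at most 1/2. With an empty prefix the degree is at least
  \<kappa> / s, which costs q^(-\<kappa>).\<close>

lemma hcontent_degree_ge_depth:
  assumes s: "0 < s" "1 < 2 * s + t"
  shows "hcontent s {x :: 'a::{field,finite} fls. x \<in> infinite_expansion \<and>
           \<kappa> + t * depth (digit x) n \<le> s * real (degree (digit x n))}
    \<le> ennreal (real CARD('a) powr (- \<kappa>) * digit_series (real CARD('a)) (2 * s + t) ^ n)"
proof (induction n arbitrary: \<kappa>)
  case 0
  have "{x :: 'a fls. x \<in> infinite_expansion \<and> \<kappa> + t * depth (digit x) 0 \<le> s * real (degree (digit x 0))}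
      = {x. x \<in> infinite_expansion \<and> \<kappa> / s \<le> real (degree (digit x 0))}"
    using s by (simp add: depth_def field_simps)
  then show ?case using hcontent_degree_ge[of s "\<kappa> / s", where 'a='a] s by simp
next
  case (Suc n)
  let ?q = "real CARD('a)" and ?Z = "digit_series (real CARD('a)) (2 * s + t)"
  let ?E = "\<lambda>j. {x :: 'a fls. x \<in> infinite_expansion \<and>
       \<kappa> + t * real j + t * depth (digit x) n \<le> s * real (degree (digit x n))}"
  let ?F = "{x :: 'a fls. x \<in> infinite_expansion \<and>
       \<kappa> + t * depth (digit x) (Suc n) \<le> s * real (degree (digit x (Suc n)))}"
  have q: "1 < ?q" by (rule card_field_gt_1)
  have Z: "0 < ?Z" using q s(2) by (rule digit_series_pos)
  have "hcontent s ?F \<le> (\<Sum>j. ennreal ((?q - 1) * ?q powr (real (Suc j) * (1 - 2 * s)) *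
       (?q powr (- (\<kappa> + t * real (Suc j))) * ?Z ^ n)))"
  proof (rule hcontent_first_digit_le[where E = ?E])
    fix x assume x: "x \<in> ?F"
    have "depth (digit x) (Suc n) = real (degree (digit x 0)) + depth (digit (gauss_map x)) n"
      unfolding depth_def sum.lessThan_Suc_shift by (simp add: digit_Suc)
    then show "gauss_map x \<in> ?E (degree (digit x 0))"
      using x by (simp add: gauss_map_infinite_expansion digit_Suc algebra_simps)
  next
    fix j show "hcontent s (?E j) \<le> ennreal (?q powr (- (\<kappa> + t * real j)) * ?Z ^ n)"
      by (rule Suc.IH)
  qed (use Z in \<open>simp_all add: less_imp_le\<close>)
  also have "\<dots> = (\<Sum>j. ennreal ((?q powr (- \<kappa>) * ?Z ^ n) * ((?q - 1) * ?q powr (real (Suc j) * (1 - (2 * s + t))))))"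
  proof (intro suminf_cong arg_cong[where f = ennreal])
    fix j
    have "?q powr (real (Suc j) * (1 - 2 * s)) * ?q powr (- (\<kappa> + t * real (Suc j)))
        = ?q powr (- \<kappa>) * ?q powr (real (Suc j) * (1 - (2 * s + t)))"
      unfolding powr_add[symmetric] by (simp add: algebra_simps)
    moreover have "a * b * (c * d) = a * (b * c) * d" "(e * d) * (a * g) = a * (e * g) * d" for a b c d e g :: real
      by simp_all
    ultimately show "(?q - 1) * ?q powr (real (Suc j) * (1 - 2 * s)) * (?q powr (- (\<kappa> + t * real (Suc j))) * ?Z ^ n)
        = (?q powr (- \<kappa>) * ?Z ^ n) * ((?q - 1) * ?q powr (real (Suc j) * (1 - (2 * s + t))))"
      by (simp only:)
  qed
  also have "\<dots> = ennreal ((?q powr (- \<kappa>) * ?Z ^ n) * ?Z)"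
    using q Z s by (intro suminf_ennreal_eq sums_mult digit_series_sums) auto
  finally show ?case by (simp add: mult_ac)
qed

text \<open>The first \<open>n\<close> digits are unrestricted, and each contributes one factor of
  the series.\<close>

lemma hcontent_funpow_gauss_map:
  fixes E :: "'a::{field,finite} fls set"
  assumes s: "1 < 2 * s" and c: "0 \<le> c" "hcontent s E \<le> ennreal c"
  shows "hcontent s {x \<in> infinite_expansion. (gauss_map ^^ n) x \<in> E}
    \<le> ennreal (c * digit_series (real CARD('a)) (2 * s) ^ n)"
proof (induction n)
  case 0
  have "hcontent s {x \<in> infinite_expansion. (gauss_map ^^ 0) x \<in> E} \<le> hcontent s E"
    by (rule hcontent_mono) auto
  with c show ?case by simp
next
  case (Suc n)
  let ?q = "real CARD('a)" and ?Z = "digit_series (real CARD('a)) (2 * s)"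
  have q: "1 < ?q" by (rule card_field_gt_1)
  have Z: "0 < ?Z" using q s by (rule digit_series_pos)
  have "hcontent s {x \<in> infinite_expansion. (gauss_map ^^ Suc n) x \<in> E}
    \<le> (\<Sum>j. ennreal ((?q - 1) * ?q powr (real (Suc j) * (1 - 2 * s)) * (c * ?Z ^ n)))"
    by (rule hcontent_first_digit_le[where E = "\<lambda>_. {x \<in> infinite_expansion. (gauss_map ^^ n) x \<in> E}"])
       (use Suc.IH Z c in \<open>auto simp: gauss_map_infinite_expansion funpow_swap1\<close>)
  also have "\<dots> = (\<Sum>j. ennreal ((c * ?Z ^ n) * ((?q - 1) * ?q powr (real (Suc j) * (1 - 2 * s)))))"
    by (simp add: mult_ac)
  also have "\<dots> = ennreal ((c * ?Z ^ n) * ?Z)"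
    using q Z s c by (intro suminf_ennreal_eq sums_mult digit_series_sums) auto
  finally show ?case by (simp add: mult_ac)
qed

lemma f_rec_pos: "0 < s \<Longrightarrow> s \<le> 1 \<Longrightarrow> 0 < f_rec (Suc k) s"
  by (induction k) (auto intro!: divide_pos_pos mult_pos_pos add_nonneg_pos)

text \<open>2 s - 1 is a fixed point of the recursion, which the values do not cross from above. In
  a block this makes q^(j (1 - 2 s + f)) nondecreasing in j.\<close>

lemma f_rec_ge:
  assumes "0 < s" "s \<le> 1"
  shows "2 * s - 1 \<le> f_rec (Suc k) s"
proof (induction k)
  case (Suc k)
  let ?f = "f_rec (Suc k) s"
  have f: "0 < ?f" using assms by (rule f_rec_pos)
  have "0 \<le> (1 - s) * (?f - (2 * s - 1))"
    using assms Suc by (intro mult_nonneg_nonneg) auto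
  then have "(2 * s - 1) * (1 - s + ?f) \<le> s * ?f"
    by (simp add: algebra_simps)
  then show ?case
    using f assms by (simp add: pos_le_divide_eq)
qed (use assms in simp)

text \<open>The first digit of a block is either of degree at least \<open>\<alpha> L\<close>, or leaves at least
  \<open>L - j \<ge> (1 - \<alpha>) L\<close> to the remaining digits; \<open>\<alpha> = f\<^sub>k / (1 - s + f\<^sub>k)\<close> makes the two contributions
  equal, which is where the recursion for \<open>f\<^sub>k\<close> comes from.\<close>

lemma hcontent_block:
  assumes s: "1/2 < s" "s \<le> 1" and L: "0 \<le> L"
  shows "hcontent s {x :: 'a::{field,finite} fls. x \<in> infinite_expansion \<and>
           L \<le> (\<Sum>i<Suc k. real (degree (digit x i)))}
    \<le> ennreal (real CARD('a) ^ k * (L + 1) ^ k * real CARD('a) powr (- L * f_rec (Suc k) s))"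
  using L
proof (induction k arbitrary: L)
  case 0
  then show ?case using hcontent_degree_ge[of s L, where 'a='a] s by simp
next
  case (Suc k)
  let ?q = "real CARD('a)"
  define f where "f = f_rec (Suc k) s"
  define g where "g = f_rec (Suc (Suc k)) s"
  define \<alpha> where "\<alpha> = f / (1 - s + f)"
  \<comment> \<open>The polynomial prefactor of the induction hypothesis at the full target; it also
    bounds the prefactor at every smaller target \<open>L - j\<close>.\<close>
  define C where "C = ?q ^ k * (L + 1) ^ k"
  have q: "1 < ?q" by (rule card_field_gt_1)
  have f: "0 < f" "2 * s - 1 \<le> f" unfolding f_def using s by (auto intro: f_rec_pos f_rec_ge)
  have g: "g = s * \<alpha>" by (simp add: g_def \<alpha>_def f_def)
  have \<alpha>: "0 < \<alpha>" "\<alpha> \<le> 1" "\<alpha> * (1 - 2 * s + f) = f - s * \<alpha>"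
    using f s by (auto simp: \<alpha>_def field_simps)
  have C: "1 \<le> C" unfolding C_def using q Suc.prems
    by (metis le_add_same_cancel2 less_imp_le mult_ge1_I one_le_power)
  let ?B = "\<lambda>L k. {x :: 'a fls. x \<in> infinite_expansion \<and> L \<le> (\<Sum>i<Suc k. real (degree (digit x i)))}"
  let ?F1 = "{x :: 'a fls. x \<in> infinite_expansion \<and> \<alpha> * L \<le> real (degree (digit x 0))}"
  let ?F2 = "{x \<in> ?B L (Suc k). real (degree (digit x 0)) < \<alpha> * L}"
  \<comment> \<open>Degrees from \<alpha> L on do not occur in \<open>?F2\<close>; the empty set
    gives them cost 0, which leaves a finite sum.\<close>
  let ?E = "\<lambda>j. if real j < \<alpha> * L then ?B (L - real j) k else {}"
  let ?c = "\<lambda>j. if real j < \<alpha> * L then C * ?q powr (- (L - real j) * f) else 0"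
  have le: "L - real j \<ge> 0" if "real j < \<alpha> * L" for j
    using that \<alpha>(2) Suc.prems mult_right_mono[of \<alpha> 1 L] by simp
  have "hcontent s ?F2 \<le> (\<Sum>j. ennreal ((?q - 1) * ?q powr (real (Suc j) * (1 - 2 * s)) * ?c (Suc j)))"
  proof (rule hcontent_first_digit_le[where E = ?E])
    fix x assume x: "x \<in> ?F2"
    then show "gauss_map x \<in> ?E (degree (digit x 0))"
      unfolding sum.lessThan_Suc_shift[of _ "Suc k"]
      by (auto simp: gauss_map_infinite_expansion digit_Suc algebra_simps)
  next
    fix j :: nat
    show "hcontent s (?E j) \<le> ennreal (?c j)"
    proof (cases "real j < \<alpha> * L")
      case True
      have "hcontent s (?B (L - real j) k) \<le>
          ennreal (?q ^ k * (L - real j + 1) ^ k * ?q powr (- (L - real j) * f))"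
        unfolding f_def using le[OF True] by (rule Suc.IH)
      also have "\<dots> \<le> ennreal (C * ?q powr (- (L - real j) * f))"
        unfolding C_def using le[OF True]
        by (intro ennreal_leI mult_right_mono mult_left_mono power_mono) auto
      finally show ?thesis using True by simp
    qed simp
  qed (use C in auto)
  also have "\<dots> \<le> (\<Sum>j. ennreal (if Suc j \<le> nat \<lfloor>L\<rfloor> then (?q - 1) * C * ?q powr (- L * g) else 0))"
  proof (intro suminf_le allI ennreal_leI)
    fix j
    show "(?q - 1) * ?q powr (real (Suc j) * (1 - 2 * s)) * ?c (Suc j)
      \<le> (if Suc j \<le> nat \<lfloor>L\<rfloor> then (?q - 1) * C * ?q powr (- L * g) else 0)"
    proof (cases "real (Suc j) < \<alpha> * L")
      case True
      have jL: "Suc j \<le> nat \<lfloor>L\<rfloor>" using le[OF True] by (simp add: le_nat_floor)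
      have "real (Suc j) * (1 - 2 * s) + - (L - real (Suc j)) * f = real (Suc j) * (1 - 2 * s + f) - L * f"
        by (simp add: algebra_simps)
      \<comment> \<open>The coefficient 1 - 2 s + f is nonnegative by \<open>f_rec_ge\<close>, so
        the worst degree is the largest one, \<alpha> L, where the exponent equals the one for
        \<open>?F1\<close>.\<close>
      also have "\<dots> \<le> (\<alpha> * L) * (1 - 2 * s + f) - L * f"
        using True f(2) by (intro diff_right_mono mult_right_mono) auto
      also have "\<dots> = L * (\<alpha> * (1 - 2 * s + f)) - L * f" by (simp add: algebra_simps)
      also have "\<dots> = - L * g" unfolding \<alpha>(3) g by (simp add: algebra_simps)
      finally have "?q powr (real (Suc j) * (1 - 2 * s) + - (L - real (Suc j)) * f) \<le> ?q powr (- L * g)"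
        using q by simp
      then have "(?q - 1) * C * (?q powr (real (Suc j) * (1 - 2 * s)) * ?q powr (- (L - real (Suc j)) * f))
        \<le> (?q - 1) * C * ?q powr (- L * g)"
        using q C by (intro mult_left_mono) (auto simp: powr_add)
      then show ?thesis using True jL by (simp only: if_True) (simp add: mult_ac)
    qed (use q C in auto)
  qed auto
  also have "\<dots> = (\<Sum>j\<in>{..<nat \<lfloor>L\<rfloor>}. ennreal (if Suc j \<le> nat \<lfloor>L\<rfloor> then (?q - 1) * C * ?q powr (- L * g) else 0))"
    by (rule suminf_finite) auto
  also have "\<dots> = (\<Sum>j\<in>{..<nat \<lfloor>L\<rfloor>}. ennreal ((?q - 1) * C * ?q powr (- L * g)))"
    by (intro sum.cong) auto
  also have "\<dots> = ennreal (real (nat \<lfloor>L\<rfloor>) * ((?q - 1) * C * ?q powr (- L * g)))"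
    using q C by (simp add: ennreal_mult ennreal_of_nat_eq_real_of_nat)
  finally have F2: "hcontent s ?F2 \<le> ennreal (real (nat \<lfloor>L\<rfloor>) * ((?q - 1) * C * ?q powr (- L * g)))" .
  have F1: "hcontent s ?F1 \<le> ennreal (?q powr (- L * g))"
    using hcontent_degree_ge[of s "\<alpha> * L", where 'a='a] s by (simp add: g mult_ac)
  have "hcontent s (?B L (Suc k)) \<le> hcontent s (?F1 \<union> ?F2)"
    by (intro hcontent_mono) auto
  also have "\<dots> \<le> hcontent s ?F1 + hcontent s ?F2" by (rule hcontent_Un_le)
  also have "\<dots> \<le> ennreal (?q powr (- L * g)) + ennreal (real (nat \<lfloor>L\<rfloor>) * ((?q - 1) * C * ?q powr (- L * g)))"
    by (intro add_mono F1 F2)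
  also have "\<dots> = ennreal (?q powr (- L * g) + real (nat \<lfloor>L\<rfloor>) * ((?q - 1) * C * ?q powr (- L * g)))"
    using q C by (intro ennreal_plus[symmetric]) auto
  also have "\<dots> = ennreal ((1 + real (nat \<lfloor>L\<rfloor>) * ((?q - 1) * C)) * ?q powr (- L * g))"
    by (simp add: algebra_simps)
  also have "\<dots> \<le> ennreal (?q ^ Suc k * (L + 1) ^ Suc k * ?q powr (- L * g))"
  proof (intro ennreal_leI mult_right_mono)
    have "1 + real (nat \<lfloor>L\<rfloor>) * ((?q - 1) * C) \<le> 1 + L * ((?q - 1) * C)"
      using q C Suc.prems by (intro add_left_mono mult_right_mono) auto
    also have "\<dots> \<le> ?q * C + L * (?q * C)"
      using q C Suc.prems mult_mono[of 1 ?q 1 C] by (intro add_mono mult_left_mono mult_right_mono) auto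
    also have "\<dots> = ?q ^ Suc k * (L + 1) ^ Suc k" by (simp add: C_def algebra_simps)
    finally show "1 + real (nat \<lfloor>L\<rfloor>) * ((?q - 1) * C) \<le> ?q ^ Suc k * (L + 1) ^ Suc k" .
  qed simp
  finally show ?case by (simp only: g_def)
qed

section \<open>Upper bounds for the dimension\<close>

lemma pq_defined_Suc: "pq_defined x (Suc n) \<longleftrightarrow> (gauss_map ^^ n) x \<noteq> 0"
  by (simp add: pq_defined_def)

lemma partial_quotient_Suc: "partial_quotient x (Suc n) = digit x n"
  by (simp add: partial_quotient_def digit_def)

lemma funpow_gauss_map_eq_0:
  fixes x :: "'a::{field,finite} fls"
  assumes "(gauss_map ^^ n) x = 0" "n \<le> m"
  shows "(gauss_map ^^ m) x = 0"
proof -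
  have "gauss_map (0 :: 'a fls) = 0" by (simp add: gauss_map_def)
  with assms(2) show ?thesis by (induction rule: dec_induct) (simp_all add: assms(1))
qed

text \<open>Zero is absorbing for the Gauss map, so blocks that are defined arbitrarily late force
  all iterates to be nonzero.\<close>

lemma F_set_eq:
  assumes "1 \<le> k"
  shows "F_set k \<Phi> = {x \<in> infinite_expansion. \<exists>\<^sub>\<infinity>n. \<Phi> n \<le> (\<Sum>i<k. real (degree (digit x (n + i))))}"
proof -
  have sum: "real (\<Sum>i=1..k. degree (partial_quotient x (n + i))) = (\<Sum>i<k. real (degree (digit x (n + i))))"
    for x :: "'a fls" and n
    by (simp add: sum.atLeast1_atMost_eq partial_quotient_Suc)
  have "x \<in> F_set k \<Phi> \<longleftrightarrow> x \<in> infinite_expansion \<and> (\<exists>\<^sub>\<infinity>n. \<Phi> n \<le> (\<Sum>i<k. real (degree (digit x (n + i)))))"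
    for x :: "'a fls"
  proof
    assume x: "x \<in> F_set k \<Phi>"
    have inf: "\<exists>\<^sub>\<infinity>n. (\<forall>i\<in>{1..k}. pq_defined x (n + i)) \<and> \<Phi> n \<le> (\<Sum>i<k. real (degree (digit x (n + i))))"
      using x by (simp only: F_set_def sum mem_Collect_eq)
    have "(gauss_map ^^ m) x \<noteq> 0" for m
    proof -
      obtain n where n: "m \<le> n" "\<forall>i\<in>{1..k}. pq_defined x (n + i)"
        using inf unfolding INFM_nat_le by blast
      then have "pq_defined x (Suc n)" using assms by force
      then show ?thesis using funpow_gauss_map_eq_0[of m x n] n(1) by (auto simp: pq_defined_Suc)
    qed
    then have "x \<in> infinite_expansion" using x by (simp add: infinite_expansion_def F_set_def)
    moreover have "\<exists>\<^sub>\<infinity>n. \<Phi> n \<le> (\<Sum>i<k. real (degree (digit x (n + i))))"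
      using inf by (rule INFM_mono) blast
    ultimately show "x \<in> infinite_expansion \<and> (\<exists>\<^sub>\<infinity>n. \<Phi> n \<le> (\<Sum>i<k. real (degree (digit x (n + i)))))" ..
  next
    assume x: "x \<in> infinite_expansion \<and> (\<exists>\<^sub>\<infinity>n. \<Phi> n \<le> (\<Sum>i<k. real (degree (digit x (n + i)))))"
    then have "pq_defined x (n + i)" if "1 \<le> i" for n i
      using that by (simp add: pq_defined_def infinite_expansion_def)
    then show "x \<in> F_set k \<Phi>"
      using x by (simp only: F_set_def sum mem_Collect_eq) (simp add: infinite_expansion_def)
  qed
  then show ?thesis by blast
qed

text \<open>For \<open>\<kappa> = t = 0\<close> the condition on the digit of index \<open>n\<close>
  holds trivially, so the content is at most Z^n, with Z < 1 for s > 1.\<close>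

lemma hcontent_infinite_expansion:
  assumes "1 < s"
  shows "hcontent s (infinite_expansion :: 'a::{field,finite} fls set) = 0"
proof (rule hcontent_eq_0_limsup)
  let ?Z = "digit_series (real CARD('a)) (2 * s)"
  have q: "1 < real CARD('a)" by (rule card_field_gt_1)
  have "real CARD('a) powr 1 < real CARD('a) powr (2 * s - 1)"
    using q assms by (intro powr_less_mono) auto
  then have Z: "0 \<le> ?Z" "?Z < 1"
    using q assms digit_series_pos[of "real CARD('a)" "2 * s"] by (auto simp: digit_series_def)
  then show "summable (\<lambda>n. ?Z ^ n)" and "\<And>n. 0 \<le> ?Z ^ n" by auto
  show "hcontent s (infinite_expansion :: 'a fls set) \<le> ennreal (?Z ^ n)" for n
  proof -
    have "(infinite_expansion :: 'a fls set) \<subseteq> {x. x \<in> infinite_expansion \<and> 0 + 0 * depth (digit x) n \<le> s * real (degree (digit x n))}"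
      using assms by auto
    then have "hcontent s (infinite_expansion :: 'a fls set) \<le> hcontent s \<dots>"
      by (rule hcontent_mono)
    also have "\<dots> \<le> ennreal (real CARD('a) powr (- 0) * digit_series (real CARD('a)) (2 * s + 0) ^ n)"
      using assms by (intro hcontent_degree_ge_depth) auto
    finally show ?thesis using q by simp
  qed
qed auto

lemma hausdorff_dim_F_set_le_1:
  assumes "1 \<le> k"
  shows "hausdorff_dim fls_rho (F_set k \<Phi> :: 'a::{field,finite} fls set) \<le> 1"
proof (rule ereal_le_epsilon2)
  fix e :: real assume "0 < e"
    have "hcontent (1 + e) (F_set k \<Phi> :: 'a fls set) \<le> hcontent (1 + e) (infinite_expansion :: 'a fls set)"
      using assms by (intro hcontent_mono) (auto simp: F_set_eq)
    then have "hcontent (1 + e) (F_set k \<Phi> :: 'a fls set) = 0"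
      using hcontent_infinite_expansion[of "1 + e", where 'a='a] \<open>0 < e\<close> by simp
    then have "hausdorff_dim fls_rho (F_set k \<Phi> :: 'a fls set) \<le> ereal (1 + e)"
      using \<open>0 < e\<close> by (intro hausdorff_dim_le) auto
    then show "hausdorff_dim fls_rho (F_set k \<Phi> :: 'a fls set) \<le> 1 + ereal e"
      by (simp add: one_ereal_def add.commute)
qed

text \<open>With \<open>\<rho>\<close> written as a square, one copy of its root absorbs a linear
  factor and the other serves the induction hypothesis.\<close>

lemma linear_power_times_geometric_bounded:
  fixes B \<rho> :: real
  assumes "0 \<le> B" "0 < \<rho>" "\<rho> < 1"
  shows "\<exists>K\<ge>0. \<forall>n. (B * real n + 1) ^ m * \<rho> ^ n \<le> K"
  using assms(2,3)
proof (induction m arbitrary: \<rho>)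
  case 0
  then show ?case by (intro exI[of _ 1]) (simp add: power_le_one)
next
  case (Suc m)
  define r where "r = sqrt \<rho>"
  have r: "0 < r" "r < 1" "r * r = \<rho>" using Suc.prems by (auto simp: r_def)
  obtain K where K: "0 \<le> K" "\<And>n. (B * real n + 1) ^ m * r ^ n \<le> K"
    using Suc.IH[OF r(1,2)] by blast
  have "(\<lambda>n. B * (real n * r ^ n) + r ^ n) \<longlonglongrightarrow> B * 0 + 0"
    using r by (intro tendsto_intros powser_times_n_limit_0 LIMSEQ_realpow_zero) auto
  then have "Bseq (\<lambda>n. B * (real n * r ^ n) + r ^ n)"
    by (intro convergent_imp_Bseq convergentI)
  then obtain K' where K': "\<And>n. norm (B * (real n * r ^ n) + r ^ n) \<le> K'"
    unfolding Bseq_def by blast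
  have K'': "(B * real n + 1) * r ^ n \<le> K'" for n
    using K'[of n] by (auto simp: algebra_simps abs_le_iff)
  have K'0: "0 \<le> K'" using K'[of 0] norm_ge_zero order.trans by blast
  have "(B * real n + 1) ^ Suc m * \<rho> ^ n \<le> K' * K" for n
  proof -
    have "\<rho> ^ n = r ^ n * r ^ n" using r(3) by (simp add: power_mult_distrib[symmetric])
    then have "(B * real n + 1) ^ Suc m * \<rho> ^ n = ((B * real n + 1) * r ^ n) * ((B * real n + 1) ^ m * r ^ n)"
      by (simp add: mult_ac)
    also have "\<dots> \<le> K' * K"
      using K K'' K'0 r assms(1) by (intro mult_mono) auto
    finally show ?thesis .
  qed
  then show ?case using K'0 K(1) by (intro exI[of _ "K' * K"]) auto
qed

lemma summable_linear_power_times_geometric: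
  fixes B \<rho> :: real
  assumes B: "0 \<le> B" and \<rho>: "0 < \<rho>" "\<rho> < 1"
  shows "summable (\<lambda>n. (B * real n + 1) ^ m * \<rho> ^ n)"
proof -
  define r where "r = sqrt \<rho>"
  have r: "0 < r" "r < 1" "r * r = \<rho>" using \<rho> by (auto simp: r_def)
  obtain K where K: "0 \<le> K" "\<And>n. (B * real n + 1) ^ m * r ^ n \<le> K"
    using linear_power_times_geometric_bounded[OF B r(1,2)] by blast
  show ?thesis
  proof (rule summable_comparison_test')
    show "summable (\<lambda>n. K * r ^ n)" using r by (intro summable_mult) auto
    show "norm ((B * real n + 1) ^ m * \<rho> ^ n) \<le> K * r ^ n" for n
    proof -
      have "\<rho> ^ n = r ^ n * r ^ n" using r(3) by (simp add: power_mult_distrib[symmetric])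
      then have "(B * real n + 1) ^ m * \<rho> ^ n = ((B * real n + 1) ^ m * r ^ n) * r ^ n"
        by simp
      also have "\<dots> \<le> K * r ^ n" using K r by (intro mult_right_mono) auto
      finally show ?thesis using B \<rho> by (simp add: abs_mult)
    qed
  qed
qed

text \<open>The n digits before a block cost Z^n, and the block costs q^(-B f n) up to a polynomial
  in n. By hypothesis the product of the exponential factors is geometric with ratio below
  1.\<close>

lemma hausdorff_dim_F_set_le:
  assumes k: "1 \<le> k" and s: "1/2 < s" "s \<le> 1" and B: "0 \<le> B"
    and less: "digit_series (real CARD('a)) (2 * s) < real CARD('a) powr (B * f_rec k s)"
    and \<Phi>: "\<And>n. N \<le> n \<Longrightarrow> B * real n \<le> \<Phi> n"
  shows "hausdorff_dim fls_rho (F_set k \<Phi> :: 'a::{field,finite} fls set) \<le> ereal s"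
proof (rule hausdorff_dim_le)
  show "0 < s" using s by simp
  obtain k' where k': "k = Suc k'" using k by (cases k) auto
  let ?q = "real CARD('a)"
  define Z where "Z = digit_series ?q (2 * s)"
  define f where "f = f_rec k s"
  define \<rho> where "\<rho> = Z * ?q powr (- B * f)"
  have q: "1 < ?q" by (rule card_field_gt_1)
  have Z: "0 < Z" using q s by (simp add: Z_def digit_series_pos)
  have \<rho>: "0 < \<rho>" "\<rho> < 1"
    using Z q less by (auto simp: \<rho>_def Z_def f_def powr_minus field_simps)
  let ?E = "\<lambda>n. {x :: 'a fls. x \<in> infinite_expansion \<and> B * real n \<le> (\<Sum>i<Suc k'. real (degree (digit x i)))}"
  let ?c = "\<lambda>n. ?q ^ k' * ((B * real n + 1) ^ k' * \<rho> ^ n)"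
  show "hcontent s (F_set k \<Phi> :: 'a fls set) = 0"
  proof (rule hcontent_eq_0_limsup)
    show "summable ?c"
      using B \<rho> by (intro summable_mult summable_linear_power_times_geometric)
    show "0 \<le> ?c n" for n using q B \<rho> by auto
    show "hcontent s {x \<in> infinite_expansion. (gauss_map ^^ n) x \<in> ?E n} \<le> ennreal (?c n)" for n
    proof -
      have "hcontent s (?E n) \<le> ennreal (?q ^ k' * (B * real n + 1) ^ k' * ?q powr (- (B * real n) * f_rec (Suc k') s))"
        using s B by (intro hcontent_block) auto
      then have "hcontent s {x \<in> infinite_expansion. (gauss_map ^^ n) x \<in> ?E n} \<le>
        ennreal (?q ^ k' * (B * real n + 1) ^ k' * ?q powr (- (B * real n) * f_rec (Suc k') s) * Z ^ n)"
        unfolding Z_def using s B q by (intro hcontent_funpow_gauss_map) auto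
      also have "?q powr (- (B * real n) * f_rec (Suc k') s) = (?q powr (- B * f)) ^ n"
        using q by (simp add: f_def k' powr_powr mult_ac flip: powr_realpow)
      finally show ?thesis by (simp add: \<rho>_def power_mult_distrib mult_ac)
    qed
    show "F_set k \<Phi> \<subseteq> {x. \<exists>\<^sub>\<infinity>n. x \<in> {x \<in> infinite_expansion. (gauss_map ^^ n) x \<in> ?E n}}"
    proof
      fix x :: "'a fls" assume "x \<in> F_set k \<Phi>"
      then have x: "x \<in> infinite_expansion"
        and inf: "\<exists>\<^sub>\<infinity>n. \<Phi> n \<le> (\<Sum>i<k. real (degree (digit x (n + i))))"
        using k by (auto simp: F_set_eq)
      have ev: "\<forall>\<^sub>\<infinity>n. B * real n \<le> \<Phi> n" using \<Phi> by (auto simp: MOST_nat_le)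
      from INFM_conjI[OF inf ev]
      have "\<exists>\<^sub>\<infinity>n. x \<in> {x \<in> infinite_expansion. (gauss_map ^^ n) x \<in> ?E n}"
        by (rule INFM_mono)
           (use x k' in \<open>auto simp: funpow_gauss_map_infinite_expansion digit_add add.commute\<close>)
      then show "x \<in> {x. \<exists>\<^sub>\<infinity>n. x \<in> {x \<in> infinite_expansion. (gauss_map ^^ n) x \<in> ?E n}}" by simp
    qed
  qed
qed

text \<open>The parameter \<open>M\<close> excludes from the first kind of jump the prefixes that are long compared
  to their depth, so that the number of the remaining ones does not affect the exponent.  The target
  of the second kind is so large that all prefixes can be counted.\<close>

lemma infinitely_many_jumps:
  fixes D :: "nat \<Rightarrow> real"
  assumes c': "1 < c'" "c' < c" and inf: "\<exists>\<^sub>\<infinity>n. c ^ n \<le> D (n + k)"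
  shows "\<exists>\<^sub>\<infinity>n. M * real n \<le> D n \<and> c' * D n \<le> D (Suc n) \<or> D n < M * real n \<and> c' ^ Suc n \<le> D (Suc n)"
proof (rule ccontr)
  assume "\<not> ?thesis"
  then obtain N where N: "\<And>n. N \<le> n \<Longrightarrow> M * real n \<le> D n \<Longrightarrow> D (Suc n) < c' * D n"
    "\<And>n. N \<le> n \<Longrightarrow> D n < M * real n \<Longrightarrow> D (Suc n) < c' ^ Suc n"
    unfolding INFM_nat_le by (metis not_le)
  \<comment> \<open>The maximum with 1 lets one bound survive both alternatives: growth by less than
    the factor c', or a value below c'^(n + 1).\<close>
  define C where "C = max 1 (D N)"
  have C: "1 \<le> C" by (simp add: C_def)
  have le: "D n \<le> C * c' ^ n" if "N \<le> n" for n
    using that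
  proof (induction rule: dec_induct)
    case base
    have "D N \<le> C * 1" by (simp add: C_def)
    also have "\<dots> \<le> C * c' ^ N" using C c' by (intro mult_left_mono one_le_power) auto
    finally show ?case .
  next
    case (step n)
    show ?case
    proof (cases "M * real n \<le> D n")
      case True
      then have "D (Suc n) \<le> c' * D n" using N(1) step by (simp add: less_imp_le)
      also have "\<dots> \<le> c' * (C * c' ^ n)" using step.IH c' by (intro mult_left_mono) auto
      finally show ?thesis by (simp add: mult_ac)
    next
      case False
      then have "D (Suc n) \<le> 1 * c' ^ Suc n" using N(2) step by (simp add: less_imp_le)
      also have "\<dots> \<le> C * c' ^ Suc n" using C c' by (intro mult_right_mono) auto
      finally show ?thesis .
    qed
  qed
  \<comment> \<open>Since c' < c, the bound C c'^(n + k) eventually falls below c^n; the shift by k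
    affects only the constant.\<close>
  have "(\<lambda>n. (c' / c) ^ n) \<longlonglongrightarrow> 0" using c' by (intro LIMSEQ_realpow_zero) auto
  moreover have "0 < 1 / (C * c' ^ k)" using C c' by simp
  ultimately have "eventually (\<lambda>n. (c' / c) ^ n < 1 / (C * c' ^ k)) sequentially"
    by (rule order_tendstoD(2))
  then obtain N' where N': "\<And>n. N' \<le> n \<Longrightarrow> (c' / c) ^ n < 1 / (C * c' ^ k)"
    by (auto simp: eventually_sequentially)
  obtain n where n: "max N N' \<le> n" "c ^ n \<le> D (n + k)"
    using inf unfolding INFM_nat_le by blast
  have "c ^ n \<le> C * c' ^ (n + k)" using n le[of "n + k"] by simp
  then have "1 \<le> (C * c' ^ k) * (c' / c) ^ n"
    using c' by (simp add: power_divide power_add field_simps)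
  also have "\<dots> < (C * c' ^ k) * (1 / (C * c' ^ k))"
    using C c' n(1) by (intro mult_strict_left_mono N') auto
  also have "\<dots> = 1" using C c' by simp
  finally show False by simp
qed

lemma sum_degrees_le_depth:
  "(\<Sum>i<k. real (degree (\<omega> (n + i)))) \<le> depth \<omega> (n + k)"
proof -
  have "depth \<omega> (n + k) = depth \<omega> n + (\<Sum>i<k. real (degree (\<omega> (n + i))))"
    unfolding depth_def by (induction k) auto
  moreover have "0 \<le> depth \<omega> n" by (simp add: depth_def sum_nonneg)
  ultimately show ?thesis by simp
qed

lemma summable_powr_neg_exponential:
  fixes q s c K :: real
  assumes "1 < q" "0 < s" "1 < c"
  shows "summable (\<lambda>n. q powr (K * real n - s * c ^ Suc n))"
proof (rule summable_comparison_test_ev)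
  have "summable (\<lambda>n. (1 / q) ^ n)" using assms by (intro summable_geometric) auto
  moreover have "(1 / q) ^ n = q powr (- real n)" for n
    using assms by (simp add: powr_minus powr_realpow power_divide field_simps)
  ultimately show "summable (\<lambda>n. q powr (- real n))" by simp
  have "(\<lambda>n. real n * (1 / c) ^ n) \<longlonglongrightarrow> 0"
    using assms by (intro powser_times_n_limit_0) auto
  then have "(\<lambda>n. (K + 1) * (real n * (1 / c) ^ n)) \<longlonglongrightarrow> (K + 1) * 0"
    by (intro tendsto_intros)
  moreover have "(K + 1) * 0 < s * c" using assms by simp
  ultimately have "eventually (\<lambda>n. (K + 1) * (real n * (1 / c) ^ n) < s * c) sequentially"
    by (rule order_tendstoD(2))
  then show "eventually (\<lambda>n. norm (q powr (K * real n - s * c ^ Suc n)) \<le> q powr (- real n)) sequentially"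
  proof (rule eventually_mono)
    fix n assume "(K + 1) * (real n * (1 / c) ^ n) < s * c"
    then have "(K + 1) * real n < s * c * c ^ n"
      using assms by (simp add: power_divide field_simps)
    then show "norm (q powr (K * real n - s * c ^ Suc n)) \<le> q powr (- real n)"
      using assms by (simp add: algebra_simps)
  qed
qed

lemma hausdorff_dim_F_set_exponential_le:
  assumes k: "1 \<le> k" and c: "1 < c'" "c' < c" and s: "1 / (1 + c') < s"
    and \<Phi>: "\<And>n. N \<le> n \<Longrightarrow> c ^ n \<le> \<Phi> n"
  shows "hausdorff_dim fls_rho (F_set k \<Phi> :: 'a::{field,finite} fls set) \<le> ereal s"
proof (rule hausdorff_dim_le)
  let ?q = "real CARD('a)"
  have q: "1 < ?q" by (rule card_field_gt_1)
  have "0 < 1 / (1 + c')" using c by simp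
  with s show s0: "0 < s" by linarith
  have sc: "1 < s * (1 + c')" using s c by (simp add: field_simps)
  \<comment> \<open>Half of the margin in s (1 + c') > 1 keeps 2 s + t above 1; the other half pays
    for the number of prefixes.\<close>
  define \<epsilon> where "\<epsilon> = (s * (1 + c') - 1) / 2"
  have \<epsilon>: "0 < \<epsilon>" using sc by (simp add: \<epsilon>_def)
  define t where "t = s * (c' - 1) - \<epsilon>"
  have t: "1 < 2 * s + t"
  proof -
    have "2 * s + t = s * (1 + c') - \<epsilon>" by (simp add: t_def algebra_simps)
    then show ?thesis using sc by (simp add: \<epsilon>_def field_simps)
  qed
  define Z1 where "Z1 = digit_series ?q (2 * s + t)"
  \<comment> \<open>The shift t = 2 makes the series converge for every s > 0. In the second kind of
    jump D < M n, so the added term 2 D is paid by 2 M n, which is negligible against the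
    exponential target.\<close>
  define Z2 where "Z2 = digit_series ?q (2 * s + 2)"
  have Z: "0 < Z1" "0 < Z2" using q t s0 by (auto simp: Z1_def Z2_def digit_series_pos)
  \<comment> \<open>Chosen such that q^(-\<epsilon> M) Z1 = 1 / q.\<close>
  define M where "M = (log ?q Z1 + 1) / \<epsilon>"
  define K where "K = (s + 2) * M + log ?q Z2"
  let ?c1 = "\<lambda>n. ?q powr (- (\<epsilon> * M * real n)) * Z1 ^ n"
  let ?c2 = "\<lambda>n. ?q powr (K * real n - s * c' ^ Suc n)"
  have c1: "?c1 n = (1 / ?q) ^ n" for n
  proof -
    have "Z1 ^ n = ?q powr (log ?q Z1 * real n)"
      using q Z by (simp add: powr_powr[symmetric] powr_realpow)
    then have "?c1 n = ?q powr (- (\<epsilon> * M * real n) + log ?q Z1 * real n)" by (simp only: powr_add)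
    also have "- (\<epsilon> * M * real n) + log ?q Z1 * real n = - real n"
    proof -
      have "\<epsilon> * M = log ?q Z1 + 1" using \<epsilon> by (simp add: M_def)
      then show ?thesis by (simp only:) (simp add: algebra_simps)
    qed
    also have "?q powr (- real n) = (1 / ?q) ^ n"
      using q by (simp add: powr_minus powr_realpow power_divide field_simps)
    finally show ?thesis .
  qed
  let ?E1 = "\<lambda>n. {x :: 'a fls. x \<in> infinite_expansion \<and>
      \<epsilon> * M * real n + t * depth (digit x) n \<le> s * real (degree (digit x n))}"
  let ?E2 = "\<lambda>n. {x :: 'a fls. x \<in> infinite_expansion \<and>
      (s * c' ^ Suc n - (s + 2) * M * real n) + 2 * depth (digit x) n \<le> s * real (degree (digit x n))}"
  show "hcontent s (F_set k \<Phi> :: 'a fls set) = 0"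
  proof (rule hcontent_eq_0_limsup[where E = "\<lambda>n. ?E1 n \<union> ?E2 n"])
    show "summable (\<lambda>n. ?c1 n + ?c2 n)"
      unfolding c1 using q s0 c
      by (intro summable_add summable_geometric summable_powr_neg_exponential) auto
    show "0 \<le> ?c1 n + ?c2 n" for n using Z by simp
    show "hcontent s (?E1 n \<union> ?E2 n) \<le> ennreal (?c1 n + ?c2 n)" for n
    proof -
      have "hcontent s (?E1 n) \<le> ennreal (?c1 n)"
        unfolding Z1_def using s0 t by (rule hcontent_degree_ge_depth)
      moreover have "hcontent s (?E2 n) \<le> ennreal (?q powr (- (s * c' ^ Suc n - (s + 2) * M * real n)) * Z2 ^ n)"
        unfolding Z2_def using s0 by (intro hcontent_degree_ge_depth) auto
      moreover have "?q powr (- (s * c' ^ Suc n - (s + 2) * M * real n)) * Z2 ^ n = ?c2 n"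
      proof -
        have "Z2 ^ n = ?q powr (log ?q Z2 * real n)"
          using q Z by (simp add: powr_powr[symmetric] powr_realpow)
        then show ?thesis by (simp add: powr_add[symmetric] K_def algebra_simps del: power_Suc)
      qed
      ultimately have "hcontent s (?E1 n) + hcontent s (?E2 n) \<le> ennreal (?c1 n) + ennreal (?c2 n)"
        by (intro add_mono) simp_all
      then show ?thesis
        using Z hcontent_Un_le[of s "?E1 n" "?E2 n"] by (simp add: ennreal_plus[symmetric] del: ennreal_plus)
    qed
    show "F_set k \<Phi> \<subseteq> {x. \<exists>\<^sub>\<infinity>n. x \<in> ?E1 n \<union> ?E2 n}"
    proof
      fix x :: "'a fls" assume "x \<in> F_set k \<Phi>"
      then have x: "x \<in> infinite_expansion"
        and inf: "\<exists>\<^sub>\<infinity>n. \<Phi> n \<le> (\<Sum>i<k. real (degree (digit x (n + i))))"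
        using k by (auto simp: F_set_eq)
      define D where "D = depth (digit x)"
      have D: "D (Suc n) = D n + real (degree (digit x n))" for n by (simp add: D_def depth_def)
      have D0: "0 \<le> D n" for n by (simp add: D_def depth_def sum_nonneg)
      have ev: "\<forall>\<^sub>\<infinity>n. c ^ n \<le> \<Phi> n" using \<Phi> by (auto simp: MOST_nat_le)
      from INFM_conjI[OF inf ev] have "\<exists>\<^sub>\<infinity>n. c ^ n \<le> D (n + k)"
      proof (rule INFM_mono)
        fix n assume "\<Phi> n \<le> (\<Sum>i<k. real (degree (digit x (n + i)))) \<and> c ^ n \<le> \<Phi> n"
        then show "c ^ n \<le> D (n + k)"
          using sum_degrees_le_depth[of "digit x" n k] by (simp add: D_def)
      qed
      then have "\<exists>\<^sub>\<infinity>n. M * real n \<le> D n \<and> c' * D n \<le> D (Suc n) \<or> D n < M * real n \<and> c' ^ Suc n \<le> D (Suc n)"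
        using c by (intro infinitely_many_jumps)
      then have "\<exists>\<^sub>\<infinity>n. x \<in> ?E1 n \<union> ?E2 n"
      proof (rule INFM_mono)
        fix n
        let ?d = "real (degree (digit x n))"
        assume "M * real n \<le> D n \<and> c' * D n \<le> D (Suc n) \<or> D n < M * real n \<and> c' ^ Suc n \<le> D (Suc n)"
        then consider "M * real n \<le> D n" "(c' - 1) * D n \<le> ?d" | "D n < M * real n" "c' ^ Suc n - M * real n \<le> ?d"
          unfolding D by (auto simp: algebra_simps)
        then show "x \<in> ?E1 n \<union> ?E2 n"
        proof cases
          case 1
          have "\<epsilon> * M * real n + t * D n \<le> \<epsilon> * D n + t * D n"
            using 1(1) \<epsilon> by simp
          also have "\<dots> = s * ((c' - 1) * D n)" by (simp add: t_def algebra_simps)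
          also have "\<dots> \<le> s * ?d" using 1(2) s0 by (intro mult_left_mono) auto
          finally show ?thesis using x by (simp add: D_def)
        next
          case 2
          have "(s * c' ^ Suc n - (s + 2) * M * real n) + 2 * D n \<le> s * (c' ^ Suc n - M * real n)"
            using 2(1) by (simp add: algebra_simps)
          also have "\<dots> \<le> s * ?d" using 2(2) s0 by (intro mult_left_mono) auto
          finally show ?thesis using x by (simp add: D_def)
        qed
      qed
      then show "x \<in> {x. \<exists>\<^sub>\<infinity>n. x \<in> ?E1 n \<union> ?E2 n}" by simp
    qed
  qed
qed

section \<open>Lower bounds for the dimension\<close>

lemma dist_le_ediam:
  assumes "x \<in> U" "y \<in> U" "ediam d U < top"
  shows "d x y \<le> enn2real (ediam d U)"
proof -
  have "ennreal (d x y) \<le> (SUP y\<in>U. ennreal (d x y))" using assms(2) by (rule SUP_upper)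
  also have "\<dots> \<le> ediam d U" unfolding ediam_def using assms(1) by (rule SUP_upper)
  finally have "ennreal (d x y) \<le> ennreal (enn2real (ediam d U))" using assms(3) by simp
  then show ?thesis using enn2real_nonneg[of "ediam d U"] by (auto simp: ennreal_le_iff2)
qed

text \<open>The measure stays on the parameter space, and measurability of \<open>X\<close> is not
  asked for: each small set only needs a measurable superset of its preimage, taken within the
  full-measure event \<open>G\<close>.\<close>

lemma mass_distribution_principle:
  fixes M :: "'b measure" and X :: "'b \<Rightarrow> 'c" and d :: "'c \<Rightarrow> 'c \<Rightarrow> real"
  assumes M: "prob_space M" and C: "0 < C" and s: "0 < s"
    and G: "AE \<omega> in M. G \<omega>" and E: "\<And>\<omega>. G \<omega> \<Longrightarrow> X \<omega> \<in> E"
    and ball: "\<And>U r. 0 < r \<Longrightarrow> r < 1 \<Longrightarrow> (\<And>x y. x \<in> U \<Longrightarrow> y \<in> U \<Longrightarrow> d x y \<le> r) \<Longrightarrow>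
       \<exists>A\<in>sets M. (\<forall>\<omega>\<in>space M. G \<omega> \<longrightarrow> X \<omega> \<in> U \<longrightarrow> \<omega> \<in> A) \<and> emeasure M A \<le> ennreal (C * r powr s)"
  shows "ereal s \<le> hausdorff_dim d E"
  unfolding hausdorff_dim_def
proof (rule Inf_greatest, clarify)
  fix t :: real assume t: "0 \<le> t" and 0: "hausdorff_measure d t E = 0"
  interpret prob_space M by (rule M)
  show "ereal s \<le> ereal t"
  proof (rule ccontr)
    assume "\<not> ereal s \<le> ereal t"
    then have ts: "t < s" by simp
    have small: "\<exists>A\<in>sets M. (\<forall>\<omega>\<in>space M. G \<omega> \<longrightarrow> X \<omega> \<in> U \<longrightarrow> \<omega> \<in> A) \<and>
        emeasure M A \<le> ennreal C * diam_pow d t U + ennreal e"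
      if U: "ediam d U \<le> ennreal (1/2)" and e: "0 < e" for U e
    proof (cases "U = {}")
      case True
      then show ?thesis by (intro bexI[of _ "{}"]) auto
    next
      case False
      have top: "ediam d U < top" using U le_less_trans ennreal_less_top by blast
      define \<delta> where "\<delta> = enn2real (ediam d U)"
      have \<delta>: "0 \<le> \<delta>" "\<delta> \<le> 1/2"
        unfolding \<delta>_def by (rule enn2real_nonneg, rule enn2real_leI[OF _ U], simp)
      have d: "d x y \<le> \<delta>" if "x \<in> U" "y \<in> U" for x y
        unfolding \<delta>_def using that top by (rule dist_le_ediam)
      \<comment> \<open>The hypothesis \<open>ball\<close> speaks of positive radii, while a
        covering set may have diameter 0; hence a radius slightly above the diameter, at the price
        of \<open>e\<close>.\<close>
      obtain r where r: "\<delta> < r" "r < 1" "ennreal (C * r powr t) \<le> ennreal C * diam_pow d t U + ennreal e"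
      proof (cases "t = 0")
        case True
        \<comment> \<open>For t = 0 a nonempty set costs 1 whatever its diameter, so any radius
          between 1/2 and 1 will do.\<close>
        have "\<delta> < 3/4" using \<delta> by simp
        moreover have "ennreal (C * (3/4) powr t) \<le> ennreal C * diam_pow d t U + ennreal e"
          using True False by (simp add: diam_pow_def)
        ultimately show ?thesis by (intro that[of "3/4"]) auto
      next
        case False
        then have t0: "0 < t" using t by simp
        have "\<delta> powr t \<le> (1/2) powr t" using \<delta> t0 by (intro powr_mono2) auto
        moreover have "(1/2) powr t < (1::real)" using t0 powr_less_mono2[of t "1/2" 1] by simp
        ultimately have \<delta>1: "\<delta> powr t < 1" by simp
        define e' where "e' = min (e / C) ((1 - \<delta> powr t) / 2)"
        have e': "0 < e'" "C * e' \<le> e" "\<delta> powr t + e' < 1"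
          using e C \<delta>1 by (auto simp: e'_def min_def field_simps)
        define r where "r = (\<delta> powr t + e') powr (1 / t)"
        have rt: "r powr t = \<delta> powr t + e'"
          using t0 e' by (simp add: r_def powr_powr add_nonneg_pos)
        have r0: "0 \<le> r" by (simp add: r_def)
        have "\<delta> < r"
        proof (rule ccontr)
          assume "\<not> \<delta> < r"
          then have "r powr t \<le> \<delta> powr t" using r0 t0 by (intro powr_mono2) auto
          with rt e' show False by simp
        qed
        moreover have "r < 1"
        proof (rule ccontr)
          assume "\<not> r < 1"
          then have "1 powr t \<le> r powr t" using t0 by (intro powr_mono2) auto
          with rt e' show False by simp
        qed
        moreover have "ennreal (C * r powr t) \<le> ennreal C * diam_pow d t U + ennreal e"
        proof -
          have "ennreal (C * r powr t) \<le> ennreal (C * \<delta> powr t + e)"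
            using e' C unfolding rt by (intro ennreal_leI) (simp add: algebra_simps)
          also have "\<dots> = ennreal C * diam_pow d t U + ennreal e"
            using C e \<open>U \<noteq> {}\<close> False by (simp add: diam_pow_def \<delta>_def ennreal_mult)
          finally show ?thesis .
        qed
        ultimately show ?thesis by (rule that)
      qed
      obtain A where A: "A \<in> sets M" "\<forall>\<omega>\<in>space M. G \<omega> \<longrightarrow> X \<omega> \<in> U \<longrightarrow> \<omega> \<in> A"
          "emeasure M A \<le> ennreal (C * r powr s)"
        using ball[of r U] r(1,2) \<delta>(1) d by (force intro: less_imp_le order.trans)
      have "r powr s \<le> r powr t" using r \<delta> ts by (intro powr_mono') auto
      then have "ennreal (C * r powr s) \<le> ennreal (C * r powr t)"
        using C by (intro ennreal_leI) auto
      then show ?thesis using A r(3) by (intro bexI[of _ A]) (auto intro: order.trans)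
    qed
    have "hausdorff_premeasure d t (1/2) E \<le> hausdorff_measure d t E"
      unfolding hausdorff_measure_def by (intro SUP_upper) auto
    \<comment> \<open>A total cost of 1 / (4 C) and errors adding up to 1/4 bound the mass by 1/2,
      contradicting probability 1.\<close>
    then have "hausdorff_premeasure d t (1/2) E < ennreal (1 / (4 * C))" using 0 C by simp
    then obtain U where U: "E \<subseteq> (\<Union>i::nat. U i)" "\<And>i. ediam d (U i) \<le> ennreal (1/2)"
      and sum: "(\<Sum>i. diam_pow d t (U i)) < ennreal (1 / (4 * C))"
      unfolding hausdorff_premeasure_def by (auto simp: Inf_less_iff)
    have "\<exists>A\<in>sets M. (\<forall>\<omega>\<in>space M. G \<omega> \<longrightarrow> X \<omega> \<in> U i \<longrightarrow> \<omega> \<in> A) \<and>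
        emeasure M A \<le> ennreal C * diam_pow d t (U i) + ennreal (1/4 * (1/2) ^ Suc i)" for i
      using U(2) by (intro small) auto
    then obtain A where A: "\<And>i. A i \<in> sets M"
      "\<And>i \<omega>. \<omega> \<in> space M \<Longrightarrow> G \<omega> \<Longrightarrow> X \<omega> \<in> U i \<Longrightarrow> \<omega> \<in> A i"
      "\<And>i. emeasure M (A i) \<le> ennreal C * diam_pow d t (U i) + ennreal (1/4 * (1/2) ^ Suc i)"
      by metis
    have "AE \<omega> in M. \<omega> \<in> (\<Union>i. A i)"
      using G AE_space
    proof eventually_elim
      case (elim \<omega>)
      then show ?case using E U(1) A(2) by blast
    qed
    then have "1 = emeasure M (\<Union>i. A i)"
      using A(1) by (subst emeasure_eq_1_AE) auto
    also have "\<dots> \<le> (\<Sum>i. emeasure M (A i))"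
      using A(1) by (intro emeasure_subadditive_countably) auto
    also have "\<dots> \<le> (\<Sum>i. ennreal C * diam_pow d t (U i) + ennreal (1/4 * (1/2) ^ Suc i))"
      using A(3) by (intro suminf_le) auto
    also have "\<dots> = (\<Sum>i. ennreal C * diam_pow d t (U i)) + (\<Sum>i. ennreal (1/4 * (1/2) ^ Suc i))"
      by (rule suminf_add[symmetric]) auto
    also have "\<dots> = ennreal C * (\<Sum>i. diam_pow d t (U i)) + ennreal (1/4)"
      by (subst ennreal_half_power_sums) auto
    also have "\<dots> \<le> ennreal C * ennreal (1 / (4 * C)) + ennreal (1/4)"
      using sum by (intro add_mono mult_left_mono) auto
    also have "\<dots> = ennreal (1/2)"
      using C by (simp add: ennreal_mult[symmetric] ennreal_plus[symmetric] del: ennreal_plus)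
    finally have "ennreal 1 \<le> ennreal (1/2)" by simp
    then show False by (subst (asm) ennreal_le_iff) auto
  qed
qed

lemma depth_Suc: "depth \<omega> (Suc n) = depth \<omega> n + real (degree (\<omega> n))"
  by (simp add: depth_def)

lemma depth_ge:
  assumes "\<And>i. 1 \<le> degree (\<omega> i)"
  shows "real n \<le> depth \<omega> n"
proof (induction n)
  case (Suc n)
  then show ?case using assms[of n] by (simp add: depth_Suc)
qed (simp add: depth_def)

lemma rho_cf_different_at:
  fixes \<omega> \<omega>' :: "nat \<Rightarrow> 'a::{field,finite} poly"
  assumes "\<And>i. 1 \<le> degree (\<omega> i)" "\<And>i. 1 \<le> degree (\<omega>' i)"
    and "\<And>i. i < n \<Longrightarrow> \<omega> i = \<omega>' i" "\<omega> n \<noteq> \<omega>' n"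
  shows "fls_rho (cf \<omega>) (cf \<omega>') = real CARD('a) powr (- 2 * depth \<omega> n +
    real (degree (\<omega> n - \<omega>' n)) - real (degree (\<omega> n)) - real (degree (\<omega>' n)))"
proof -
  have "digit (cf \<omega>) = \<omega>" "digit (cf \<omega>') = \<omega>'" using assms(1,2) by (auto simp: digit_cf)
  then show ?thesis
    using rho_different_at[of "cf \<omega>" "cf \<omega>'" n] assms by (simp add: cf_in_infinite_expansion)
qed

text \<open>A set of diameter at most \<open>r\<close> fixes the digits up to the first \<open>n\<close> with \<open>q\<close> to the power
  \<open>-2 D (n + 1)\<close> at most \<open>r\<close>, and either leaves the digit of index \<open>n\<close> free or fixes its degree
  and its leading coefficients.\<close>

lemma hausdorff_dim_cf_ge:
  fixes p :: "nat \<Rightarrow> 'a::{field,finite} poly pmf"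
  assumes s: "0 < s" "s \<le> 1" and C: "0 < C"
    and deg: "\<And>n A. A \<in> set_pmf (p n) \<Longrightarrow> 1 \<le> degree A" "\<And>n A. A \<in> set_pmf (p n) \<Longrightarrow> real (degree A) \<le> m n"
    and unif: "\<And>n A. pmf (p n) A \<le> real CARD('a) powr (- real (degree A))"
    and prod: "\<And>\<omega> n. (\<And>i. \<omega> i \<in> set_pmf (p i)) \<Longrightarrow>
      (\<Prod>i<n. pmf (p i) (\<omega> i)) \<le> C * real CARD('a) powr (- s * (2 * depth \<omega> n + m n))"
    and sub: "\<And>\<omega>. (\<And>i. \<omega> i \<in> set_pmf (p i)) \<Longrightarrow> cf \<omega> \<in> E"
  shows "ereal s \<le> hausdorff_dim fls_rho E"
proof -
  let ?q = "real CARD('a)"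
  define M where "M = PiM (UNIV :: nat set) (\<lambda>i. measure_pmf (p i))"
  define G where "G = (\<lambda>\<omega>. \<forall>i. \<omega> i \<in> set_pmf (p i))"
  interpret PM: product_prob_space "\<lambda>i. measure_pmf (p i)" "UNIV :: nat set" ..
  have q: "1 < ?q" by (rule card_field_gt_1)
  have spM: "space M = UNIV" by (simp add: M_def space_PiM)
  have Gdeg: "1 \<le> degree (\<omega> i)" if "G \<omega>" for \<omega> i using that deg(1)[of "\<omega> i" i] by (simp add: G_def)
  show ?thesis
  proof (rule mass_distribution_principle[where M = M and X = cf and G = G and C = "C * ?q"])
    show "prob_space M" unfolding M_def by (rule PM.P.prob_space_axioms)
    show "0 < C * ?q" using C q by simp
    show "0 < s" by fact
    show "AE \<omega> in M. G \<omega>"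
      unfolding G_def M_def
      by (subst AE_all_countable) (intro allI PM.AE_component, auto simp: AE_measure_pmf)
    show "cf \<omega> \<in> E" if "G \<omega>" for \<omega> using that sub by (simp add: G_def)
  next
    fix U :: "'a fls set" and r :: real
    assume r: "0 < r" "r < 1" and U: "\<And>x y. x \<in> U \<Longrightarrow> y \<in> U \<Longrightarrow> fls_rho x y \<le> r"
    show "\<exists>A\<in>sets M. (\<forall>\<omega>\<in>space M. G \<omega> \<longrightarrow> cf \<omega> \<in> U \<longrightarrow> \<omega> \<in> A) \<and> emeasure M A \<le> ennreal (C * ?q * r powr s)"
    proof (cases "\<exists>\<omega>. G \<omega> \<and> cf \<omega> \<in> U")
      case False
      then show ?thesis by (intro bexI[of _ "{}"]) auto
    next
      case True
      then obtain w where w: "G w" "cf w \<in> U" by blast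
      \<comment> \<open>\<open>P n\<close> compares r with the bound on the diameter of the cylinder
        around \<open>w\<close> that fixes the digits up to index \<open>n\<close>
        inclusive.\<close>
      define P where "P = (\<lambda>n. ?q powr (- 2 * depth w (Suc n)) \<le> r)"
      have "\<exists>n. P n"
      proof -
        have "(\<lambda>n. (1 / ?q) ^ n) \<longlonglongrightarrow> 0" using q by (intro LIMSEQ_realpow_zero) auto
        then have "eventually (\<lambda>n. (1 / ?q) ^ n < r) sequentially" using r(1) by (rule order_tendstoD(2))
        then obtain n where n: "(1 / ?q) ^ n < r" by (auto simp: eventually_sequentially)
        have "?q powr (- 2 * depth w (Suc n)) \<le> ?q powr (- real n)"
          using q depth_ge[of w "Suc n"] Gdeg[OF w(1)] by (intro powr_mono) auto
        also have "\<dots> = (1 / ?q) ^ n" using q by (simp add: powr_minus powr_realpow power_divide field_simps)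
        also have "\<dots> < r" by (rule n)
        finally show ?thesis unfolding P_def by (blast intro: less_imp_le)
      qed
      define n where "n = (LEAST n. P n)"
      have Pn: "P n" unfolding n_def using \<open>\<exists>n. P n\<close> by (rule LeastI_ex)
      have Pless: "\<not> P i" if "i < n" for i using that unfolding n_def by (rule not_less_Least)
      \<comment> \<open>\<open>u\<close> locates r between the scales of the cylinders of lengths
        \<open>n\<close> and \<open>n + 1\<close>.\<close>
      define u where "u = - log ?q r - 2 * depth w n"
      have r_eq: "r = ?q powr (- 2 * depth w n - u)"
        using q r by (simp add: u_def)
      let ?d = "degree (w n)"
      have u2d: "u \<le> 2 * real ?d"
        using Pn q unfolding P_def r_eq depth_Suc by (simp add: powr_le_cancel_iff)
      have dm: "real ?d \<le> m n" using w(1) deg(2) by (auto simp: G_def)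
      \<comment> \<open>A first disagreement at i < n would separate the points by at least q^(-2 D
        (i + 1)), so \<open>P i\<close> would hold, against the minimality of n.\<close>
      have agree: "\<omega> i = w i" if \<omega>: "G \<omega>" "cf \<omega> \<in> U" and i: "i < n" for \<omega> i
        using i
      proof (induction i rule: less_induct)
        case (less i)
        show ?case
        proof (rule ccontr)
          assume ne: "\<omega> i \<noteq> w i"
          have "r \<ge> fls_rho (cf w) (cf \<omega>)" using U w(2) \<omega>(2) by blast
          also have "fls_rho (cf w) (cf \<omega>) = ?q powr (- 2 * depth w i +
             real (degree (w i - \<omega> i)) - real (degree (w i)) - real (degree (\<omega> i)))"
            using less ne Gdeg[OF w(1)] Gdeg[OF \<omega>(1)] by (intro rho_cf_different_at) auto
          also have "\<dots> \<ge> ?q powr (- 2 * depth w (Suc i))"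
          proof (rule powr_mono)
            have "degree (\<omega> i) \<le> degree (w i) + degree (w i - \<omega> i)"
              using degree_diff_le_max[of "w i" "w i - \<omega> i"] by simp
            then have "real (degree (\<omega> i)) \<le> real (degree (w i)) + real (degree (w i - \<omega> i))"
              by linarith
            then show "- 2 * depth w (Suc i) \<le> - 2 * depth w i +
               real (degree (w i - \<omega> i)) - real (degree (w i)) - real (degree (\<omega> i))"
              by (simp add: depth_Suc)
          qed (use q in auto)
          finally have "P i" by (simp add: P_def)
          with less.prems Pless show False by blast
        qed
      qed
      \<comment> \<open>For u \<le> m n the mass of the prefix is already small enough; otherwise
        the bound on the degree of the difference expresses distance at most r from
        \<open>cf w\<close>.\<close>
      define S where "S = (if u \<le> m n then UNIV else
         {B. degree B = ?d \<and> real (degree (w n - B)) \<le> 2 * real ?d - u})"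
      have inS: "\<omega> n \<in> S" if \<omega>: "G \<omega>" "cf \<omega> \<in> U" for \<omega>
      proof (cases "u \<le> m n \<or> \<omega> n = w n")
        case True
        then show ?thesis using u2d by (auto simp: S_def)
      next
        case False
        have "?q powr (- 2 * depth w n + real (degree (w n - \<omega> n)) - real ?d - real (degree (\<omega> n)))
            = fls_rho (cf w) (cf \<omega>)"
          using False Gdeg[OF w(1)] Gdeg[OF \<omega>(1)] agree[OF \<omega>] by (intro rho_cf_different_at[symmetric]) auto
        also have "\<dots> \<le> r" using U w(2) \<omega>(2) by blast
        finally have le: "real (degree (w n - \<omega> n)) - real ?d - real (degree (\<omega> n)) \<le> - u"
          using q unfolding r_eq by (simp add: powr_le_cancel_iff)
        have "real (degree (\<omega> n)) \<le> m n" using \<omega>(1) deg(2) by (auto simp: G_def)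
        have "degree (\<omega> n) = ?d"
        proof (rule ccontr)
          assume ne: "degree (\<omega> n) \<noteq> ?d"
          \<comment> \<open>Different degrees do not cancel, so the difference has at least the
            larger degree; the distance bound then leaves u at most the smaller one.\<close>
          have "?d \<le> degree (w n - \<omega> n) \<or> degree (\<omega> n) \<le> degree (w n - \<omega> n)"
            using ne degree_diff_le_max[of "w n" "w n - \<omega> n"] degree_add_le_max[of "w n - \<omega> n" "\<omega> n"] by auto
          then have "u \<le> m n"
            using le dm \<open>real (degree (\<omega> n)) \<le> m n\<close> by auto
          with False show False by simp
        qed
        then show ?thesis using le False by (auto simp: S_def)
      qed
      define A where "A = {\<omega> \<in> space M. \<forall>i\<in>{..n}. \<omega> i \<in> (if i < n then {w i} else S)}"
      have A: "A \<in> sets M"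
        unfolding A_def M_def by (intro sets.sets_Collect_finite_All sets_Collect_single') auto
      have emA: "emeasure M A = ennreal ((\<Prod>i<n. pmf (p i) (w i)) * measure (measure_pmf (p n)) S)"
      proof -
        have "emeasure M A = (\<Prod>i\<in>{..n}. emeasure (measure_pmf (p i)) (if i < n then {w i} else S))"
          unfolding A_def M_def by (rule PM.emeasure_PiM_Collect) auto
        also have "\<dots> = (\<Prod>i\<in>{..n}. ennreal (measure (measure_pmf (p i)) (if i < n then {w i} else S)))"
          by (simp add: measure_pmf.emeasure_eq_measure)
        also have "\<dots> = ennreal (\<Prod>i\<in>{..n}. measure (measure_pmf (p i)) (if i < n then {w i} else S))"
          by (rule prod_ennreal) auto
        also have "{..n} = insert n {..<n}" by auto
        finally show ?thesis by (simp add: measure_pmf_single mult.commute)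
      qed
      have prodw: "(\<Prod>i<n. pmf (p i) (w i)) \<le> C * ?q powr (- s * (2 * depth w n + m n))"
        using w(1) by (intro prod) (simp add: G_def)
      have rs: "r powr s = ?q powr (- s * (2 * depth w n + u))"
        unfolding r_eq powr_powr by (rule arg_cong[where f = "\<lambda>x. ?q powr x"]) (simp add: algebra_simps)
      have "(\<Prod>i<n. pmf (p i) (w i)) * measure (measure_pmf (p n)) S \<le> C * ?q * r powr s"
      proof (cases "u \<le> m n")
        case True
        have "(\<Prod>i<n. pmf (p i) (w i)) * measure (measure_pmf (p n)) S \<le> (\<Prod>i<n. pmf (p i) (w i)) * 1"
          by (intro mult_left_mono prod_nonneg measure_pmf.prob_le_1) auto
        also have "\<dots> \<le> C * ?q powr (- s * (2 * depth w n + m n))" using prodw by simp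
        also have "\<dots> \<le> C * ?q powr (- s * (2 * depth w n + u))"
        proof (rule mult_left_mono[OF powr_mono])
          have "s * u \<le> s * m n" using True s by (intro mult_left_mono) auto
          then show "- s * (2 * depth w n + m n) \<le> - s * (2 * depth w n + u)"
            by (simp add: algebra_simps)
        qed (use C q in auto)
        also have "\<dots> = C * 1 * r powr s" by (simp add: rs)
        also have "\<dots> \<le> C * ?q * r powr s" using C q by (intro mult_right_mono mult_left_mono) auto
        finally show ?thesis .
      next
        case False
        define l where "l = nat \<lfloor>2 * real ?d - u\<rfloor>"
        have l: "real l \<le> 2 * real ?d - u" using u2d by (simp add: l_def)
        \<comment> \<open>There are q^(l + 1) polynomials of degree at most l; the surplus factor q
          is the one in \<open>C * ?q\<close>.\<close>
        have Ssub: "S \<subseteq> (\<lambda>B. w n - B) ` {B. degree B \<le> l}"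
        proof
          fix B assume "B \<in> S"
          then have "real (degree (w n - B)) \<le> 2 * real ?d - u" using False by (simp add: S_def)
          then have "degree (w n - B) \<le> l" unfolding l_def by (simp add: le_nat_floor)
          then show "B \<in> (\<lambda>B. w n - B) ` {B. degree B \<le> l}"
            by (intro image_eqI[of _ _ "w n - B"]) auto
        qed
        have finS: "finite S" by (rule finite_subset[OF Ssub]) (simp add: finite_degree_le)
        have "card S \<le> card ((\<lambda>B. w n - B) ` {B. degree B \<le> l})"
          by (intro card_mono Ssub) (simp add: finite_degree_le)
        also have "\<dots> \<le> CARD('a) ^ Suc l"
          using card_image_le[OF finite_degree_le[of l], of "\<lambda>B. w n - B"] by (simp add: card_degree_le)
        finally have "real (card S) \<le> ?q ^ Suc l" by (metis of_nat_le_iff of_nat_power)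
        also have "\<dots> = ?q * ?q powr real l" using q by (simp add: powr_realpow)
        also have "\<dots> \<le> ?q * ?q powr (2 * real ?d - u)" using q l by simp
        finally have cardS: "real (card S) \<le> ?q * ?q powr (2 * real ?d - u)" .
        have "measure (measure_pmf (p n)) S = (\<Sum>B\<in>S. pmf (p n) B)"
          using finS by (rule measure_measure_pmf_finite)
        also have "\<dots> \<le> (\<Sum>B\<in>S. ?q powr (- real ?d))"
        proof (rule sum_mono)
          fix B assume "B \<in> S"
          then have "degree B = ?d" using False by (simp add: S_def)
          then show "pmf (p n) B \<le> ?q powr (- real ?d)" using unif[of n B] by simp
        qed
        also have "\<dots> = real (card S) * ?q powr (- real ?d)" by simp
        also have "\<dots> \<le> (?q * ?q powr (2 * real ?d - u)) * ?q powr (- real ?d)"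
          by (intro mult_right_mono cardS) simp
        also have "\<dots> = ?q * ?q powr (real ?d - u)" by (simp add: powr_add[symmetric])
        finally have mS: "measure (measure_pmf (p n)) S \<le> ?q * ?q powr (real ?d - u)" .
        have "(\<Prod>i<n. pmf (p i) (w i)) * measure (measure_pmf (p n)) S
          \<le> (C * ?q powr (- s * (2 * depth w n + m n))) * (?q * ?q powr (real ?d - u))"
          using prodw mS C by (intro mult_mono) auto
        also have "\<dots> = C * ?q * ?q powr (- s * (2 * depth w n + m n) + (real ?d - u))"
          by (simp only: powr_add mult_ac)
        also have "\<dots> \<le> C * ?q * ?q powr (- s * (2 * depth w n + u))"
        proof (intro mult_left_mono powr_mono)
          \<comment> \<open>Within a digit the mass bound decays with exponent 1 in r, at least as
            fast as required since s \<le> 1; d \<le> m n makes the two regimes match at u = m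
            n.\<close>
          have "s * (u - m n) \<le> 1 * (u - m n)" using False s by (intro mult_right_mono) auto
          then show "- s * (2 * depth w n + m n) + (real ?d - u) \<le> - s * (2 * depth w n + u)"
            using dm by (simp add: algebra_simps)
        qed (use q C in auto)
        finally show ?thesis by (simp add: rs)
      qed
      then have "emeasure M A \<le> ennreal (C * ?q * r powr s)"
        unfolding emA by (rule ennreal_leI)
      moreover have "\<forall>\<omega>\<in>space M. G \<omega> \<longrightarrow> cf \<omega> \<in> U \<longrightarrow> \<omega> \<in> A"
        using agree inS by (auto simp: A_def)
      ultimately show ?thesis using A by blast
    qed
  qed
qed

section \<open>Laws for free and prescribed digits\<close>

lemma exists_pmf_finite:
  fixes f :: "'b \<Rightarrow> real"
  assumes "finite S" "\<And>x. 0 \<le> f x" "\<And>x. x \<notin> S \<Longrightarrow> f x = 0" "sum f S = 1"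
  shows "\<exists>p. \<forall>x. pmf p x = f x"
proof -
  have "(\<integral>\<^sup>+ x. ennreal (f x) \<partial>count_space UNIV) = (\<Sum>x\<in>S. ennreal (f x))"
    using assms by (intro nn_integral_count_space'[of S]) auto
  also have "\<dots> = 1" using assms by (simp add: sum_ennreal)
  finally have "pmf (embed_pmf f) x = f x" for x
    using assms(2) by (intro pmf_embed_pmf) auto
  then show ?thesis by blast
qed

text \<open>The cut-off of \<open>digit_series\<close> at degree \<open>m\<close>. It normalises a
  law of bounded degree, as the mass estimate for cylinders needs a bound on the next
  degree.\<close>

definition truncated_series :: "real \<Rightarrow> real \<Rightarrow> nat \<Rightarrow> real" where
  "truncated_series q u m = (\<Sum>j<m. (q - 1) * q powr (real (Suc j) * (1 - u)))"

text \<open>A normalisation no smaller than the total weight of degree d gives each polynomial of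
  that degree mass at most q^(-d).\<close>

lemma truncated_series_ge_term:
  assumes "1 < q" "1 \<le> d" "d \<le> m"
  shows "(q - 1) * q powr (real d * (1 - u)) \<le> truncated_series q u m"
proof -
  have "(\<Sum>j\<in>{d - 1}. (q - 1) * q powr (real (Suc j) * (1 - u))) \<le> truncated_series q u m"
    unfolding truncated_series_def using assms by (intro sum_mono2) auto
  then show ?thesis using assms(2) by simp
qed

lemma truncated_series_pos: "1 < q \<Longrightarrow> 1 \<le> m \<Longrightarrow> 0 < truncated_series q u m"
  using truncated_series_ge_term[of q 1 m u] by (auto intro: less_le_trans[rotated])

lemma exists_truncated_weight_pmf:
  assumes m: "1 \<le> m"
  defines "q \<equiv> real CARD('a::{field,finite})"
  shows "\<exists>p :: 'a poly pmf. \<forall>A. pmf p A =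
    (if 1 \<le> degree A \<and> degree A \<le> m then q powr (- u * real (degree A)) / truncated_series q u m else 0)"
    (is "\<exists>p. \<forall>A. pmf p A = ?f A")
proof (rule exists_pmf_finite)
  let ?S = "\<Union>j\<in>{..<m}. {A :: 'a poly. degree A = Suc j}"
  have q: "1 < q" unfolding q_def by (rule card_field_gt_1)
  have Z: "0 < truncated_series q u m" using q m by (rule truncated_series_pos)
  show "finite ?S" by (simp add: finite_degree_eq)
  show "0 \<le> ?f A" for A using Z by simp
  show "?f A = 0" if A: "A \<notin> ?S" for A
  proof -
    have "\<not> (1 \<le> degree A \<and> degree A \<le> m)"
    proof
      assume "1 \<le> degree A \<and> degree A \<le> m"
      then have "A \<in> ?S" by (intro UN_I[of "degree A - 1"]) auto
      with A show False ..
    qed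
    then show ?thesis by (simp only: if_False)
  qed
  have "sum ?f ?S = (\<Sum>j<m. sum ?f {A :: 'a poly. degree A = Suc j})"
    by (rule sum.UNION_disjoint) (auto simp: finite_degree_eq)
  also have "\<dots> = (\<Sum>j<m. (q - 1) * q powr (real (Suc j) * (1 - u)) / truncated_series q u m)"
  proof (rule sum.cong)
    fix j assume j: "j \<in> {..<m}"
    have "sum ?f {A :: 'a poly. degree A = Suc j} =
        (\<Sum>A\<in>{A :: 'a poly. degree A = Suc j}. q powr (- u * real (Suc j)) / truncated_series q u m)"
      using j by (intro sum.cong) auto
    also have "\<dots> = real (card {A :: 'a poly. degree A = Suc j}) * (q powr (- u * real (Suc j)) / truncated_series q u m)"
      by (rule sum_constant)
    also have "\<dots> = (q - 1) * (q powr real (Suc j) * q powr (- u * real (Suc j))) / truncated_series q u m"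
      using q card_degree_eq[of "Suc j", where 'a='a] by (simp add: q_def[symmetric] powr_realpow del: of_nat_Suc power_Suc)
    also have "q powr real (Suc j) * q powr (- u * real (Suc j)) = q powr (real (Suc j) * (1 - u))"
      unfolding powr_add[symmetric] by (simp add: algebra_simps)
    finally show "sum ?f {A :: 'a poly. degree A = Suc j} =
      (q - 1) * q powr (real (Suc j) * (1 - u)) / truncated_series q u m" .
  qed simp
  also have "\<dots> = truncated_series q u m / truncated_series q u m"
    unfolding truncated_series_def by (rule sum_divide_distrib[symmetric])
  finally show "sum ?f ?S = 1" using Z by simp
qed

text \<open>In the schedule \<open>\<delta>\<close>, the value 0 leaves a digit free up to degree \<open>m\<close>, and a positive
  value prescribes its degree.  The slack \<open>\<sigma> n\<close> is the exponent by which the mass of a cylinder of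
  length \<open>n\<close> is smaller than the power \<open>s\<close> of its diameter.\<close>

lemma hausdorff_dim_schedule:
  fixes E :: "'a::{field,finite} fls set" and \<delta> :: "nat \<Rightarrow> nat" and \<sigma> :: "nat \<Rightarrow> real"
  defines "q \<equiv> real CARD('a)"
  assumes s: "0 < s" "s \<le> 1" and m: "1 \<le> m" and c: "0 \<le> c"
    and \<sigma>0: "\<sigma> 0 \<le> 0"
    and free: "\<And>n. \<delta> n = 0 \<Longrightarrow> \<sigma> (Suc n) \<le> \<sigma> n + log q (truncated_series q (2 * s) m)"
      "\<And>n. \<delta> n = 0 \<Longrightarrow> 0 \<le> \<sigma> n + c"
    and forced: "\<And>n. 0 < \<delta> n \<Longrightarrow> \<sigma> (Suc n) \<le> \<sigma> n + (1 - 2 * s) * real (\<delta> n)"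
      "\<And>n. 0 < \<delta> n \<Longrightarrow> s * real (\<delta> n) \<le> \<sigma> n + c"
    and sub: "\<And>x. x \<in> infinite_expansion \<Longrightarrow> (\<And>n. 0 < \<delta> n \<Longrightarrow> degree (digit x n) = \<delta> n) \<Longrightarrow> x \<in> E"
  shows "ereal s \<le> hausdorff_dim fls_rho E"
proof -
  define Z where "Z = truncated_series q (2 * s) m"
  have q: "1 < q" unfolding q_def by (rule card_field_gt_1)
  have Z: "0 < Z" unfolding Z_def using q m by (rule truncated_series_pos)
  obtain w :: "'a poly pmf" where w: "\<And>A. pmf w A =
    (if 1 \<le> degree A \<and> degree A \<le> m then q powr (- (2 * s) * real (degree A)) / Z else 0)"
    using exists_truncated_weight_pmf[OF m, of "2 * s", where 'a='a] unfolding q_def Z_def by blast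
  \<comment> \<open>A forced digit is uniform on its degree. Its mass, at most q^(-\<delta>), is
    compared with q^(-2 s \<delta>), which is the origin of the change (1 - 2 s) \<delta> in the
    slack.\<close>
  define p where "p n = (if \<delta> n = 0 then w else pmf_of_set {A. degree A = \<delta> n})" for n
  define M where "M n = (if \<delta> n = 0 then m else \<delta> n)" for n
  have ne: "{A :: 'a poly. degree A = d} \<noteq> {}" for d
    using degree_monom_eq[of "1 :: 'a" d] by auto
  have set_free: "1 \<le> degree A \<and> degree A \<le> m" if "A \<in> set_pmf (p n)" "\<delta> n = 0" for A n
    using that w[of A] by (auto simp: p_def set_pmf_eq split: if_splits)
  have set_forced: "degree A = \<delta> n" if "A \<in> set_pmf (p n)" "\<delta> n \<noteq> 0" for A n
    using that ne by (simp add: p_def finite_degree_eq)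
  have pmf_forced: "pmf (p n) A \<le> q powr (- real (degree A))" if n: "\<delta> n \<noteq> 0" for n A
  proof (cases "degree A = \<delta> n")
    case True
    have "pmf (p n) A = 1 / ((q - 1) * q ^ \<delta> n)"
      using n ne True card_degree_eq[of "\<delta> n", where 'a='a] by (simp add: p_def finite_degree_eq q_def)
    also have "\<dots> \<le> 1 / (1 * q ^ \<delta> n)"
      using q card_field_ge_2[where 'a='a]
      by (intro divide_left_mono mult_right_mono mult_pos_pos) (auto simp: q_def)
    also have "\<dots> = q powr (- real (degree A))"
      using q True by (simp add: powr_minus powr_realpow field_simps)
    finally show ?thesis .
  next
    case False
    then show ?thesis using n ne by (simp add: p_def finite_degree_eq)
  qed
  show ?thesis
  proof (rule hausdorff_dim_cf_ge[where p = p and m = "\<lambda>n. real (M n)" and C = "q powr (c + s * real m)"])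
    show "0 < s" "s \<le> 1" by fact+
    show "0 < q powr (c + s * real m)" using q by simp
    show "1 \<le> degree A" if "A \<in> set_pmf (p n)" for n A
      using set_free[OF that] set_forced[OF that] by (cases "\<delta> n = 0") auto
    show "real (degree A) \<le> real (M n)" if "A \<in> set_pmf (p n)" for n A
      using set_free[OF that] set_forced[OF that] by (cases "\<delta> n = 0") (auto simp: M_def)
    show "pmf (p n) A \<le> real CARD('a) powr (- real (degree A))" for n A
    proof (cases "\<delta> n = 0 \<and> 1 \<le> degree A \<and> degree A \<le> m")
      case True
      have "1 * q powr (real (degree A) * (1 - 2 * s)) \<le> (q - 1) * q powr (real (degree A) * (1 - 2 * s))"
        using card_field_ge_2[where 'a='a] by (intro mult_right_mono) (auto simp: q_def)
      also have "\<dots> \<le> Z" unfolding Z_def using q True by (intro truncated_series_ge_term) auto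
      finally have "q powr (- real (degree A)) * q powr (real (degree A) * (1 - 2 * s)) \<le> q powr (- real (degree A)) * Z"
        by (intro mult_left_mono) auto
      then have "q powr (- (2 * s) * real (degree A)) \<le> q powr (- real (degree A)) * Z"
        by (simp add: powr_add[symmetric] algebra_simps)
      then show ?thesis using True Z w[of A] by (simp add: p_def q_def[symmetric] pos_divide_le_eq)
    next
      case False
      then show ?thesis using pmf_forced[of n A] w[of A] by (cases "\<delta> n = 0") (auto simp: p_def q_def)
    qed
    show "cf \<omega> \<in> E" if \<omega>: "\<And>i. \<omega> i \<in> set_pmf (p i)" for \<omega>
    proof -
      have deg: "1 \<le> degree (\<omega> i)" for i
        using set_free[OF \<omega>] set_forced[OF \<omega>] by (cases "\<delta> i = 0") auto
      show ?thesis
        using cf_in_infinite_expansion[of \<omega>] digit_cf[of \<omega>] deg set_forced[OF \<omega>] by (intro sub) auto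
    qed
    show "(\<Prod>i<n. pmf (p i) (\<omega> i)) \<le> q powr (c + s * real m) * real CARD('a) powr (- s * (2 * depth \<omega> n + real (M n)))"
      if \<omega>: "\<And>i. \<omega> i \<in> set_pmf (p i)" for \<omega> n
    proof -
      have "(\<Prod>i<n. pmf (p i) (\<omega> i)) \<le> q powr (- (2 * s) * depth \<omega> n - \<sigma> n)"
      proof (induction n)
        case 0
        then show ?case using q \<sigma>0 by (simp add: depth_def ge_one_powr_ge_zero)
      next
        case (Suc n)
        let ?d = "real (degree (\<omega> n))"
        have "pmf (p n) (\<omega> n) \<le> q powr (- (2 * s) * ?d - (\<sigma> (Suc n) - \<sigma> n))"
        proof (cases "\<delta> n = 0")
          case True
          have "pmf (p n) (\<omega> n) = q powr (- (2 * s) * ?d - log q Z)"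
            using set_free[OF \<omega> True] True w[of "\<omega> n"] q Z by (simp add: p_def powr_diff)
          also have "\<dots> \<le> q powr (- (2 * s) * ?d - (\<sigma> (Suc n) - \<sigma> n))"
            using free(1)[OF True] q by (intro powr_mono) (auto simp: Z_def)
          finally show ?thesis .
        next
          case False
          have "pmf (p n) (\<omega> n) \<le> q powr (- ?d)" using False by (rule pmf_forced)
          also have "\<dots> \<le> q powr (- (2 * s) * ?d - (\<sigma> (Suc n) - \<sigma> n))"
            using forced(1)[of n] False set_forced[OF \<omega> False] q by (intro powr_mono) (auto simp: algebra_simps)
          finally show ?thesis .
        qed
        then have "(\<Prod>i<Suc n. pmf (p i) (\<omega> i)) \<le>
            q powr (- (2 * s) * depth \<omega> n - \<sigma> n) * q powr (- (2 * s) * ?d - (\<sigma> (Suc n) - \<sigma> n))"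
          using Suc by (simp add: mult_mono)
        then show ?case by (simp add: powr_add[symmetric] depth_Suc algebra_simps)
      qed
      also have "\<dots> \<le> q powr ((c + s * real m) + - s * (2 * depth \<omega> n + real (M n)))"
      proof (rule powr_mono)
        have "s * real (M n) \<le> \<sigma> n + (c + s * real m)"
        proof (cases "\<delta> n = 0")
          case False
          have "0 \<le> s * real m" using s by simp
          with False forced(2)[of n] show ?thesis by (simp add: M_def)
        qed (use free(2)[of n] in \<open>simp add: M_def\<close>)
        then show "- (2 * s) * depth \<omega> n - \<sigma> n \<le> (c + s * real m) + - s * (2 * depth \<omega> n + real (M n))"
          by (simp add: algebra_simps)
      qed (use q in simp)
      finally show ?thesis by (simp only: powr_add q_def)
    qed
  qed
qed

text \<open>For s = 1 / (1 + c) one has 1 - 2 s = s (c - 1), so the slack collected from degrees 1,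
  c, ..., c^(n - 1) is s (c^n - 1), which up to a constant pays for a digit of degree c^n. As all
  digits are prescribed, the positions where \<Phi> n \<le> c^n need not be known in
  advance.\<close>

lemma hausdorff_dim_F_set_exponential_ge:
  assumes k: "1 \<le> k" and c: "1 < c" and inf: "\<exists>\<^sub>\<infinity>n. \<Phi> n \<le> c ^ n"
  shows "ereal (1 / (1 + c)) \<le> hausdorff_dim fls_rho (F_set k \<Phi> :: 'a::{field,finite} fls set)"
proof -
  define s where "s = 1 / (1 + c)"
  define \<delta> where "\<delta> n = nat \<lceil>c ^ n\<rceil>" for n
  define \<sigma> where "\<sigma> n = (1 - 2 * s) * (\<Sum>i<n. real (\<delta> i))" for n
  have s: "0 < s" "s \<le> 1" "1 - 2 * s = s * (c - 1)" using c by (auto simp: s_def field_simps)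
  have \<delta>: "c ^ n \<le> real (\<delta> n)" "real (\<delta> n) \<le> c ^ n + 1" "0 < \<delta> n" for n
  proof -
    have "1 \<le> c ^ n" using c by simp
    then show "c ^ n \<le> real (\<delta> n)" "real (\<delta> n) \<le> c ^ n + 1" "0 < \<delta> n"
    unfolding \<delta>_def by linarith+
  qed
  have \<delta>0: "\<delta> n \<noteq> 0" for n using \<delta>(3)[of n] by simp
  have "ereal s \<le> hausdorff_dim fls_rho (F_set k \<Phi> :: 'a fls set)"
  \<comment> \<open>Of the constant 2 s, one s makes up for the -1 in the geometric sum and the
    other pays for rounding c^n up.\<close>
  proof (rule hausdorff_dim_schedule[where \<delta> = \<delta> and \<sigma> = \<sigma> and m = 1 and c = "2 * s"])
    show "s * real (\<delta> n) \<le> \<sigma> n + 2 * s" for n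
    proof -
      have "(c - 1) * (\<Sum>i<n. c ^ i) = c ^ n - 1" using power_diff_1_eq[of c n] c by simp
      then have "s * (c ^ n - 1) = (1 - 2 * s) * (\<Sum>i<n. c ^ i)" by (simp add: s(3))
      also have "\<dots> \<le> \<sigma> n"
        unfolding \<sigma>_def using \<delta>(1) c s by (intro mult_left_mono sum_mono) auto
      finally have "s * (c ^ n - 1) \<le> \<sigma> n" .
      moreover have "s * real (\<delta> n) \<le> s * (c ^ n + 1)" using \<delta>(2) s by (intro mult_left_mono) auto
      ultimately show ?thesis by (simp add: algebra_simps)
    qed
    show "x \<in> F_set k \<Phi>" if x: "x \<in> infinite_expansion" "\<And>n. 0 < \<delta> n \<Longrightarrow> degree (digit x n) = \<delta> n"
      for x :: "'a fls"
    proof -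
      have "\<exists>\<^sub>\<infinity>n. \<Phi> n \<le> (\<Sum>i<k. real (degree (digit x (n + i))))"
        using inf
      proof (rule INFM_mono)
        fix n assume "\<Phi> n \<le> c ^ n"
        also have "\<dots> \<le> real (degree (digit x (n + 0)))" using x(2) \<delta>(1,3) by simp
        also have "\<dots> = (\<Sum>i\<in>{0}. real (degree (digit x (n + i))))" by simp
        also have "\<dots> \<le> (\<Sum>i<k. real (degree (digit x (n + i))))"
          using k by (intro sum_mono2) auto
        finally show "\<Phi> n \<le> (\<Sum>i<k. real (degree (digit x (n + i))))" .
      qed
      then show ?thesis using x(1) k by (simp add: F_set_eq)
    qed
  qed (use s \<delta>(3) \<delta>0 in \<open>auto simp: \<sigma>_def algebra_simps\<close>)
  then show ?thesis by (simp only: s_def)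
qed

text \<open>The degrees realise the optimal splitting in the recursion for \<open>f\<^sub>k\<close>; the error term
  pays for rounding.\<close>

lemma block_degrees:
  assumes s: "1/2 < s" "s \<le> 1" and L: "0 \<le> L"
  shows "\<exists>d :: nat \<Rightarrow> nat. (\<forall>j. 1 \<le> d j) \<and> L \<le> (\<Sum>j<Suc k. real (d j)) \<and>
    (\<forall>j<Suc k. (2 * s - 1) * (\<Sum>i<j. real (d i)) + s * real (d j) \<le> f_rec (Suc k) s * L + 2 * real (Suc k)) \<and>
    (2 * s - 1) * (\<Sum>j<Suc k. real (d j)) \<le> f_rec (Suc k) s * L + 2 * real (Suc k)"
  using L
proof (induction k arbitrary: L)
  case 0
  \<comment> \<open>Rounding up adds at most 1, and the extra 1 keeps the degree positive even for L
    = 0; hence the allowance of 2 per digit.\<close>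
  define d where "d = nat \<lceil>L\<rceil> + 1"
  have d: "L \<le> real d" "real d \<le> L + 2" "1 \<le> d" using 0 unfolding d_def by linarith+
  have "s * real d \<le> s * (L + 2)" using d(2) s by (intro mult_left_mono) auto
  then have "s * real d \<le> s * L + 2" using s by (simp add: algebra_simps)
  moreover have "(2 * s - 1) * real d \<le> s * real d" using s by (intro mult_right_mono) auto
  ultimately have "(2 * s - 1) * real d \<le> s * L + 2" by linarith
  with d \<open>s * real d \<le> s * L + 2\<close> show ?case by (intro exI[of _ "\<lambda>_. d"]) auto
next
  case (Suc k)
  define f where "f = f_rec (Suc k) s"
  define g where "g = f_rec (Suc (Suc k)) s"
  define \<alpha> where "\<alpha> = f / (1 - s + f)"
  have f: "0 < f" unfolding f_def using s by (intro f_rec_pos) auto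
  have g: "g = s * \<alpha>" by (simp add: g_def \<alpha>_def f_def)
  have \<alpha>: "0 < \<alpha>" "\<alpha> \<le> 1" "\<alpha> * (1 - 2 * s + f) = f - s * \<alpha>"
    using f s by (auto simp: \<alpha>_def field_simps)
  have L': "0 \<le> (1 - \<alpha>) * L" using \<alpha> Suc.prems by simp
  \<comment> \<open>With \<alpha> L spent on the first digit, its loss plus the cost of the rest
    equals its own cost s \<alpha> L = g L, so no position in the block is cheaper to cover.\<close>
  have split: "f * ((1 - \<alpha>) * L) + (2 * s - 1) * (\<alpha> * L) = g * L"
  proof -
    have "f * ((1 - \<alpha>) * L) + (2 * s - 1) * (\<alpha> * L) = (f - \<alpha> * (1 - 2 * s + f)) * L"
      by (simp add: algebra_simps)
    then show ?thesis by (simp add: \<alpha>(3) g)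
  qed
  obtain d :: "nat \<Rightarrow> nat" where d: "\<And>j. 1 \<le> d j" "(1 - \<alpha>) * L \<le> (\<Sum>j<Suc k. real (d j))"
    "\<And>j. j < Suc k \<Longrightarrow> (2 * s - 1) * (\<Sum>i<j. real (d i)) + s * real (d j) \<le> f * ((1 - \<alpha>) * L) + 2 * real (Suc k)"
    "(2 * s - 1) * (\<Sum>j<Suc k. real (d j)) \<le> f * ((1 - \<alpha>) * L) + 2 * real (Suc k)"
    using Suc.IH[OF L'] unfolding f_def by blast
  define d0 where "d0 = nat \<lceil>\<alpha> * L\<rceil> + 1"
  have "0 \<le> \<alpha> * L" using \<alpha> Suc.prems by simp
  then have d0: "\<alpha> * L \<le> real d0" "real d0 \<le> \<alpha> * L + 2" unfolding d0_def by linarith+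
  have d0s: "(2 * s - 1) * real d0 \<le> (2 * s - 1) * (\<alpha> * L) + 2"
  proof -
    have "(2 * s - 1) * real d0 \<le> (2 * s - 1) * (\<alpha> * L + 2)" using d0(2) s by (intro mult_left_mono) auto
    then show ?thesis using s by (simp add: algebra_simps)
  qed
  let ?d = "\<lambda>j. case j of 0 \<Rightarrow> d0 | Suc j \<Rightarrow> d j"
  have sum: "(\<Sum>i<Suc j. real (?d i)) = real d0 + (\<Sum>i<j. real (d i))" for j
    unfolding sum.lessThan_Suc_shift by simp
  have "(2 * s - 1) * (\<Sum>i<j. real (?d i)) + s * real (?d j) \<le> g * L + 2 * real (Suc (Suc k))"
    if j: "j < Suc (Suc k)" for j
  proof (cases j)
    case 0
    have "s * real d0 \<le> s * (\<alpha> * L + 2)" using d0(2) s by (intro mult_left_mono) auto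
    also have "\<dots> \<le> g * L + 2" using s by (simp add: g algebra_simps)
    finally show ?thesis using 0 by simp
  next
    case (Suc i)
    have "(2 * s - 1) * (\<Sum>l<j. real (?d l)) + s * real (?d j) =
        (2 * s - 1) * real d0 + ((2 * s - 1) * (\<Sum>l<i. real (d l)) + s * real (d i))"
      unfolding Suc sum by (simp add: algebra_simps)
    also have "\<dots> \<le> ((2 * s - 1) * (\<alpha> * L) + 2) + (f * ((1 - \<alpha>) * L) + 2 * real (Suc k))"
      using j Suc by (intro add_mono d0s d(3)) simp
    also have "\<dots> = g * L + 2 * real (Suc (Suc k))" unfolding split[symmetric] by simp
    finally show ?thesis .
  qed
  moreover have "(2 * s - 1) * (\<Sum>j<Suc (Suc k). real (?d j)) \<le> g * L + 2 * real (Suc (Suc k))"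
  proof -
    have "(2 * s - 1) * (\<Sum>j<Suc (Suc k). real (?d j)) = (2 * s - 1) * real d0 + (2 * s - 1) * (\<Sum>l<Suc k. real (d l))"
      unfolding sum[of "Suc k"] by (simp add: distrib_left)
    also have "\<dots> \<le> ((2 * s - 1) * (\<alpha> * L) + 2) + (f * ((1 - \<alpha>) * L) + 2 * real (Suc k))"
      by (intro add_mono d0s d(4))
    also have "\<dots> = g * L + 2 * real (Suc (Suc k))" unfolding split[symmetric] by simp
    finally show ?thesis .
  qed
  moreover have "L \<le> (\<Sum>j<Suc (Suc k). real (?d j))"
    unfolding sum[of "Suc k"] using d0(1) d(2) by (simp add: algebra_simps)
  moreover have "1 \<le> ?d j" for j using d(1) by (cases j) (auto simp: d0_def)
  ultimately show ?case unfolding g_def[symmetric] by (intro exI[of _ ?d]) blast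
qed

lemma exists_truncated_series_ge:
  assumes "1 < q" "1 < u" "x < digit_series q u"
  shows "\<exists>m\<ge>1. x \<le> truncated_series q u m"
proof -
  have "(\<lambda>m. truncated_series q u m) \<longlonglongrightarrow> digit_series q u"
    using digit_series_sums[OF assms(1,2)] by (simp add: sums_def truncated_series_def)
  then have "eventually (\<lambda>m. x < truncated_series q u m) sequentially"
    using assms(3) by (rule order_tendstoD(1))
  then have "eventually (\<lambda>m. x < truncated_series q u m \<and> 1 \<le> m) sequentially"
    using eventually_ge_at_top by (rule eventually_conj)
  then show ?thesis by (auto simp: eventually_sequentially intro: less_imp_le)
qed

text \<open>Blocks of prescribed degrees start at the positions \<open>\<nu> i\<close>.  Each block uses up the slack
  gained from the free digits preceding it, for which the positions must be sparse.\<close>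

lemma hausdorff_dim_F_set_ge:
  assumes k: "1 \<le> k" and s: "1/2 < s" "s \<le> 1" and B: "0 \<le> B" "B < B'"
    and less: "real CARD('a) powr (B' * f_rec k s) < digit_series (real CARD('a)) (2 * s)"
    and inf: "\<exists>\<^sub>\<infinity>n. \<Phi> n \<le> B * real n"
  shows "ereal s \<le> hausdorff_dim fls_rho (F_set k \<Phi> :: 'a::{field,finite} fls set)"
proof -
  let ?q = "real CARD('a)"
  have q: "1 < ?q" by (rule card_field_gt_1)
  obtain k' where k': "k = Suc k'" using k by (cases k) auto
  define f where "f = f_rec k s"
  define c where "c = 2 * real k"
  have f: "0 < f" unfolding f_def k' using s by (intro f_rec_pos) auto
  obtain m where m: "1 \<le> m" "?q powr (B' * f) \<le> truncated_series ?q (2 * s) m"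
    using exists_truncated_series_ge[of ?q "2 * s" "?q powr (B' * f)"] q s less by (auto simp: f_def)
  have "log ?q (?q powr (B' * f)) \<le> log ?q (truncated_series ?q (2 * s) m)"
    using q m by (subst log_le_cancel_iff) (auto intro: truncated_series_pos)
  then have \<lambda>: "B' * f \<le> log ?q (truncated_series ?q (2 * s) m)" using q by simp
  \<comment> \<open>A block at n needs slack f B n + c, while the free digits from a to n yield B' f
    each. Since B < B', every sufficiently large n is affordable.\<close>
  have "\<exists>n\<ge>a. \<Phi> n \<le> B * real n \<and> f * (B * real n) + c \<le> B' * f * real (n - a)" for a
  proof -
    obtain N where N: "(B' * f * real a + c) / ((B' - B) * f) \<le> real N" using real_arch_simple by blast
    obtain n where n: "max a N \<le> n" "\<Phi> n \<le> B * real n" using inf unfolding INFM_nat_le by blast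
    have "B' * f * real a + c \<le> real N * ((B' - B) * f)"
      using N B f by (simp add: divide_le_eq)
    also have "\<dots> \<le> real n * ((B' - B) * f)" using n B f by (intro mult_right_mono) auto
    finally have "f * (B * real n) + c \<le> B' * f * real (n - a)"
      using n by (simp add: of_nat_diff algebra_simps)
    then show ?thesis using n by (intro exI[of _ n]) auto
  qed
  then obtain pick where nx: "\<And>a. a \<le> pick a" "\<And>a. \<Phi> (pick a) \<le> B * real (pick a)"
    "\<And>a. f * (B * real (pick a)) + c \<le> B' * f * real (pick a - a)" by metis
  \<comment> \<open>Stage i consists of free digits from \<open>start i\<close> up to the block of k
    digits at \<open>\<nu> i\<close>; the next stage begins right after that block.\<close>
  define \<nu> where "\<nu> = rec_nat (pick 0) (\<lambda>i v. pick (v + k))"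
  define start where "start i = (case i of 0 \<Rightarrow> 0 | Suc i \<Rightarrow> \<nu> i + k)" for i
  have \<nu>: "\<nu> i = pick (start i)" for i by (cases i) (auto simp: \<nu>_def start_def)
  have start_Suc: "start (Suc i) = \<nu> i + k" for i by (simp add: start_def)
  have start_le: "start i \<le> \<nu> i" for i using nx(1) by (simp add: \<nu>)
  have start_less: "start i < start (Suc i)" for i using start_le[of i] k by (simp add: start_Suc)
  have mono: "start i \<le> start j" if "i \<le> j" for i j
    by (rule lift_Suc_mono_le[of start]) (use that start_less in \<open>auto intro: less_imp_le\<close>)
  have \<nu>_ge: "i \<le> \<nu> i" for i
  proof (induction i)
    case (Suc i)
    then show ?case using start_le[of "Suc i"] k by (simp add: start_Suc)
  qed simp
  obtain d :: "nat \<Rightarrow> nat \<Rightarrow> nat" where d: "\<And>i j. 1 \<le> d i j"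
    "\<And>i. B * real (\<nu> i) \<le> (\<Sum>j<k. real (d i j))"
    "\<And>i j. j < k \<Longrightarrow> (2 * s - 1) * (\<Sum>l<j. real (d i l)) + s * real (d i j) \<le> f * (B * real (\<nu> i)) + c"
    "\<And>i. (2 * s - 1) * (\<Sum>j<k. real (d i j)) \<le> f * (B * real (\<nu> i)) + c"
  proof -
    have "\<forall>i. \<exists>d :: nat \<Rightarrow> nat. (\<forall>j. 1 \<le> d j) \<and> B * real (\<nu> i) \<le> (\<Sum>j<k. real (d j)) \<and>
      (\<forall>j<k. (2 * s - 1) * (\<Sum>i<j. real (d i)) + s * real (d j) \<le> f * (B * real (\<nu> i)) + c) \<and>
      (2 * s - 1) * (\<Sum>j<k. real (d j)) \<le> f * (B * real (\<nu> i)) + c"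
      unfolding f_def c_def k' using s B by (intro allI block_degrees) auto
    from choice[OF this] show ?thesis using that by blast
  qed
  define idx where "idx n = (LEAST i. n < start (Suc i))" for n
  define \<delta> where "\<delta> n = (if \<nu> (idx n) \<le> n then d (idx n) (n - \<nu> (idx n)) else 0)" for n
  \<comment> \<open>Each free digit is credited with B' f, a lower bound for the logarithm of the
    truncated series, which keeps the slack explicit.\<close>
  define \<sigma> where "\<sigma> = rec_nat 0 (\<lambda>n v. v + (if \<delta> n = 0 then B' * f else (1 - 2 * s) * real (\<delta> n)))"
  have \<sigma>_Suc: "\<sigma> (Suc n) = \<sigma> n + (if \<delta> n = 0 then B' * f else (1 - 2 * s) * real (\<delta> n))" for n
    by (simp add: \<sigma>_def)
  have idx: "idx n = i" if "start i \<le> n" "n < start (Suc i)" for n i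
    unfolding idx_def
  proof (rule Least_equality)
    show "n < start (Suc i)" by fact
    show "i \<le> j" if "n < start (Suc j)" for j
    proof (rule ccontr)
      assume "\<not> i \<le> j"
      then have "start (Suc j) \<le> start i" by (intro mono) auto
      with \<open>start i \<le> n\<close> that show False by simp
    qed
  qed
  have \<delta>_free: "\<delta> n = 0" if "start i \<le> n" "n < \<nu> i" for n i
    using that idx[of i n] by (simp add: \<delta>_def start_Suc)
  have \<delta>_forced: "\<delta> (\<nu> i + j) = d i j" if "j < k" for i j
    using that idx[of i "\<nu> i + j"] start_le[of i] by (simp add: \<delta>_def start_Suc)
  have \<sigma>_free: "\<sigma> (start i + j) = \<sigma> (start i) + B' * f * real j" if "start i + j \<le> \<nu> i" for i j
    using that
  proof (induction j)
    case (Suc j)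
    then show ?case using \<delta>_free[of i "start i + j"] by (simp add: \<sigma>_Suc algebra_simps)
  qed simp
  have \<sigma>_forced: "\<sigma> (\<nu> i + j) = \<sigma> (\<nu> i) - (2 * s - 1) * (\<Sum>l<j. real (d i l))" if "j \<le> k" for i j
    using that
  proof (induction j)
    case (Suc j)
    then show ?case using \<delta>_forced[of j i] d(1)[of i j] by (simp add: \<sigma>_Suc algebra_simps)
  qed simp
  \<comment> \<open>A stage that starts with nonnegative slack can afford its block, and since the
    block spends no more than f B \<nu> + c, the next stage starts with nonnegative slack
    again.\<close>
  have \<sigma>_\<nu>: "f * (B * real (\<nu> i)) + c \<le> \<sigma> (\<nu> i)" if "0 \<le> \<sigma> (start i)" for i
  proof -
    have "\<sigma> (start i + (\<nu> i - start i)) = \<sigma> (start i) + B' * f * real (\<nu> i - start i)"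
      using start_le by (intro \<sigma>_free) simp
    then show ?thesis using that nx(3)[of "start i"] start_le[of i] by (simp add: \<nu>[symmetric])
  qed
  have \<sigma>_start: "0 \<le> \<sigma> (start i)" for i
  proof (induction i)
    case 0
    show ?case by (simp add: start_def \<sigma>_def)
  next
    case (Suc i)
    then show ?case using \<sigma>_forced[of k i] \<sigma>_\<nu>[OF Suc] d(4)[of i] by (simp add: start_Suc)
  qed
  have ex: "\<exists>i. start i \<le> n \<and> n < start (Suc i)" for n
  proof -
    have "n < start (Suc n)" using \<nu>_ge[of n] k by (simp add: start_Suc)
    define i where "i = (LEAST i. n < start (Suc i))"
    have i: "n < start (Suc i)" unfolding i_def by (rule LeastI) fact
    moreover have "start i \<le> n"
    proof (cases i)
      case (Suc j)
      then have "\<not> n < start (Suc j)" unfolding i_def by (intro not_less_Least) (simp add: i_def)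
      then show ?thesis using Suc by simp
    qed (simp add: start_def)
    ultimately show ?thesis by blast
  qed
  have cases: "(\<delta> n = 0 \<and> 0 \<le> \<sigma> n) \<or> (0 < \<delta> n \<and> s * real (\<delta> n) \<le> \<sigma> n)" for n
  proof -
    obtain i where i: "start i \<le> n" "n < start (Suc i)" using ex by blast
    show ?thesis
    proof (cases "n < \<nu> i")
      case True
      have "0 \<le> B' * f * real (n - start i)" using B f by simp
      then show ?thesis
        using True i \<delta>_free[of i n] \<sigma>_free[of i "n - start i"] \<sigma>_start[of i] by simp
    next
      case False
      define j where "j = n - \<nu> i"
      have j: "n = \<nu> i + j" "j < k" using False i by (auto simp: j_def start_Suc)
      then show ?thesis
        using \<delta>_forced[OF j(2), of i] d(1)[of i j] d(3)[OF j(2), of i] \<sigma>_forced[of j i] \<sigma>_\<nu>[OF \<sigma>_start, of i]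
        by simp
    qed
  qed
  show ?thesis
  proof (rule hausdorff_dim_schedule[where \<delta> = \<delta> and \<sigma> = \<sigma> and m = m and c = 0])
    show "0 < s" "s \<le> 1" "1 \<le> m" "(0::real) \<le> 0" using s m by auto
    show "\<sigma> 0 \<le> 0" by (simp add: \<sigma>_def)
    show "\<sigma> (Suc n) \<le> \<sigma> n + log ?q (truncated_series ?q (2 * s) m)" "0 \<le> \<sigma> n + 0" if "\<delta> n = 0" for n
      using that \<lambda> cases[of n] by (auto simp: \<sigma>_Suc)
    show "\<sigma> (Suc n) \<le> \<sigma> n + (1 - 2 * s) * real (\<delta> n)" "s * real (\<delta> n) \<le> \<sigma> n + 0" if "0 < \<delta> n" for n
      using that cases[of n] by (auto simp: \<sigma>_Suc)
    show "x \<in> F_set k \<Phi>" if x: "x \<in> infinite_expansion" "\<And>n. 0 < \<delta> n \<Longrightarrow> degree (digit x n) = \<delta> n"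
      for x :: "'a fls"
    proof -
      have "\<Phi> (\<nu> i) \<le> (\<Sum>j<k. real (degree (digit x (\<nu> i + j))))" for i
      proof -
        have "\<Phi> (\<nu> i) \<le> (\<Sum>j<k. real (d i j))" using nx(2)[of "start i"] d(2)[of i] by (simp add: \<nu>[symmetric])
        also have "\<dots> = (\<Sum>j<k. real (degree (digit x (\<nu> i + j))))"
        proof (rule sum.cong)
          fix j assume "j \<in> {..<k}"
          then show "real (d i j) = real (degree (digit x (\<nu> i + j)))"
            using x(2)[of "\<nu> i + j"] \<delta>_forced[of j i] d(1)[of i j] by simp
        qed simp
        finally show ?thesis .
      qed
      then have "\<exists>\<^sub>\<infinity>n. \<Phi> n \<le> (\<Sum>j<k. real (degree (digit x (n + j))))"
        unfolding INFM_nat_le using \<nu>_ge by blast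
      then show ?thesis using x(1) k by (simp add: F_set_eq)
    qed
  qed
qed

section \<open>The dimension equation\<close>

lemma f_rec_mono:
  assumes "0 < s" "s \<le> s'" "s' \<le> 1"
  shows "f_rec (Suc k) s \<le> f_rec (Suc k) s'"
proof (induction k)
  case (Suc k)
  let ?f = "f_rec (Suc k) s" and ?f' = "f_rec (Suc k) s'"
  have f: "0 < ?f" "0 < ?f'" using assms by (auto intro: f_rec_pos)
  have "?f * (1 - s') \<le> ?f' * (1 - s)" using assms f Suc by (intro mult_mono) auto
  then have "?f / (1 - s + ?f) \<le> ?f' / (1 - s' + ?f')"
    using assms f by (intro mult_imp_div_pos_le) (auto simp: field_simps)
  then have "s * (?f / (1 - s + ?f)) \<le> s' * (?f' / (1 - s' + ?f'))"
    using assms f by (intro mult_mono) auto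
  then show ?case by simp
qed (use assms in simp)

lemma continuous_on_f_rec:
  assumes "A \<subseteq> {0<..1}"
  shows "continuous_on A (f_rec (Suc k))"
proof (induction k)
  case 0
  then show ?case by (simp add: continuous_on_id)
next
  case (Suc k)
  have "1 - s + f_rec (Suc k) s \<noteq> 0" if "s \<in> A" for s
    using that assms f_rec_pos[of s k] by force
  then show ?case using Suc by (simp, intro continuous_intros) auto
qed

text \<open>The value of \<open>B\<close> for which \<open>s\<close> solves the equation.\<close>

definition critical_ratio :: "real \<Rightarrow> nat \<Rightarrow> real \<Rightarrow> real" where
  "critical_ratio q k s = log q (digit_series q (2 * s)) / f_rec k s"

lemma
  assumes "1 < q" "1 \<le> k" "1/2 < s" "s \<le> 1"
  shows critical_ratio_less_iff: "critical_ratio q k s < B \<longleftrightarrow> digit_series q (2 * s) < q powr (B * f_rec k s)"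
    and less_critical_ratio_iff: "B < critical_ratio q k s \<longleftrightarrow> q powr (B * f_rec k s) < digit_series q (2 * s)"
    and critical_ratio_eq_iff: "critical_ratio q k s = B \<longleftrightarrow> digit_series q (2 * s) = q powr (B * f_rec k s)"
proof -
  obtain k' where k: "k = Suc k'" using assms by (cases k) auto
  have f: "0 < f_rec k s" unfolding k using assms by (intro f_rec_pos) auto
  have Z: "0 < digit_series q (2 * s)" using assms by (intro digit_series_pos) auto
  show less: "critical_ratio q k s < B \<longleftrightarrow> digit_series q (2 * s) < q powr (B * f_rec k s)"
    using f Z assms(1) by (simp add: critical_ratio_def divide_less_eq log_less_iff)
  show greater: "B < critical_ratio q k s \<longleftrightarrow> q powr (B * f_rec k s) < digit_series q (2 * s)"
    using f Z assms(1) by (simp add: critical_ratio_def less_divide_eq less_log_iff)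
  show "critical_ratio q k s = B \<longleftrightarrow> digit_series q (2 * s) = q powr (B * f_rec k s)"
    using less greater by (metis linorder_less_linear less_irrefl)
qed

lemma digit_series_strict_antimono:
  assumes "1 < q" "1 < u" "u < v"
  shows "digit_series q v < digit_series q u"
proof -
  have "q powr (u - 1) < q powr (v - 1)" "1 < q powr (u - 1)" using assms by auto
  then show ?thesis unfolding digit_series_def using assms by (intro divide_strict_left_mono) auto
qed

lemma digit_series_2: "1 < q \<Longrightarrow> digit_series q 2 = 1"
  by (simp add: digit_series_def)

text \<open>The numerator decreases strictly and the denominator does not decrease. Comparing the
  quotients needs a nonnegative numerator, which follows from the value 1 of the series at s =
  1.\<close>

lemma critical_ratio_strict_antimono:
  assumes q: "1 < q" and k: "1 \<le> k" and s: "1/2 < s" "s < s'" "s' \<le> 1"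
  shows "critical_ratio q k s' < critical_ratio q k s"
proof -
  obtain k' where k': "k = Suc k'" using k by (cases k) auto
  have f: "0 < f_rec k s" "f_rec k s \<le> f_rec k s'"
    unfolding k' using s by (auto intro!: f_rec_pos f_rec_mono)
  have less: "digit_series q (2 * s') < digit_series q (2 * s)"
    using q s by (intro digit_series_strict_antimono) auto
  have "1 \<le> digit_series q (2 * s')"
    using digit_series_strict_antimono[of q "2 * s'" 2] digit_series_2[OF q] q s
    by (cases "s' = 1") auto
  with less have "log q (digit_series q (2 * s')) < log q (digit_series q (2 * s))"
    "0 \<le> log q (digit_series q (2 * s'))"
    using q by auto
  then show ?thesis
    unfolding critical_ratio_def using f by (intro frac_less) auto
qed

lemma critical_ratio_pos:
  assumes "1 < q" "1 \<le> k" "1/2 < s" "s < 1"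
  shows "0 < critical_ratio q k s"
  using critical_ratio_strict_antimono[of q k s 1] assms
  by (simp add: critical_ratio_def digit_series_2)

lemma exists_critical_ratio_eq:
  assumes q: "1 < q" and k: "1 \<le> k" and B: "0 < B"
  shows "\<exists>s. 1/2 < s \<and> s < 1 \<and> critical_ratio q k s = B"
proof -
  obtain k' where k': "k = Suc k'" using k by (cases k) auto
  \<comment> \<open>Cleared of denominators, the equation reads P s = q - 1. P is continuous also at
    1/2, where the series has a pole, and vanishes there.\<close>
  define P where "P s = q powr (B * f_rec k s) * (q powr (2 * s - 1) - 1)" for s
  have "continuous_on {1/2..1} (f_rec k)"
    unfolding k' by (rule continuous_on_f_rec) auto
  then have "continuous_on {1/2..1} P"
    unfolding P_def using q by (intro continuous_intros) auto
  moreover have "P (1/2) < q - 1" using q by (simp add: P_def)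
  moreover have P1: "q - 1 < P 1"
  proof -
    have "0 < f_rec k 1" unfolding k' by (intro f_rec_pos) auto
    then have "1 < q powr (B * f_rec k 1)" using q B by simp
    then have "1 * (q - 1) < q powr (B * f_rec k 1) * (q - 1)" using q by (intro mult_strict_right_mono) auto
    then show ?thesis using q by (simp add: P_def)
  qed
  ultimately obtain s where s: "1/2 \<le> s" "s \<le> 1" "P s = q - 1"
    using IVT'[of P "1/2" "q - 1" 1] by auto
  then have s': "1/2 < s" "s < 1"
    using \<open>P (1/2) < q - 1\<close> P1 by (metis less_irrefl order_less_le)+
  have "1 < q powr (2 * s - 1)" using q s' by simp
  then have "digit_series q (2 * s) = q powr (B * f_rec k s)"
    using s(3) by (simp add: digit_series_def P_def field_simps)
  then have "critical_ratio q k s = B" using q k s' by (subst critical_ratio_eq_iff) auto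
  with s' show ?thesis by blast
qed

text \<open>Above 1/2 the sum is the closed form divided by q^(B f); for s \<le> 1/2 the summands
  stay above a positive constant, so the series diverges.\<close>

lemma solves_eq_iff:
  assumes q: "1 < q" and k: "1 \<le> k"
  shows "solves_eq q k B s \<longleftrightarrow> 1/2 < s \<and> s \<le> 1 \<and> critical_ratio q k s = B"
proof -
  define X where "X = q powr (B * f_rec k s)"
  have X: "0 < X" using q by (simp add: X_def)
  have summand: "(let i = Suc j in (q - 1) * q ^ i / q powr (2 * real i * s + B * f_rec k s)) =
      (q - 1) * q powr (real (Suc j) * (1 - 2 * s)) / X" for j
  proof -
    have "q ^ Suc j = q powr real (Suc j)" using q by (simp only: powr_realpow)
    then have "q ^ Suc j / q powr (2 * real (Suc j) * s + B * f_rec k s) =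
        q powr (real (Suc j) * (1 - 2 * s)) / X"
      by (simp add: X_def powr_diff[symmetric] algebra_simps del: power_Suc of_nat_Suc)
    then show ?thesis by (simp only: Let_def times_divide_eq_right[symmetric])
  qed
  have eq: "solves_eq q k B s \<longleftrightarrow> 0 \<le> s \<and> s \<le> 1 \<and>
      (\<lambda>j. (q - 1) * q powr (real (Suc j) * (1 - 2 * s)) / X) sums 1"
    by (simp only: solves_eq_def summand)
  show ?thesis
  proof (cases "1/2 < s")
    case True
    have "(\<lambda>j. (q - 1) * q powr (real (Suc j) * (1 - 2 * s)) / X) sums (digit_series q (2 * s) / X)"
      using digit_series_sums[of q "2 * s"] q True by (intro sums_divide) auto
    then have "(\<lambda>j. (q - 1) * q powr (real (Suc j) * (1 - 2 * s)) / X) sums 1 \<longleftrightarrow> digit_series q (2 * s) / X = 1"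
      using sums_unique2 by metis
    also have "\<dots> \<longleftrightarrow> digit_series q (2 * s) = X" using X by (auto simp: divide_eq_1_iff)
    finally show ?thesis
      unfolding eq using True critical_ratio_eq_iff[OF q k True, of B] by (auto simp: X_def)
  next
    case False
    have "\<not> (\<lambda>j. (q - 1) * q powr (real (Suc j) * (1 - 2 * s)) / X) sums 1"
    proof
      assume "(\<lambda>j. (q - 1) * q powr (real (Suc j) * (1 - 2 * s)) / X) sums 1"
      then have "(\<lambda>j. (q - 1) * q powr (real (Suc j) * (1 - 2 * s)) / X) \<longlonglongrightarrow> 0"
        by (intro summable_LIMSEQ_zero sums_summable)
      moreover have "(q - 1) * 1 / X \<le> (q - 1) * q powr (real (Suc j) * (1 - 2 * s)) / X" for j
        using q X False by (intro divide_right_mono mult_left_mono ge_one_powr_ge_zero) auto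
      ultimately have "(q - 1) * 1 / X \<le> 0" by (intro LIMSEQ_le_const) auto
      then show False using q X by (simp add: divide_le_0_iff)
    qed
    then show ?thesis unfolding eq using False by blast
  qed
qed

section \<open>The dimension of the exceptional set\<close>

lemma hausdorff_dim_nonneg: "0 \<le> hausdorff_dim d E"
  unfolding hausdorff_dim_def by (rule Inf_greatest) auto

lemma frequently_less_of_liminf_less:
  fixes f :: "nat \<Rightarrow> ereal"
  assumes "liminf f < x"
  shows "\<exists>\<^sub>\<infinity>n. f n < x"
proof (rule ccontr)
  assume "\<not> ?thesis"
  then have "eventually (\<lambda>n. x \<le> f n) sequentially"
    by (simp add: frequently_def not_less cofinite_eq_sequentially)
  then have "x \<le> liminf f" by (rule Liminf_bounded)
  with assms show False by simp
qed

text \<open>The strict inequality leaves room for a real B' below the liminf. An infinite B is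
  allowed and gives the bound for every s in (1/2, 1], which settles the case b = 1 below.\<close>

lemma hausdorff_dim_F_set_le_of_critical_ratio:
  assumes k: "1 \<le> k" and B: "0 < B" "B = liminf (\<lambda>n. ereal (\<Phi> n / real n))"
    and s: "1/2 < s" "s \<le> 1" and less: "ereal (critical_ratio (real CARD('a)) k s) < B"
  shows "hausdorff_dim fls_rho (F_set k \<Phi> :: 'a::{field,finite} fls set) \<le> ereal s"
proof -
  have q: "1 < real CARD('a)" by (rule card_field_gt_1)
  have "max 0 (ereal (critical_ratio (real CARD('a)) k s)) < B" using B(1) less by simp
  then obtain B' where B': "max 0 (ereal (critical_ratio (real CARD('a)) k s)) < ereal B'" "ereal B' < B"
    using ereal_dense2 by blast
  have B'': "0 < B'" "critical_ratio (real CARD('a)) k s < B'" using B'(1) by auto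
  have "eventually (\<lambda>n. ereal B' < ereal (\<Phi> n / real n)) sequentially"
    using B'(2) unfolding B(2) by (rule less_LiminfD)
  then have "eventually (\<lambda>n. B' * real n \<le> \<Phi> n) sequentially"
    using eventually_gt_at_top[of 0]
  proof eventually_elim
    case (elim n)
    then show ?case by (simp add: less_divide_eq)
  qed
  then obtain N where N: "\<And>n. N \<le> n \<Longrightarrow> B' * real n \<le> \<Phi> n" by (auto simp: eventually_sequentially)
  show ?thesis
  proof (rule hausdorff_dim_F_set_le[OF k s])
    show "0 \<le> B'" using B'' by simp
    show "digit_series (real CARD('a)) (2 * s) < real CARD('a) powr (B' * f_rec k s)"
      using B'' critical_ratio_less_iff[OF q k s] by simp
  qed (rule N)
qed

lemma hausdorff_dim_F_set_ge_of_critical_ratio: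
  assumes k: "1 \<le> k" and B: "0 \<le> B" "B = liminf (\<lambda>n. ereal (\<Phi> n / real n))"
    and s: "1/2 < s" "s \<le> 1" and less: "B < ereal (critical_ratio (real CARD('a)) k s)"
  shows "ereal s \<le> hausdorff_dim fls_rho (F_set k \<Phi> :: 'a::{field,finite} fls set)"
proof -
  have q: "1 < real CARD('a)" by (rule card_field_gt_1)
  obtain B1 where B1: "B < ereal B1" "ereal B1 < ereal (critical_ratio (real CARD('a)) k s)"
    using ereal_dense2[OF less] by blast
  \<comment> \<open>\<Phi> n \<le> B1 n holds infinitely often, and the surplus B2 - B1 makes sparse
    blocks affordable.\<close>
  then obtain B2 where B2: "B1 < B2" "B2 < critical_ratio (real CARD('a)) k s"
    using dense by auto
  have "0 \<le> ereal B1" using B(1) B1(1) by (metis less_imp_le order.trans)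
  then have B10: "0 \<le> B1" by simp
  have "\<exists>\<^sub>\<infinity>n. ereal (\<Phi> n / real n) < ereal B1"
    using B1(1) unfolding B(2) by (rule frequently_less_of_liminf_less)
  moreover have "\<forall>\<^sub>\<infinity>n. 0 < (n :: nat)" unfolding MOST_nat by auto
  ultimately have "\<exists>\<^sub>\<infinity>n. ereal (\<Phi> n / real n) < ereal B1 \<and> 0 < n" by (rule INFM_conjI)
  then have "\<exists>\<^sub>\<infinity>n. \<Phi> n \<le> B1 * real n"
    by (rule INFM_mono) (auto simp: divide_less_eq)
  then show ?thesis
    using B2 critical_ratio_less_iff[OF q k s] less_critical_ratio_iff[OF q k s]
    by (intro hausdorff_dim_F_set_ge[OF k s B10 B2(1)]) auto
qed

lemma ext_ln_mono_ereal:
  assumes "1 \<le> b" "0 < c"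
  shows "ereal (ln c) < ext_ln b \<longleftrightarrow> ereal c < b" "ext_ln b < ereal (ln c) \<longleftrightarrow> b < ereal c"
  using assms by (cases b; simp add: ext_ln_def)+

text \<open>If b = 1, no exponential lower bound on \<Phi> with base above 1 is available, but then
  s > 1/2 and the superlinear growth suffices. Otherwise there are 1 < c' < c < b with 1 / (1 + c')
  < s.\<close>

lemma hausdorff_dim_F_set_le_of_growth:
  assumes k: "1 \<le> k" and \<Phi>: "\<And>n. n \<ge> 1 \<Longrightarrow> \<Phi> n \<ge> real k"
    and B: "liminf (\<lambda>n. ereal (\<Phi> n / real n)) = \<infinity>"
    and b: "1 \<le> b" "ext_ln b = liminf (\<lambda>n. ereal (ln (\<Phi> n) / real n))"
    and s: "0 < s" "s < 1" "1 / ereal s - 1 < b"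
  shows "hausdorff_dim fls_rho (F_set k \<Phi> :: 'a::{field,finite} fls set) \<le> ereal s"
proof (cases "b = 1")
  case True
  have "ereal (1 / s - 1) < ereal 1"
    using s True by (simp add: one_ereal_def)
  then have "1/2 < s" using s by (simp add: field_simps)
  then show ?thesis
    using s B by (intro hausdorff_dim_F_set_le_of_critical_ratio[OF k, of \<infinity>]) auto
next
  case False
  with b(1) have b1: "ereal 1 < b" by (simp add: one_ereal_def order_less_le)
  have "ereal (1 / s - 1) < b" using s by (simp add: one_ereal_def)
  with b1 have "ereal (max 1 (1 / s - 1)) < b" by (simp add: max_def)
  then obtain c where c: "ereal (max 1 (1 / s - 1)) < ereal c" "ereal c < b"
    using ereal_dense2 by blast
  have "max 1 (1 / s - 1) < c" using c(1) by (simp only: less_ereal.simps)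
  then obtain c' where c': "max 1 (1 / s - 1) < c'" "c' < c" using dense by blast
  have "ereal (ln c) < liminf (\<lambda>n. ereal (ln (\<Phi> n) / real n))"
    using c c' b ext_ln_mono_ereal(1)[of b c] by simp
  then have "eventually (\<lambda>n. ereal (ln c) < ereal (ln (\<Phi> n) / real n)) sequentially"
    by (rule less_LiminfD)
  then have "eventually (\<lambda>n. c ^ n \<le> \<Phi> n) sequentially"
    using eventually_ge_at_top[of 1]
  proof eventually_elim
    case (elim n)
    have "0 < \<Phi> n" using \<Phi>[of n] elim k by simp
    have "ln (c ^ n) \<le> ln (\<Phi> n)"
      using elim c' by (simp add: ln_realpow less_divide_eq mult.commute)
    then show ?case using \<open>0 < \<Phi> n\<close> c' by simp
  qed
  then obtain N where "\<And>n. N \<le> n \<Longrightarrow> c ^ n \<le> \<Phi> n" by (auto simp: eventually_sequentially)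
  moreover have "1 / (1 + c') < s"
    using c'(1) s(1) by (simp add: field_simps)
  ultimately show ?thesis
    using k c' by (intro hausdorff_dim_F_set_exponential_le[of k c' c]) auto
qed

lemma hausdorff_dim_F_set_ge_of_growth:
  assumes k: "1 \<le> k" and \<Phi>: "\<And>n. n \<ge> 1 \<Longrightarrow> \<Phi> n \<ge> real k"
    and b: "1 \<le> b" "ext_ln b = liminf (\<lambda>n. ereal (ln (\<Phi> n) / real n))" and c: "b < ereal c"
  shows "ereal (1 / (1 + c)) \<le> hausdorff_dim fls_rho (F_set k \<Phi> :: 'a::{field,finite} fls set)"
proof (rule hausdorff_dim_F_set_exponential_ge[OF k])
  have "ereal 1 < ereal c" using b(1) c by (metis le_less_trans one_ereal_def)
  then show c1: "1 < c" by simp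
  have "liminf (\<lambda>n. ereal (ln (\<Phi> n) / real n)) < ereal (ln c)"
    using b c c1 ext_ln_mono_ereal(2)[of b c] by simp
  then have "\<exists>\<^sub>\<infinity>n. ereal (ln (\<Phi> n) / real n) < ereal (ln c)" by (rule frequently_less_of_liminf_less)
  moreover have "\<forall>\<^sub>\<infinity>n. 0 < (n :: nat)" unfolding MOST_nat by auto
  ultimately have "\<exists>\<^sub>\<infinity>n. ereal (ln (\<Phi> n) / real n) < ereal (ln c) \<and> 0 < n" by (rule INFM_conjI)
  then show "\<exists>\<^sub>\<infinity>n. \<Phi> n \<le> c ^ n"
  proof (rule INFM_mono)
    fix n assume n: "ereal (ln (\<Phi> n) / real n) < ereal (ln c) \<and> 0 < n"
    then have "0 < \<Phi> n" using \<Phi>[of n] k by simp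
    have "ln (\<Phi> n) < ln c * real n" using n by (simp add: pos_divide_less_eq[symmetric])
    then have "ln (\<Phi> n) \<le> ln (c ^ n)" using c1 by (simp add: ln_realpow mult.commute)
    then show "\<Phi> n \<le> c ^ n" using \<open>0 < \<Phi> n\<close> c1 by simp
  qed
qed

theorem theorem1p2:
  fixes k :: nat and \<Phi> :: "nat \<Rightarrow> real" and B b :: ereal
  assumes "k \<ge> 1"
    and "\<And>n. n \<ge> 1 \<Longrightarrow> \<Phi> n \<ge> real k"
    and "B = liminf (\<lambda>n. ereal (\<Phi> n / real n))"
    and "b \<ge> 1"
    and "ext_ln b = liminf (\<lambda>n. ereal (ln (\<Phi> n) / real n))"
  defines "q \<equiv> real CARD('a::{field,finite})"
  defines "D \<equiv> hausdorff_dim fls_rho (F_set k \<Phi> :: 'a fls set)"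
  shows "(B = 0 \<longrightarrow> D = 1) \<and>
         (B = \<infinity> \<longrightarrow> D = (if b = \<infinity> then 0 else 1 / (1 + b))) \<and>
         (0 < B \<and> B < \<infinity> \<longrightarrow>
            (\<exists>!s. solves_eq q k (real_of_ereal B) s) \<and>
            1 / 2 < s_dim q k (real_of_ereal B) \<and> s_dim q k (real_of_ereal B) < 1 \<and>
            D = ereal (s_dim q k (real_of_ereal B)))"
proof (intro conjI impI)
  note k = assms(1) and \<Phi> = assms(2) and B = assms(3) and b = assms(4,5)
  have q: "1 < q" unfolding q_def by (rule card_field_gt_1)
  show "D = 1" if "B = 0"
  proof (rule antisym)
    show "D \<le> 1" unfolding D_def using k by (rule hausdorff_dim_F_set_le_1)
    \<comment> \<open>The critical ratio is positive for s < 1, hence above B = 0.\<close>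
    have "ereal s \<le> D" if "1/2 < s" "s < 1" for s
      unfolding D_def using that critical_ratio_pos[OF q k] B \<open>B = 0\<close>
      by (intro hausdorff_dim_F_set_ge_of_critical_ratio[OF k, of B]) (auto simp: q_def)
    then have *: "s \<in> {1/2<..<1} \<Longrightarrow> ereal s \<le> D" for s by auto
    show "1 \<le> D"
    proof (rule dense_le_bounded[of "ereal (1/2)"])
      show "ereal (1/2) < 1" by (simp add: one_ereal_def)
      fix w assume w: "ereal (1/2) < w" "w < 1"
      then obtain s where "w = ereal s" by (cases w) auto
      with w * show "w \<le> D" by (simp add: one_ereal_def)
    qed
  qed
  show "D = (if b = \<infinity> then 0 else 1 / (1 + b))" if "B = \<infinity>"
  proof -
    have upper: "D \<le> ereal s" if "0 < s" "s < 1" "1 / ereal s - 1 < b" for s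
      unfolding D_def using k \<Phi> B \<open>B = \<infinity>\<close> b that
      by (intro hausdorff_dim_F_set_le_of_growth[of k \<Phi> b]) auto
    have lower: "ereal (1 / (1 + c)) \<le> D" if "b < ereal c" for c
      unfolding D_def using k \<Phi> b that by (rule hausdorff_dim_F_set_ge_of_growth)
    show ?thesis
    proof (cases "b = \<infinity>")
      case True
      have "D \<le> 0"
      proof (rule dense_ge_bounded[of 0 1])
        fix w :: ereal assume w: "0 < w" "w < 1"
        then obtain s where "w = ereal s" by (cases w) auto
        with w True upper[of s] show "D \<le> w" by (simp add: one_ereal_def)
      qed simp
      with True hausdorff_dim_nonneg[of fls_rho "F_set k \<Phi> :: 'a fls set"] show ?thesis
        by (simp add: D_def)
    next
      case False
      then obtain \<beta> where \<beta>: "b = ereal \<beta>" "1 \<le> \<beta>" using b(1) by (cases b) auto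
      have "D \<le> ereal (1 / (1 + \<beta>))"
      proof (rule dense_ge_bounded[of _ 1])
        show "ereal (1 / (1 + \<beta>)) < 1" using \<beta> by (simp add: one_ereal_def)
        fix w :: ereal assume w: "ereal (1 / (1 + \<beta>)) < w" "w < 1"
        then obtain s where s: "w = ereal s" by (cases w) auto
        have s': "1 / (1 + \<beta>) < s" "s < 1" using w by (auto simp: s)
        moreover have "0 < 1 / (1 + \<beta>)" using \<beta> by simp
        ultimately have s0: "0 < s" by linarith
        have "1 / s - 1 < \<beta>" using s' s0 \<beta> by (simp add: field_simps)
        then show "D \<le> w" unfolding s using s0 s' \<beta> by (intro upper) (auto simp: one_ereal_def)
      qed
      moreover have "ereal (1 / (1 + \<beta>)) \<le> D"
      proof (rule dense_le_bounded[of 0])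
        show "0 < ereal (1 / (1 + \<beta>))" using \<beta> by simp
        fix w :: ereal assume w: "0 < w" "w < ereal (1 / (1 + \<beta>))"
        then obtain s where s: "w = ereal s" by (cases w) auto
        have s': "0 < s" "s < 1 / (1 + \<beta>)" using w by (auto simp: s)
        then have "\<beta> < 1 / s - 1" using \<beta> by (simp add: field_simps)
        \<comment> \<open>The base c = 1 / s - 1 exceeds b and turns 1 / (1 + c) into s.\<close>
        then have "ereal (1 / (1 + (1 / s - 1))) \<le> D" using \<beta> by (intro lower) simp
        then show "w \<le> D" using s' by (simp add: s)
      qed
      ultimately have "D = ereal (1 / (1 + \<beta>))" by (rule antisym)
      then show ?thesis using \<beta> by (simp add: one_ereal_def)
    qed
  qed
  assume Bpos: "0 < B \<and> B < \<infinity>"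
  define r where "r = real_of_ereal B"
  have Br: "B = ereal r" "0 < r" using Bpos by (cases B; simp add: r_def)+
  obtain s where s: "1/2 < s" "s < 1" "critical_ratio q k s = r"
    using exists_critical_ratio_eq[OF q k Br(2)] by blast
  have uniq: "s' = s" if "solves_eq q k r s'" for s'
    using that s critical_ratio_strict_antimono[OF q k, of s s'] critical_ratio_strict_antimono[OF q k, of s' s]
    unfolding solves_eq_iff[OF q k] by (cases s s' rule: linorder_cases) auto
  have solves: "solves_eq q k r s" using s by (simp add: solves_eq_iff[OF q k])
  have s_dim: "s_dim q k r = s"
    unfolding s_dim_def using solves uniq by (rule the_equality)
  show "\<exists>!s. solves_eq q k (real_of_ereal B) s"
    unfolding r_def[symmetric] using solves uniq by blast
  show "1/2 < s_dim q k (real_of_ereal B)" "s_dim q k (real_of_ereal B) < 1"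
    unfolding r_def[symmetric] s_dim using s by auto
  \<comment> \<open>Strict monotonicity puts the critical ratio of t below r for t > s and above r
    for t < s, so the two bounds apply arbitrarily close to s.\<close>
  have upper: "D \<le> ereal t" if "s < t" "t \<le> 1" for t
    unfolding D_def using that s Br B critical_ratio_strict_antimono[OF q k, of s t]
    by (intro hausdorff_dim_F_set_le_of_critical_ratio[OF k, of B]) (auto simp: q_def)
  have lower: "ereal t \<le> D" if "1/2 < t" "t < s" for t
    unfolding D_def using that s Br B critical_ratio_strict_antimono[OF q k, of t s]
    by (intro hausdorff_dim_F_set_ge_of_critical_ratio[OF k, of B]) (auto simp: q_def)
  have "D \<le> ereal s"
  proof (rule dense_ge_bounded[of _ "ereal 1"])
    fix w :: ereal assume w: "ereal s < w" "w < ereal 1"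
    then obtain t where "w = ereal t" by (cases w) auto
    with w upper[of t] show "D \<le> w" by simp
  qed (use s in simp)
  moreover have "ereal s \<le> D"
  proof (rule dense_le_bounded[of "ereal (1/2)"])
    fix w :: ereal assume w: "ereal (1/2) < w" "w < ereal s"
    then obtain t where "w = ereal t" by (cases w) auto
    with w lower[of t] show "w \<le> D" by simp
  qed (use s in simp)
  ultimately show "D = ereal (s_dim q k (real_of_ereal B))"
    unfolding r_def[symmetric] s_dim by (rule antisym)
qed

end
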